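(* Let $\beta\in(1,2)$. The map $\tilde\psi:E\cup\overline E\to E\cup\overline E$ defined by $\tilde\psi=Q\circ\psi$, with the (normalised) measure $\tilde\lambda$ on $E\cup\overline E$ and the projection $(\omega,x,y)\mapsto(\omega,x)$ as factor map, is a natural extension of $(\Omega\times I_\beta,R_\beta,\hat\mu_\beta)$.
   Context: **Setting.** Let $\beta\in(1,2)$, $I_\beta=\left[0,\frac1{\beta-1}\right]$, $L=\left[0,\frac1\beta\right)$, $S=\left[\frac1\beta,\frac1{\beta(\beta-1)}\right]$, $R=\left(\frac1{\beta(\beta-1)},\frac1{\beta-1}\right]$, $T_0(x)=\beta x$, $T_1(x)=\beta x-1$, $\Omega=\{0,1\}^{\mathbb N}$ with left shift $\sigma$, $m$ the $(\frac12,\frac12)$ Bernoulli measure on $\Omega$, $\lambda$ Lebesgue measure on $\mathbb R$. For $i\in\{0,1\}$ put $R_{\beta,i}(x)=T_0(x)$ if $x\in L$, $T_i(x)$ if $x\in S$, $T_1(x)$ if $x\in R$; $R_\beta:\Omega\times I_\beta\to\Omega\times I_\beta$ is $R_\beta(\omega,x)=(\sigma(\omega),R_{\beta,\omega_1}(x))$. $\hat\mu_\beta=m\times\mu_\beta$ is the $R_\beta$-invariant probability measure (found by Dajani and de Vries) with $\mu_\beta$ absolutely continuous with respect to Lebesgue measure. **The tower $E$.** For a word $\omega_1\cdots\omega_n\in\{0,1\}^n$, $n\ge 0$, let $r(\omega_1\cdots\omega_n)=R_{\beta,\omega_n}\circ\cdots\circ R_{\beta,\omega_1}(1)$ (so $r=1$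 for the empty word). For $n\ge1$ let $l(\omega_1\cdots\omega_n)=1+\sum_{i=1}^n\omega_i2^{i-1}\in\{1,\dots,2^n\}$ and $v(\omega_1\cdots\omega_n)=\sum_{k=0}^{n-1}\beta^{-k}+\frac{l(\omega_1\cdots\omega_n)-1}{(2\beta)^n}$; for the empty word $v=0$. Put \[E_{\omega_1\cdots\omega_n}=\Omega\times[0,r(\omega_1\cdots\omega_n)]\times\left[v(\omega_1\cdots\omega_n),v(\omega_1\cdots\omega_n)+\tfrac1{(2\beta)^n}\right),\] where for the empty word this is $E_{base}=\Omega\times[0,1]\times[0,1)$, and let $E$ be the union of $E_{base}$ and all $E_{\omega_1\cdots\omega_n}$, $n\ge1$. Points of $E_{\omega_1\cdots\omega_n}$ are written $(\sigma^n(\omega),x,y)$ with $\omega\in\Omega$ having prefix $\omega_1\cdots\omega_n$; thus $\omega_{n+1}$ is the first symbol of the first coordinate. **The map $\psi$ on $E$.** Let $(\sigma^n(\omega),x,y)\in E_{\omega_1\cdots\omega_n}$, $n\ge0$, and $C_1(\omega_1\cdots\omega_{n+1})=v(\omega_1\cdots\omega_{n+1})-\frac{v(\omega_1\cdots\omega_n)}{2\beta}$. Case 1: if $R_{\beta,\omega_{n+1}}$ acts on $r(\omega_1\cdots\omega_n)$ by $T_0$, then $\psi(\sigma^n(\omega),x,y)=(\sigma^{n+1}(\omega),T_0(x),\frac{y}{2\beta}+C_1(\omega_1\cdots\omega_{n+1}))$. Case 2: if it acts by $T_1$, then $\psi(\sigma^n(\omega),x,y)=(\sigma^{n+1}(\omega),T_1(x),\frac{y}{2\beta}+C_1(\omega_1\cdots\omega_{n+1}))$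 when $x\in S\cup R$, and $\psi(\sigma^n(\omega),x,y)=(\sigma^{n+1}(\omega),T_0(x),\frac{y}{2\beta}+C_2(\omega_1\cdots\omega_{n+1}))$ when $x\in L$, where \[C_2(\omega_1\cdots\omega_{n+1})=\sum\frac1{(2\beta)^{m+1}}-\frac{v(\omega_1\cdots\omega_n)}{2\beta},\] the sum being over all words $a_1\cdots a_{m+1}$, $m\ge0$, with $r(a_1\cdots a_{m+1})=T_1(r(a_1\cdots a_m))$ and either $v(a_1\cdots a_m)<v(\omega_1\cdots\omega_n)$, or $a_1\cdots a_m=\omega_1\cdots\omega_n$ and $a_{m+1}<\omega_{n+1}$. (So the pieces mapped into $E_{base}$ are horizontal strips stacked exactly on top of each other.) **The second tower and $Q$.** For $\omega\in\Omega$ or a finite word, $\overline\omega$ is given by $\overline{\omega_i}=1-\omega_i$. Let $P(\omega,x,y)=(\overline\omega,\frac1{\beta-1}-x,-y)$ and $\overline E=P(E)$. $E$ and $\overline E$ are regarded as disjoint (they meet only in a null set in $\{y=0\}$). Extend $\psi$ to $\overline E$ by $\psi=P\circ\psi\circ P^{-1}$. For $n\ge0$ let $F_{\omega_1\cdots\omega_n}=\{(\sigma^n(\omega),x,y)\in E_{\omega_1\cdots\omega_n}:\omega_{n+1}=0,\ x\in S\}$ if $r(\omega_1\cdots\omega_n)\in R$, and $F_{\omega_1\cdots\omega_n}=\emptyset$ otherwise; let $\overline F_{\overline{\omega_1}\cdots\overline{\omega_n}}=P(F_{\omega_1\cdots\omega_n})$. Define $Q$ on $E\cup\overline E$ by: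 $Q(\eta,x,y)=(\eta,x+1,-y)$ if $(\eta,x,y)\in\psi(F_w)\subset E$ for some finite word $w$; $Q(\eta,x,y)=(\eta,x-1,-y)$ if $(\eta,x,y)\in\psi(\overline F_{w})\subset\overline E$ for some finite word $w$; $Q(\eta,x,y)=(\eta,x,y)$ otherwise. (Points of $E$ moved by $Q$ go to $\overline E$ and vice versa.) **Measure and terminology.** $\tilde\lambda=(m\times\lambda\times\lambda)|_{E\cup\overline E}$, a finite measure, normalised to a probability measure when compared with $\hat\mu_\beta$. A natural extension of a measure preserving system $(Y,T,\mu)$ is, in the usual sense and modulo null sets, an invertible measure preserving system $(\tilde Y,\tilde T,\tilde\mu)$ with a factor map $\pi:\tilde Y\to Y$ ($\pi\circ\tilde T=T\circ\pi$, $\tilde\mu\circ\pi^{-1}=\mu$) such that the $\sigma$-algebras $\tilde T^{k}\pi^{-1}\mathcal B_Y$, $k\ge0$, together generate the $\sigma$-algebra of $\tilde Y$. *)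

theory Defs
  imports "HOL-Probability.Probability"
begin

section \<open>Natural extensions\<close>

definition mp_system :: "'a measure \<Rightarrow> ('a \<Rightarrow> 'a) \<Rightarrow> bool" where
  "mp_system M T \<longleftrightarrow> prob_space M \<and> T \<in> M \<rightarrow>\<^sub>M M \<and> distr M M T = M"

definition factor_map :: "'b measure \<Rightarrow> ('b \<Rightarrow> 'b) \<Rightarrow> ('b \<Rightarrow> 'a) \<Rightarrow> 'a measure \<Rightarrow> ('a \<Rightarrow> 'a) \<Rightarrow> bool" where
  "factor_map N S p M T \<longleftrightarrow>
     p \<in> N \<rightarrow>\<^sub>M M \<and> distr N M p = M \<and> (AE z in N. p (S z) = T (p z))"

definition invertible_on :: "'b measure \<Rightarrow> ('b \<Rightarrow> 'b) \<Rightarrow> 'b set \<Rightarrow> bool" where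
  "invertible_on N S X \<longleftrightarrow>
     X \<in> sets N \<and> space N - X \<in> null_sets N \<and> bij_betw S X X \<and>
     the_inv_into X S \<in> restrict_space N X \<rightarrow>\<^sub>M restrict_space N X"

text \<open>
  Everything is meant modulo null sets. In particular, the images of the sets of the pulled-back
  \<open>\<sigma>\<close>-algebra are formed inside a set \<open>X\<close> of full measure on which \<open>S\<close> is an invertible
  measurable transformation; on the discarded null set images under \<open>S\<close> need not be null.
\<close>

definition natural_extension ::
  "'b measure \<Rightarrow> ('b \<Rightarrow> 'b) \<Rightarrow> ('b \<Rightarrow> 'a) \<Rightarrow> 'a measure \<Rightarrow> ('a \<Rightarrow> 'a) \<Rightarrow> bool" where
  "natural_extension N S p M T \<longleftrightarrow>
     mp_system M T \<and> mp_system N S \<and> factor_map N S p M T \<and>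
     (\<exists>X. invertible_on N S X \<and>
        (\<forall>A\<in>sets N.
           \<exists>B\<in>sigma_sets X {(S ^^ k) ` (p -` C \<inter> X) | k C. C \<in> sets M}.
             sym_diff A B \<in> null_sets N))"

definition normalised :: "'a measure \<Rightarrow> 'a measure" where
  "normalised N = scale_measure (1 / emeasure N (space N)) N"


section \<open>The random \<open>\<beta>\<close>-transformation\<close>

text \<open>
  The digits \<open>0\<close> and \<open>1\<close> are \<^const>\<open>False\<close> and \<^const>\<open>True\<close>. The space \<open>\<Omega>\<close> is the type
  \<^typ>\<open>bool stream\<close>, the left shift is \<^const>\<open>stl\<close>, and \<open>\<omega>\<^sub>1\<close> is \<^term>\<open>shd \<omega>\<close>.
\<close>

definition bernoulli_measure :: "bool stream measure" where
  "bernoulli_measure = stream_space (measure_pmf (bernoulli_pmf (1/2)))"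

definition I_beta :: "real \<Rightarrow> real set" where
  "I_beta \<beta> = {0 .. 1 / (\<beta> - 1)}"

definition reg_L :: "real \<Rightarrow> real set" where
  "reg_L \<beta> = {0 ..< 1 / \<beta>}"

definition reg_S :: "real \<Rightarrow> real set" where
  "reg_S \<beta> = {1 / \<beta> .. 1 / (\<beta> * (\<beta> - 1))}"

definition reg_R :: "real \<Rightarrow> real set" where
  "reg_R \<beta> = {1 / (\<beta> * (\<beta> - 1)) <.. 1 / (\<beta> - 1)}"

definition T0 :: "real \<Rightarrow> real \<Rightarrow> real" where
  "T0 \<beta> x = \<beta> * x"

definition T1 :: "real \<Rightarrow> real \<Rightarrow> real" where
  "T1 \<beta> x = \<beta> * x - 1"

text \<open>Only the values on \<^const>\<open>I_beta\<close>, the union of the three regions, are relevant.\<close>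

definition R_fibre :: "real \<Rightarrow> bool \<Rightarrow> real \<Rightarrow> real" where
  "R_fibre \<beta> i x =
     (if x \<in> reg_L \<beta> then T0 \<beta> x
      else if x \<in> reg_S \<beta> then (if i then T1 \<beta> x else T0 \<beta> x)
      else T1 \<beta> x)"

definition R_map :: "real \<Rightarrow> bool stream \<times> real \<Rightarrow> bool stream \<times> real" where
  "R_map \<beta> = (\<lambda>(\<omega>, x). (stl \<omega>, R_fibre \<beta> (shd \<omega>) x))"


section \<open>The tower \<open>E\<close>\<close>

definition r :: "real \<Rightarrow> bool list \<Rightarrow> real" where
  "r \<beta> w = fold (R_fibre \<beta>) w 1"

definition l :: "bool list \<Rightarrow> nat" where
  "l w = 1 + (\<Sum>i<length w. of_bool (w ! i) * 2 ^ i)"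

definition v :: "real \<Rightarrow> bool list \<Rightarrow> real" where
  "v \<beta> w = (\<Sum>k<length w. 1 / \<beta> ^ k) + (real (l w) - 1) / (2 * \<beta>) ^ length w"

lemma v_Nil: "v \<beta> [] = 0"
  by (simp add: v_def l_def)

definition piece :: "real \<Rightarrow> bool list \<Rightarrow> (bool stream \<times> real \<times> real) set" where
  "piece \<beta> w = UNIV \<times> {0 .. r \<beta> w} \<times> {v \<beta> w ..< v \<beta> w + 1 / (2 * \<beta>) ^ length w}"

definition E :: "real \<Rightarrow> (bool stream \<times> real \<times> real) set" where
  "E \<beta> = (\<Union>w. piece \<beta> w)"

text \<open>
  For \<open>\<beta> \<in> (1, 2)\<close> the height intervals of the pieces are pairwise disjoint, so a point of
  \<^const>\<open>E\<close> determines the word of its piece.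
\<close>

definition word_of :: "real \<Rightarrow> bool stream \<times> real \<times> real \<Rightarrow> bool list" where
  "word_of \<beta> z = (THE w. z \<in> piece \<beta> w)"

definition C1 :: "real \<Rightarrow> bool list \<Rightarrow> bool \<Rightarrow> real" where
  "C1 \<beta> w i = v \<beta> (w @ [i]) - v \<beta> w / (2 * \<beta>)"

text \<open>
  In \<open>C2\<close> the word \<open>a\<^sub>1 \<dots> a\<^sub>m\<^sub>+\<^sub>1\<close> is \<^term>\<open>a @ [j]\<close>. The index set is finite because
  \<^term>\<open>v \<beta> a < v \<beta> w\<close> forces \<^term>\<open>length a \<le> length w\<close>.
\<close>

definition C2 :: "real \<Rightarrow> bool list \<Rightarrow> bool \<Rightarrow> real" where
  "C2 \<beta> w i =
     (\<Sum>(a, j) \<in> {(a, j). r \<beta> (a @ [j]) = T1 \<beta> (r \<beta> a) \<and>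
                           (v \<beta> a < v \<beta> w \<or> a = w \<and> j < i)}.
        1 / (2 * \<beta>) ^ (length a + 1))
     - v \<beta> w / (2 * \<beta>)"

text \<open>
  The first component \<open>\<eta>\<close> is \<open>\<sigma>\<^sup>n(\<omega>)\<close>, so \<open>\<omega>\<^sub>n\<^sub>+\<^sub>1\<close> is \<^term>\<open>shd \<eta>\<close>. As \<^const>\<open>T0\<close> and \<^const>\<open>T1\<close>
  differ everywhere, an equation between values tells which of the two acts.
\<close>

definition psi_E :: "real \<Rightarrow> bool stream \<times> real \<times> real \<Rightarrow> bool stream \<times> real \<times> real" where
  "psi_E \<beta> = (\<lambda>(\<eta>, x, y).
     let w = word_of \<beta> (\<eta>, x, y); i = shd \<eta> in
     if R_fibre \<beta> i (r \<beta> w) = T0 \<beta> (r \<beta> w)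
     then (stl \<eta>, T0 \<beta> x, y / (2 * \<beta>) + C1 \<beta> w i)
     else if x \<in> reg_S \<beta> \<union> reg_R \<beta>
     then (stl \<eta>, T1 \<beta> x, y / (2 * \<beta>) + C1 \<beta> w i)
     else (stl \<eta>, T0 \<beta> x, y / (2 * \<beta>) + C2 \<beta> w i))"


section \<open>The second tower and the maps \<open>\<psi>\<close> and \<open>Q\<close>\<close>

definition P :: "real \<Rightarrow> bool stream \<times> real \<times> real \<Rightarrow> bool stream \<times> real \<times> real" where
  "P \<beta> = (\<lambda>(\<eta>, x, y). (smap Not \<eta>, 1 / (\<beta> - 1) - x, - y))"

lemma P_P: "P \<beta> (P \<beta> z) = z"
  by (cases z) (simp add: P_def stream.map_comp stream.map_ident comp_def)

definition E_bar :: "real \<Rightarrow> (bool stream \<times> real \<times> real) set" where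
  "E_bar \<beta> = P \<beta> ` E \<beta>"

text \<open>The map \<open>P \<circ> \<psi> \<circ> P\<^sup>-\<^sup>1\<close>; by \<open>P_P\<close>, \<open>P\<^sup>-\<^sup>1 = P\<close>.\<close>

definition psi_E_bar :: "real \<Rightarrow> bool stream \<times> real \<times> real \<Rightarrow> bool stream \<times> real \<times> real" where
  "psi_E_bar \<beta> = P \<beta> \<circ> psi_E \<beta> \<circ> P \<beta>"

text \<open>
  \<^const>\<open>E\<close> and \<^const>\<open>E_bar\<close> are regarded as disjoint. They meet only in a null set contained in
  \<open>{y = 0}\<close>; its points are counted as points of \<^const>\<open>E\<close>.
\<close>

definition psi :: "real \<Rightarrow> bool stream \<times> real \<times> real \<Rightarrow> bool stream \<times> real \<times> real" where
  "psi \<beta> z = (if z \<in> E \<beta> then psi_E \<beta> z else psi_E_bar \<beta> z)"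

definition F :: "real \<Rightarrow> bool list \<Rightarrow> (bool stream \<times> real \<times> real) set" where
  "F \<beta> w = (if r \<beta> w \<in> reg_R \<beta>
             then {(\<eta>, x, y). (\<eta>, x, y) \<in> piece \<beta> w \<and> \<not> shd \<eta> \<and> x \<in> reg_S \<beta>} else {})"

definition F_bar :: "real \<Rightarrow> bool list \<Rightarrow> (bool stream \<times> real \<times> real) set" where
  "F_bar \<beta> w = P \<beta> ` F \<beta> (map Not w)"

text \<open>
  Here \<open>\<psi>(F\<^sub>w)\<close> and its mirror image are formed with the branch of \<open>\<psi>\<close> belonging to the tower that
  contains the set. The two conditions exclude each other: the former set lies in \<open>{y \<ge> 1}\<close>, the
  latter in \<open>{y \<le> -1}\<close>.
\<close>

definition Q :: "real \<Rightarrow> bool stream \<times> real \<times> real \<Rightarrow> bool stream \<times> real \<times> real" where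
  "Q \<beta> = (\<lambda>(\<eta>, x, y).
     if (\<eta>, x, y) \<in> (\<Union>w. psi_E \<beta> ` F \<beta> w) then (\<eta>, x + 1, - y)
     else if (\<eta>, x, y) \<in> (\<Union>w. psi_E_bar \<beta> ` F_bar \<beta> w) then (\<eta>, x - 1, - y)
     else (\<eta>, x, y))"

definition psi_tilde :: "real \<Rightarrow> bool stream \<times> real \<times> real \<Rightarrow> bool stream \<times> real \<times> real" where
  "psi_tilde \<beta> = Q \<beta> \<circ> psi \<beta>"

definition lambda_tilde :: "real \<Rightarrow> (bool stream \<times> real \<times> real) measure" where
  "lambda_tilde \<beta> =
     restrict_space (bernoulli_measure \<Otimes>\<^sub>M lborel \<Otimes>\<^sub>M lborel) (E \<beta> \<union> E_bar \<beta>)"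

end

theory Submission
  imports Defs
begin

text \<open>
  Each branch of \<open>\<psi>\<close> multiplies the three coordinates by \<open>2\<close>, \<open>\<beta>\<close> and \<open>1 / (2 \<beta>)\<close>, and the images of the
  branches are disjoint, so \<open>Q \<circ> \<psi>\<close> is injective and measure preserving up to null sets. The projected
  measure is \<open>m \<times> \<nu>\<close> with \<open>\<nu>\<close> absolutely continuous and invariant. Such a \<open>\<nu>\<close> is unique: if \<open>f\<close> and \<open>g\<close> are
  two invariant densities, then \<open>{f > g}\<close> and \<open>{f < g}\<close> are mapped into themselves by both digits, and each
  of them contains the whole switch region if it is not null.

  The projections of the past determine the point because the height contracts: it is enough that
  two points with the same projection eventually lie in the same piece. For almost every \<open>x\<close> any two
  pieces over \<open>x\<close> can be merged by a finite word of digits. The next digits are independent of the past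
  and the invariant measure prevents an escape to high pieces, so merging happens almost surely.
\<close>

text \<open>The second tower answers a mismatch. In a piece whose end \<open>r\<close> lies in the
  right region, digit 0 moves the end by \<open>T1\<close>, while a point x of the switch region has
  to move by \<open>T0\<close>. The image \<beta> x may lie beyond the new end, but with c = 1 /
  (\<beta> - 1) its mirror point c - \<beta> x always fits into the new piece; this is the purpose
  of \<open>Q\<close>. A position in the two towers is therefore a state, a word with an orientation
  bit, and the next state depends only on the old one, on x and on the digit. The obstacle to
  generation is that there are infinitely many states and no common lower bound for the probability
  that two of them merge. A bound \<gamma> is available only off a set of small measure, and it
  depends on that set. The argument closes because the error caused by the exceptional set carries
  the same factor \<gamma>, which cancels. Uniqueness and merging share one principle: a set that
  some digit maps by a single branch into a set of the same kind grows in length by the factor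
  \<beta>, which cannot continue inside a bounded interval.\<close>

section \<open>Invertibility and generation modulo null sets\<close>

text \<open>Images are easier than preimages here, because every branch has an explicit affine
  inverse. A forward image of \<open>G\<close> has the same finite measure as \<open>G\<close>, so
  all iterated images have full measure, and so has their decreasing intersection, on which
  \<open>S\<close> is onto.\<close>

lemma forward_invertible:
  assumes fin: "finite_measure N" and S[measurable]: "S \<in> N \<rightarrow>\<^sub>M N"
    and G: "G \<in> sets N" "space N - G \<in> null_sets N" and inj: "inj_on S G" and SG: "S ` G \<subseteq> G"
    and fw: "\<And>A. A \<in> sets N \<Longrightarrow> A \<subseteq> G \<Longrightarrow> S ` A \<in> sets N \<and> emeasure N (S ` A) = emeasure N A"
  shows "distr N N S = N" and "invertible_on N S (\<Inter>n. (S ^^ n) ` G)"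
proof -
  interpret finite_measure N by fact
  have full: "emeasure N (B \<inter> H) = emeasure N B"
    if "B \<in> sets N" "H \<in> sets N" "space N - H \<in> null_sets N" for B H
  proof -
    have "AE x in N. x \<in> H" using that(3) by (intro AE_I'[OF that(3)]) auto
    then show ?thesis using that(1,2) by (intro emeasure_eq_AE) auto
  qed
  have null: "space N - H \<in> null_sets N" if "H \<in> sets N" "emeasure N H = emeasure N (space N)" for H
    using that sets.sets_into_space[OF that(1)] emeasure_Diff[of N H "space N"] emeasure_finite
    by (auto simp: null_sets_def)
  show "distr N N S = N"
  proof (rule measure_eqI)
    fix B assume "B \<in> sets (distr N N S)"
    then have B: "B \<in> sets N" by simp
    have pre: "S -` B \<inter> space N \<in> sets N" using B by measurable
    have SGs: "S ` G \<in> sets N" "space N - S ` G \<in> null_sets N"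
      using fw[OF G(1)] null[of "S ` G"] full[of "space N" G] G sets.sets_into_space[OF G(1)]
      by (auto simp: Int_absorb1)
    have "emeasure (distr N N S) B = emeasure N (S -` B \<inter> space N)" using B by (simp add: emeasure_distr)
    also have "\<dots> = emeasure N (S -` B \<inter> space N \<inter> G)" using full[OF pre G] by simp
    \<comment> \<open>Forward preservation turns the preimage into an image, which is
      \<open>B\<close> cut down to the image of \<open>G\<close>, again a set of full
      measure.\<close>
    also have "\<dots> = emeasure N (S ` (S -` B \<inter> space N \<inter> G))" using fw[of "S -` B \<inter> space N \<inter> G"] pre G by auto
    also have "S ` (S -` B \<inter> space N \<inter> G) = B \<inter> S ` G" using sets.sets_into_space[OF G(1)] by auto
    also have "emeasure N \<dots> = emeasure N B" using full[OF B SGs] .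
    finally show "emeasure (distr N N S) B = emeasure N B" .
  qed simp
  define X where "X = (\<Inter>n. (S ^^ n) ` G)"
  have it: "(S ^^ n) ` G \<in> sets N \<and> (S ^^ n) ` G \<subseteq> G \<and> emeasure N ((S ^^ n) ` G) = emeasure N (space N)" for n
  proof (induction n)
    case 0
    show ?case using G full[of "space N" G] sets.sets_into_space[OF G(1)] by (simp add: Int_absorb1)
  next
    case (Suc n)
    have "(S ^^ Suc n) ` G = S ` ((S ^^ n) ` G)" by (simp add: image_comp)
    moreover have "S ` ((S ^^ n) ` G) \<subseteq> G" using Suc SG by blast
    ultimately show ?case using Suc fw[of "(S ^^ n) ` G"] by simp
  qed
  have Xs: "X \<in> sets N" using it unfolding X_def by auto
  have XG: "X \<subseteq> G" unfolding X_def using it[of 0] by fastforce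
  have "space N - X = (\<Union>n. space N - (S ^^ n) ` G)" unfolding X_def by auto
  moreover have "space N - (S ^^ n) ` G \<in> null_sets N" for n using it null by blast
  ultimately have Xn: "space N - X \<in> null_sets N" by (metis null_sets_UN)
  \<comment> \<open>Injectivity lets the image commute with the intersection. The index then shifts
    by one, which loses nothing because the images of \<open>G\<close> decrease.\<close>
  have "S ` X = (\<Inter>n. S ` ((S ^^ n) ` G))"
    unfolding X_def by (rule image_INT[OF inj]) (use it in auto)
  also have "\<dots> = (\<Inter>n. (S ^^ Suc n) ` G)" by (simp add: image_comp)
  also have "\<dots> = X" unfolding X_def
  proof (intro equalityI INT_greatest subsetI)
    fix x n assume x: "x \<in> (\<Inter>n. (S ^^ Suc n) ` G)"
    show "x \<in> (S ^^ n) ` G"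
    proof (cases n)
      case 0
      have "x \<in> (S ^^ Suc 0) ` G" using x by blast
      then show ?thesis using it[of "Suc 0"] 0 by auto
    next
      case (Suc k) then show ?thesis using x by blast
    qed
  qed blast
  finally have SX: "S ` X = X" .
  have injX: "inj_on S X" using inj XG inj_on_subset by blast
  have bij: "bij_betw S X X" using injX SX by (simp add: bij_betw_def)
  have "the_inv_into X S \<in> restrict_space N X \<rightarrow>\<^sub>M restrict_space N X"
  proof (rule measurableI)
    fix x assume "x \<in> space (restrict_space N X)"
    then have "x \<in> X" by (simp add: space_restrict_space)
    then have "the_inv_into X S x \<in> X" using the_inv_into_into[OF injX, of x X] SX by auto
    then show "the_inv_into X S x \<in> space (restrict_space N X)"
      using sets.sets_into_space[OF Xs] by (auto simp: space_restrict_space)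
  next
    fix A assume "A \<in> sets (restrict_space N X)"
    then have A: "A \<in> sets N" "A \<subseteq> X" using Xs by (auto simp: sets_restrict_space_iff)
    have "the_inv_into X S -` A \<inter> space (restrict_space N X) = {x \<in> X. the_inv_into X S x \<in> A}"
      using sets.sets_into_space[OF Xs] by (auto simp: space_restrict_space)
    also have "\<dots> = S ` A"
    proof (intro equalityI subsetI)
      fix x assume x: "x \<in> {x \<in> X. the_inv_into X S x \<in> A}"
      then have "S (the_inv_into X S x) = x" using f_the_inv_into_f[OF injX, of x] SX by auto
      then show "x \<in> S ` A" using x by (metis (no_types, lifting) image_eqI mem_Collect_eq)
    next
      fix x assume "x \<in> S ` A"
      then obtain y where y: "y \<in> A" "x = S y" by blast
      then have "the_inv_into X S x = y" using the_inv_into_f_f[OF injX, of y] A by auto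
      then show "x \<in> {x \<in> X. the_inv_into X S x \<in> A}" using y A SX by auto
    qed
    finally have "the_inv_into X S -` A \<inter> space (restrict_space N X) = S ` A" .
    moreover have "S ` A \<in> sets N" "S ` A \<subseteq> X" using fw[of A] A XG SX by auto
    ultimately show "the_inv_into X S -` A \<inter> space (restrict_space N X) \<in> sets (restrict_space N X)"
      using Xs by (auto simp: sets_restrict_space_iff)
  qed
  then show "invertible_on N S (\<Inter>n. (S ^^ n) ` G)"
    using Xs Xn bij unfolding invertible_on_def X_def[symmetric] by blast
qed

text \<open>Since \<open>S ^^ k\<close> preserves \<open>N\<close>, the integral in
  \<open>lim\<close> is the L1 distance between \<open>Y\<close> and \<open>u k\<close> evaluated at
  the projection of the \<open>k\<close>-th preimage. A subsequence of these functions converges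
  almost everywhere to a limit measurable for the generated sigma-algebra, so this algebra contains
  \<open>Y\<close>, and with it every set, up to null sets.\<close>

lemma generated_mod_null:
  fixes N :: "'b measure" and M :: "'a measure" and Y :: "'b \<Rightarrow> real"
  assumes fin: "finite_measure N" and S[measurable]: "S \<in> N \<rightarrow>\<^sub>M N" and mp: "distr N N S = N"
    and inv: "invertible_on N S X"
    and p[measurable]: "p \<in> N \<rightarrow>\<^sub>M M" and Y[measurable]: "Y \<in> borel_measurable N"
    and u[measurable]: "\<And>k. u k \<in> borel_measurable M"
    and bnd: "\<And>z. z \<in> space N \<Longrightarrow> \<bar>Y z\<bar> \<le> c" "\<And>k z. z \<in> space M \<Longrightarrow> \<bar>u k z\<bar> \<le> c"
    and lim: "(\<lambda>k. \<integral>z. \<bar>u k (p z) - Y ((S ^^ k) z)\<bar> \<partial>N) \<longlonglongrightarrow> 0"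
    and gen: "\<And>A. A \<in> sets N \<Longrightarrow> \<exists>A'\<in>sets (M \<Otimes>\<^sub>M borel). A = {z \<in> space N. (p z, Y z) \<in> A'}"
  shows "\<forall>A\<in>sets N. \<exists>B\<in>sigma_sets X {(S ^^ k) ` (p -` C \<inter> X) | k C. C \<in> sets M}.
     sym_diff A B \<in> null_sets N"
proof
  fix A assume "A \<in> sets N"
  interpret finite_measure N by fact
  define T where "T = the_inv_into X S"
  define Gen where "Gen = {(S ^^ k) ` (p -` C \<inter> X) | k C. C \<in> sets M}"
  have X[measurable]: "X \<in> sets N" and Xn: "space N - X \<in> null_sets N" and bij: "bij_betw S X X"
    and Tm: "T \<in> restrict_space N X \<rightarrow>\<^sub>M restrict_space N X"
    using inv unfolding invertible_on_def T_def by auto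
  have injX: "inj_on S X" and SX: "S ` X = X" using bij by (auto simp: bij_betw_def)
  have XN: "X \<subseteq> space N" using sets.sets_into_space[OF X] .
  have TX: "T z \<in> X" and ST: "S (T z) = z" and TS: "T (S z) = z" if "z \<in> X" for z
    using that the_inv_into_into[OF injX, of z X] f_the_inv_into_f[OF injX, of z]
      the_inv_into_f_f[OF injX, of z] SX by (auto simp: T_def)
  have SXm: "S z \<in> X" if "z \<in> X" for z using that SX by auto
  have TkX: "(T ^^ k) z \<in> X" if "z \<in> X" for z k using that by (induction k) (auto simp: TX)
  have SkX: "(S ^^ k) z \<in> X" if "z \<in> X" for z k using that by (induction k) (auto simp: SXm)
  have TSk: "(T ^^ k) ((S ^^ k) z) = z" if "z \<in> X" for z k
  proof (induction k)
    case (Suc k)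
    have "(T ^^ Suc k) ((S ^^ Suc k) z) = (T ^^ k) (T (S ((S ^^ k) z)))" by (simp only: funpow_Suc_right[of k T] funpow.simps(2)[of k S] comp_def)
    then show ?case using Suc TS[OF SkX[OF that]] by simp
  qed simp
  have STk: "(S ^^ k) ((T ^^ k) z) = z" if "z \<in> X" for z k
  proof (induction k)
    case (Suc k)
    have "(S ^^ Suc k) ((T ^^ Suc k) z) = (S ^^ k) (S (T ((T ^^ k) z)))" by (simp only: funpow_Suc_right[of k S] funpow.simps(2)[of k T] comp_def)
    then show ?case using Suc ST[OF TkX[OF that]] by simp
  qed simp
  have Skm[measurable]: "(S ^^ k) \<in> N \<rightarrow>\<^sub>M N" for k by (induction k) auto
  have Skmp: "distr N N (S ^^ k) = N" for k
  proof (induction k)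
    case (Suc k)
    have "distr N N (S ^^ Suc k) = distr (distr N N (S ^^ k)) N S" by (subst distr_distr) auto
    then show ?case using Suc mp by (simp del: funpow.simps)
  qed (simp add: distr_id)
  have Tkm: "(T ^^ k) \<in> restrict_space N X \<rightarrow>\<^sub>M restrict_space N X" for k
  proof (induction k)
    case (Suc k)
    show ?case using measurable_comp[OF Suc Tm] by (simp add: comp_def)
  qed (simp add: measurable_ident)
  have pX: "p \<in> restrict_space N X \<rightarrow>\<^sub>M M" by (rule measurable_restrict_space1) simp
  \<comment> \<open>On \<open>X\<close> an image under \<open>S ^^ k\<close> is a preimage under the
    inverse iterate, so the generators are exactly what makes all the maps \<open>p\<close> after
    \<open>T ^^ k\<close> measurable.\<close>
  have img: "(S ^^ k) ` (p -` C \<inter> X) = {z \<in> X. p ((T ^^ k) z) \<in> C}" for k C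
  proof (intro equalityI subsetI)
    fix z assume "z \<in> (S ^^ k) ` (p -` C \<inter> X)"
    then show "z \<in> {z \<in> X. p ((T ^^ k) z) \<in> C}" using TSk SkX by auto
  next
    fix z assume z: "z \<in> {z \<in> X. p ((T ^^ k) z) \<in> C}"
    then have "(T ^^ k) z \<in> p -` C \<inter> X" "z = (S ^^ k) ((T ^^ k) z)" using TkX STk by auto
    then show "z \<in> (S ^^ k) ` (p -` C \<inter> X)" by blast
  qed
  define MG where "MG = sigma X Gen"
  have GenX: "Gen \<subseteq> Pow X" unfolding Gen_def img by auto
  have sp: "space MG = X" and st: "sets MG = sigma_sets X Gen" unfolding MG_def using GenX by auto
  have pT: "(\<lambda>z. p ((T ^^ k) z)) \<in> MG \<rightarrow>\<^sub>M M" for k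
  proof (rule measurableI)
    fix z assume "z \<in> space MG"
    then show "p ((T ^^ k) z) \<in> space M" using TkX XN measurable_space[OF p] by (auto simp: sp)
  next
    fix C assume "C \<in> sets M"
    then have "{z \<in> X. p ((T ^^ k) z) \<in> C} \<in> Gen" unfolding Gen_def img by blast
    moreover have "(\<lambda>z. p ((T ^^ k) z)) -` C \<inter> space MG = {z \<in> X. p ((T ^^ k) z) \<in> C}" by (auto simp: sp)
    ultimately show "(\<lambda>z. p ((T ^^ k) z)) -` C \<inter> space MG \<in> sets MG" by (simp add: st)
  qed
  have GenN: "Gen \<subseteq> sets N"
  proof
    fix B assume "B \<in> Gen"
    then obtain k C where B: "B = {z \<in> X. p ((T ^^ k) z) \<in> C}" "C \<in> sets M" unfolding Gen_def img by blast
    have "(\<lambda>z. p ((T ^^ k) z)) \<in> restrict_space N X \<rightarrow>\<^sub>M M"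
      using measurable_comp[OF Tkm pX] by (simp add: comp_def)
    moreover have "(\<lambda>z. p ((T ^^ k) z)) -` C \<inter> space (restrict_space N X) = B"
      using XN by (auto simp: B(1) space_restrict_space)
    ultimately have "B \<in> sets (restrict_space N X)" using B(2) measurable_sets by metis
    then show "B \<in> sets N" using X by (simp add: sets_restrict_space_iff)
  qed
  have MGN: "sets MG \<subseteq> sets N"
  proof -
    have "sigma_sets X Gen \<subseteq> sigma_sets X (sets (restrict_space N X))"
      using subsetD[OF GenN] subsetD[OF GenX] X by (intro sigma_sets_mono') (auto simp: sets_restrict_space_iff)
    also have "\<dots> = sets (restrict_space N X)"
      using sets.sigma_sets_eq[of "restrict_space N X"] XN by (simp add: space_restrict_space Int_absorb2)
    finally show ?thesis using X by (auto simp: st sets_restrict_space_iff)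
  qed
  \<comment> \<open>\<open>W\<close> is measured against the generated sigma-algebra on
    \<open>X\<close>; its extension \<open>W'\<close> by 0 serves for integrals over
    \<open>N\<close>.\<close>
  define W where "W k z = u k (p ((T ^^ k) z))" for k z
  define W' where "W' k z = (if z \<in> X then W k z else 0)" for k z
  have Wm: "W k \<in> borel_measurable MG" for k unfolding W_def using measurable_compose[OF pT u] .
  have "W k \<in> borel_measurable (restrict_space N X)" for k
    unfolding W_def using measurable_compose[OF measurable_comp[OF Tkm pX] u] by (simp add: comp_def)
  then have W'm[measurable]: "W' k \<in> borel_measurable N" for k
    unfolding W'_def by (subst measurable_If_restrict_space_iff) (auto simp: XN)
  have AEX: "AE z in N. z \<in> X" by (rule AE_I'[OF Xn]) auto
  have c0: "0 \<le> c \<or> space N = {}" using bnd(1) by fastforce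
  have W'b: "\<bar>W' k z\<bar> \<le> c" if "z \<in> space N" for k z
    using that bnd(2)[of "p ((T ^^ k) z)" k] TkX XN measurable_space[OF p] c0 unfolding W'_def W_def by auto
  have int: "integrable N (W' k)" "integrable N Y" for k
    using W'b bnd(1) by (auto intro!: integrable_const_bound[where B=c])
  have "(\<integral>z. norm (W' k z - Y z) \<partial>N) = (\<integral>z. \<bar>u k (p z) - Y ((S ^^ k) z)\<bar> \<partial>N)" for k
  proof -
    have "(\<integral>z. norm (W' k z - Y z) \<partial>N) = (\<integral>z. norm (W' k z - Y z) \<partial>distr N N (S ^^ k))" by (simp add: Skmp)
    also have "\<dots> = (\<integral>z. norm (W' k ((S ^^ k) z) - Y ((S ^^ k) z)) \<partial>N)" by (rule integral_distr) auto
    also have "\<dots> = (\<integral>z. \<bar>u k (p z) - Y ((S ^^ k) z)\<bar> \<partial>N)"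
    proof (rule integral_cong_AE)
      show "AE z in N. norm (W' k ((S ^^ k) z) - Y ((S ^^ k) z)) = \<bar>u k (p z) - Y ((S ^^ k) z)\<bar>"
        using AEX by eventually_elim (auto simp: W'_def W_def SkX TSk)
    qed auto
    finally show ?thesis .
  qed
  then have lim': "(\<lambda>k. \<integral>z. norm (W' k z - Y z) \<partial>N) \<longlonglongrightarrow> 0" using lim by simp
  \<comment> \<open>L1 convergence gives almost everywhere convergence only along a subsequence. The
    limit \<open>Z\<close> is formed from \<open>W\<close>, so that it is measurable for the
    generated sigma-algebra.\<close>
  obtain s where s: "strict_mono s" "AE z in N. (\<lambda>n. W' (s n) z - Y z) \<longlonglongrightarrow> 0"
    using tendsto_L1_AE_subseq[OF _ lim'] int by auto
  define Z where "Z z = lim (\<lambda>n. W (s n) z)" for z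
  have Zm: "Z \<in> borel_measurable MG" unfolding Z_def by (rule borel_measurable_lim_metric) (rule Wm)
  have AEZ: "AE z in N. z \<in> X \<and> Z z = Y z"
    using s(2) AEX by eventually_elim (auto simp: W'_def Z_def LIM_zero_iff limI)
  obtain A' where A': "A' \<in> sets (M \<Otimes>\<^sub>M borel)" "A = {z \<in> space N. (p z, Y z) \<in> A'}" using gen \<open>A \<in> sets N\<close> by blast
  define B where "B = {z \<in> X. (p z, Z z) \<in> A'}"
  have "(\<lambda>z. (p z, Z z)) \<in> MG \<rightarrow>\<^sub>M M \<Otimes>\<^sub>M borel" using pT[of 0] Zm by simp
  from measurable_sets[OF this A'(1)] have B: "B \<in> sets MG"
    by (simp add: B_def sp vimage_def Int_def conj_commute)
  have sd: "sym_diff A B \<in> sets N" using B MGN \<open>A \<in> sets N\<close> by auto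
  have "AE z in N. z \<notin> sym_diff A B" using AEZ by eventually_elim (use XN in \<open>auto simp: A'(2) B_def\<close>)
  then have "sym_diff A B \<in> null_sets N" using AE_iff_null_sets[OF sd] by simp
  then show "\<exists>B\<in>sigma_sets X {(S ^^ k) ` (p -` C \<inter> X) | k C. C \<in> sets M}. sym_diff A B \<in> null_sets N"
    using B unfolding st Gen_def by blast
qed

section \<open>Uniqueness of the absolutely continuous invariant measure\<close>

text \<open>A weak form of the Lebesgue density theorem. Cover \<open>A\<close> by an open set of
  measure at most 1 + e times that of \<open>A\<close>. If all its components, which are intervals,
  had density at most 1 - e, then \<open>A\<close> would have at most (1 - e)(1 + e) times its own
  measure.\<close>

lemma density_interval:
  fixes A :: "real set"
  assumes A[measurable]: "A \<in> sets borel" and Aab: "A \<subseteq> {a..b}" and pos: "0 < measure lborel A" and e: "0 < e" "e < 1"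
  obtains J where "is_interval J" "J \<in> sets borel" "J \<subseteq> {a..b}" "0 < measure lborel (A \<inter> J)"
    "(1 - e) * measure lborel J \<le> measure lborel (A \<inter> J)"
proof -
  have fin: "emeasure lborel B < \<infinity>" if "B \<subseteq> {a..b}" for B
  proof -
    have "emeasure lborel B \<le> emeasure lborel {a..b}" using that by (intro emeasure_mono) auto
    also have "\<dots> < \<infinity>" by (simp add: emeasure_lborel_Icc_eq)
    finally show ?thesis .
  qed
  define d where "d = e * measure lborel A"
  have "0 < d" using e pos by (simp add: d_def)
  obtain U where U: "open U" "A \<subseteq> U" "emeasure lborel (U - A) < d"
    using outer_regular_lborel[OF A \<open>0 < d\<close>] by blast
  have [measurable]: "U \<in> sets borel" using U by simp
  have eA: "emeasure lborel A = measure lborel A" using fin[OF Aab] by (simp add: emeasure_eq_ennreal_measure)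
  have "emeasure lborel U = emeasure lborel A + emeasure lborel (U - A)"
    using U(2) by (subst plus_emeasure) (auto simp: Un_absorb1)
  also have "\<dots> \<le> ennreal (measure lborel A + d)"
    using U(3) \<open>0 < d\<close> by (simp add: eA ennreal_plus add_left_mono less_imp_le)
  finally have eU: "emeasure lborel U \<le> ennreal (measure lborel A + d)" .
  have op: "open C" "C \<noteq> {}" "C \<subseteq> U" "is_interval C" if "C \<in> components U" for C
    using open_components[OF U(1) that] in_components_nonempty[OF that] in_components_subset[OF that]
      in_components_connected[OF that] unfolding is_interval_connected_1 by blast+
  have dj: "pairwise disjnt (components U)" using pairwise_disjoint_components[of U] by (simp add: pairwise_def disjnt_def)
  have cU: "countable (components U)"
    using countable_disjoint_open_subsets[of "components U"] op dj by blast
  have sum: "emeasure lborel (B \<inter> U) = (\<integral>\<^sup>+C. emeasure lborel (B \<inter> C) \<partial>count_space (components U))"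
    if [measurable]: "B \<in> sets borel" for B
  proof -
    have "B \<inter> U = (\<Union>C\<in>components U. B \<inter> C)" using Union_components[of U] by blast
    also have "emeasure lborel \<dots> = (\<integral>\<^sup>+C. emeasure lborel (B \<inter> C) \<partial>count_space (components U))"
    proof (rule emeasure_UN_countable[OF _ cU])
      show "disjoint_family_on ((\<inter>) B) (components U)"
        using dj unfolding disjoint_family_on_def pairwise_def disjnt_def by blast
    qed (use op in auto)
    finally show ?thesis .
  qed
  have "\<exists>C\<in>components U. ennreal (1 - e) * emeasure lborel C < emeasure lborel (A \<inter> C)"
  proof (rule ccontr)
    assume "\<not> ?thesis"
    then have le: "\<And>C. C \<in> components U \<Longrightarrow> emeasure lborel (A \<inter> C) \<le> ennreal (1 - e) * emeasure lborel C"
      using not_less by blast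
    have "emeasure lborel A = emeasure lborel (A \<inter> U)" using U(2) by (simp add: Int_absorb2)
    also have "\<dots> \<le> (\<integral>\<^sup>+C. ennreal (1 - e) * emeasure lborel C \<partial>count_space (components U))"
      unfolding sum[OF A] by (intro nn_integral_mono) (use le in auto)
    also have "\<dots> = ennreal (1 - e) * emeasure lborel U"
      using sum[of UNIV] by (subst nn_integral_cmult) auto
    also have "\<dots> \<le> ennreal (1 - e) * ennreal (measure lborel A + d)" using eU by (rule mult_left_mono) simp
    also have "\<dots> = ennreal ((1 - e) * (measure lborel A + d))" using e by (simp add: ennreal_mult')
    finally have "measure lborel A \<le> (1 - e) * (measure lborel A + d)"
      using e \<open>0 < d\<close> by (simp add: eA)
    also have "\<dots> = (1 - e\<^sup>2) * measure lborel A" by (simp add: d_def algebra_simps power2_eq_square)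
    finally have "e\<^sup>2 * measure lborel A \<le> 0" by (simp add: algebra_simps)
    then show False using e pos by (simp add: mult_le_0_iff)
  qed
  then obtain C where C: "C \<in> components U" "ennreal (1 - e) * emeasure lborel C < emeasure lborel (A \<inter> C)" by blast
  \<comment> \<open>Cutting the component down to \<open>{a..b}\<close> keeps its part of
    \<open>A\<close> and can only raise the density.\<close>
  define J where "J = C \<inter> {a..b}"
  have Jm[measurable]: "J \<in> sets borel" using op(1)[OF C(1)] by (auto simp: J_def)
  have Jf: "emeasure lborel J = measure lborel J" "emeasure lborel (A \<inter> J) = measure lborel (A \<inter> J)"
    using fin[of J] fin[of "A \<inter> J"] Aab by (auto simp: emeasure_eq_ennreal_measure J_def le_infI1)
  have AJ: "A \<inter> J = A \<inter> C" using Aab by (auto simp: J_def)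
  have "ennreal (1 - e) * emeasure lborel J \<le> ennreal (1 - e) * emeasure lborel C"
    using op(1)[OF C(1)] by (intro mult_left_mono emeasure_mono) (auto simp: J_def)
  then have "ennreal (1 - e) * emeasure lborel J < emeasure lborel (A \<inter> J)" using C(2) by (simp add: AJ)
  then have "ennreal ((1 - e) * measure lborel J) < ennreal (measure lborel (A \<inter> J))"
    using e by (simp add: Jf ennreal_mult')
  then have *: "(1 - e) * measure lborel J < measure lborel (A \<inter> J)" using e by (simp add: ennreal_less_iff)
  moreover have "0 \<le> (1 - e) * measure lborel J" using e by simp
  moreover have "is_interval J" unfolding J_def using op(4)[OF C(1)] by (intro is_interval_Int) (auto simp: is_interval_cc)
  ultimately show thesis using that[of J] Jm by (auto simp: J_def)
qed

lemma affine_image_lborel: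
  fixes b d :: real
  assumes b: "0 < b" and A[measurable]: "A \<in> sets borel"
  shows "(\<lambda>x. b * x - d) ` A \<in> sets borel"
    and "emeasure lborel ((\<lambda>x. b * x - d) ` A) = ennreal b * emeasure lborel A"
    and "measure lborel ((\<lambda>x. b * x - d) ` A) = b * measure lborel A"
proof -
  have im: "(\<lambda>x. b * x - d) ` A = (\<lambda>x. (x + d) / b) -` A \<inter> space borel"
    using b by (force simp: image_iff field_simps)
  have m: "(\<lambda>x. (x + d) / b) \<in> borel_measurable borel" by simp
  show "(\<lambda>x. b * x - d) ` A \<in> sets borel" unfolding im using measurable_sets[OF m A] .
  then have [measurable]: "(\<lambda>x. b * x - d) ` A \<in> sets borel" .
  have "emeasure lborel ((\<lambda>x. b * x - d) ` A) = emeasure (density (distr lborel borel (\<lambda>x. - d + b * x)) (\<lambda>_. ennreal \<bar>b\<bar>)) ((\<lambda>x. b * x - d) ` A)"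
    using lborel_real_affine[of b "- d"] b by simp
  also have "\<dots> = ennreal b * emeasure (distr lborel borel (\<lambda>x. - d + b * x)) ((\<lambda>x. b * x - d) ` A)"
    using b by (simp add: emeasure_density nn_integral_cmult_indicator)
  also have "emeasure (distr lborel borel (\<lambda>x. - d + b * x)) ((\<lambda>x. b * x - d) ` A) = emeasure lborel A"
  proof -
    have "(\<lambda>x. - d + b * x) -` ((\<lambda>x. b * x - d) ` A) = A" using b by (auto simp: image_iff)
    then show ?thesis by (subst emeasure_distr) auto
  qed
  finally show *: "emeasure lborel ((\<lambda>x. b * x - d) ` A) = ennreal b * emeasure lborel A" .
  show "measure lborel ((\<lambda>x. b * x - d) ` A) = b * measure lborel A"
    unfolding measure_def * using b by (simp add: enn2real_mult)
qed

section \<open>The interval, its switch region and the fibre maps\<close>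

locale beta_expansion =
  fixes \<beta> c :: real
  assumes beta1: "1 < \<beta>" and beta2: "\<beta> < 2" and c_def: "c = 1 / (\<beta> - 1)"
begin

lemma beta0: "0 < \<beta>" using beta1 by simp
lemma c1: "1 < c" using beta1 beta2 by (simp add: c_def)
text \<open>\<open>c\<close> is the right end of the interval and the fixed point of
  \<open>T1\<close>. The switch region becomes \<open>{1 / \<beta>..c / \<beta>}\<close>, which is
  symmetric about c / 2.\<close>

lemma beta_c: "\<beta> * c = c + 1" using beta1 by (simp add: c_def field_simps)
lemma c_div: "1 / (\<beta> * (\<beta> - 1)) = c / \<beta>" by (simp add: c_def)
lemma c_div': "c / \<beta> = c - 1 / \<beta>" using beta_c beta0 by (simp add: field_simps)
lemma c_div_less: "c / \<beta> < c" "1 / \<beta> < c / \<beta>" "0 < 1 / \<beta>" "1 / \<beta> < 1" "c - 1 < c / \<beta>"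
  using beta1 c1 beta_c by (auto simp: field_simps)

lemma I_eq: "I_beta \<beta> = {0..c}" by (simp add: I_beta_def c_def)

lemma R_fibre_eq:
  assumes "x \<in> {0..c}"
  shows "R_fibre \<beta> i x = (if x < 1 / \<beta> \<or> x \<le> c / \<beta> \<and> \<not> i then \<beta> * x else \<beta> * x - 1)"
  using assms c_div_less unfolding R_fibre_def reg_L_def reg_S_def T0_def T1_def c_div by auto

lemma beta_mult_le: "\<beta> * x \<le> c + 1" if "x \<le> c"
  using that beta0 by (subst beta_c[symmetric]) simp

lemma R_fibre_I:
  assumes "x \<in> {0..c}"
  shows "R_fibre \<beta> i x \<in> {0..c}"
proof -
  have "\<beta> * x \<le> c" if "x \<le> c / \<beta>" using that beta0 by (simp add: field_simps)
  moreover have "1 \<le> \<beta> * x" if "\<not> x < 1 / \<beta>" using that beta0 by (simp add: field_simps)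
  ultimately show ?thesis
    using assms beta_mult_le[of x] beta0 c_div_less(2) unfolding R_fibre_eq[OF assms] by auto
qed

lemma R_fibre_measurable[measurable]: "R_fibre \<beta> i \<in> borel_measurable borel"
  unfolding R_fibre_def reg_L_def reg_S_def T0_def T1_def by measurable

text \<open>The signed difference of the two measures is largest on the set where one density
  exceeds the other. Invariance writes this maximum as the mean of two values that cannot exceed it,
  so the preimages of the set under both digits attain it.\<close>

lemma absolutely_continuous_invariant_unique:
  assumes "prob_space \<mu>" "sets \<mu> = sets (restrict_space borel {0..c})"
    and "absolutely_continuous (restrict_space lborel {0..c}) \<mu>"
    and mi: "\<And>B. B \<in> sets \<mu> \<Longrightarrow> measure \<mu> B = (\<Sum>i\<in>UNIV. measure \<mu> {x\<in>{0..c}. R_fibre \<beta> i x \<in> B}) / 2"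
  assumes "prob_space \<nu>" "sets \<nu> = sets (restrict_space borel {0..c})"
    and "absolutely_continuous (restrict_space lborel {0..c}) \<nu>"
    and ni: "\<And>B. B \<in> sets \<nu> \<Longrightarrow> measure \<nu> B = (\<Sum>i\<in>UNIV. measure \<nu> {x\<in>{0..c}. R_fibre \<beta> i x \<in> B}) / 2"
  shows "\<mu> = \<nu>"
proof -
  define LI where "LI = restrict_space lborel {0..c}"
  have sLI: "sets LI = sets (restrict_space borel {0..c})" "space LI = {0..c}"
    by (auto simp: LI_def sets_restrict_space space_restrict_space)
  have sm: "sets \<mu> = sets LI" and sn: "sets \<nu> = sets LI" using assms sLI by auto
  have spm: "space \<mu> = {0..c}" and spn: "space \<nu> = {0..c}" using sets_eq_imp_space_eq[OF sm] sets_eq_imp_space_eq[OF sn] sLI by auto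
  have sLI': "B \<in> sets LI \<longleftrightarrow> B \<in> sets borel \<and> B \<subseteq> {0..c}" for B
    unfolding sLI by (simp add: sets_restrict_space_iff conj_commute)
  have eLI: "emeasure LI B = emeasure lborel B" if "B \<in> sets LI" for B
    using that unfolding LI_def sLI' by (subst emeasure_restrict_space) (auto simp: sLI'[unfolded LI_def])
  have "{0..c} \<in> sets LI" by (simp add: sLI')
  then have "emeasure LI (space LI) \<noteq> \<infinity>" unfolding sLI(2) by (simp add: eLI emeasure_lborel_Icc_eq)
  then interpret LI: finite_measure LI by (rule finite_measureI)
  \<comment> \<open>Stated for any two densities, so that it applies both to {g < f} and to {f <
    g}.\<close>
  have core: "measure lborel ({1/\<beta>..c/\<beta>} - A) = 0"
    if f[measurable]: "f \<in> borel_measurable LI" and g[measurable]: "g \<in> borel_measurable LI"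
      and fm: "density LI f = m" and gn: "density LI g = n" and pm: "prob_space m" and pn: "prob_space n"
      and mi: "\<And>B. B \<in> sets LI \<Longrightarrow> measure m B = (\<Sum>i\<in>UNIV. measure m {x\<in>{0..c}. R_fibre \<beta> i x \<in> B}) / 2"
      and ni: "\<And>B. B \<in> sets LI \<Longrightarrow> measure n B = (\<Sum>i\<in>UNIV. measure n {x\<in>{0..c}. R_fibre \<beta> i x \<in> B}) / 2"
      and Adef: "A = {x\<in>{0..c}. g x < f x}" and posA: "emeasure LI A \<noteq> 0"
    for m n :: "real measure" and f g :: "real \<Rightarrow> ennreal" and A
  proof -
    interpret m: prob_space m by (fact pm)
    interpret n: prob_space n by (fact pn)
    have sets[simp]: "sets m = sets LI" "sets n = sets LI" using fm gn by (metis sets_density)+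
    have "{x \<in> space LI. g x < f x} \<in> sets LI" by measurable
    then have A[measurable]: "A \<in> sets LI" by (simp add: Adef sLI)
    have pre[measurable]: "{x\<in>{0..c}. R_fibre \<beta> i x \<in> B} \<in> sets LI" if "B \<in> sets LI" for B i
    proof -
      have "R_fibre \<beta> i \<in> LI \<rightarrow>\<^sub>M LI"
        unfolding LI_def by (rule measurable_restrict_space3) (use R_fibre_I in auto)
      from measurable_sets[OF this that] show ?thesis by (simp add: sLI vimage_def Int_def conj_commute)
    qed
    have em: "emeasure m B = (\<integral>\<^sup>+x. f x * indicator B x \<partial>LI)" "emeasure n B = (\<integral>\<^sup>+x. g x * indicator B x \<partial>LI)" if "B \<in> sets LI" for B
      using that fm gn emeasure_density[OF f, of B] emeasure_density[OF g, of B] by auto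
    define D where "D B = measure m B - measure n B" for B
    have out: "D B \<le> 0" if "B \<in> sets LI" "B \<inter> A = {}" for B
    proof -
      have "emeasure m B \<le> emeasure n B" unfolding em[OF that(1)]
        by (intro nn_integral_mono) (use that(2) in \<open>auto simp: Adef sLI indicator_def not_less\<close>)
      then show ?thesis by (simp add: D_def m.emeasure_eq_measure n.emeasure_eq_measure)
    qed
    have ins: "0 \<le> D B" if "B \<in> sets LI" "B \<subseteq> A" for B
    proof -
      have "emeasure n B \<le> emeasure m B" unfolding em[OF that(1)]
        by (intro nn_integral_mono) (use that(2) in \<open>auto simp: Adef sLI indicator_def intro!: less_imp_le\<close>)
      then show ?thesis by (simp add: D_def m.emeasure_eq_measure n.emeasure_eq_measure)
    qed
    \<comment> \<open>Strictness of g < f on \<open>A\<close> forces a subset of \<open>A\<close>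
      without excess mass to be null.\<close>
    have insnull: "emeasure LI B = 0" if B[measurable]: "B \<in> sets LI" and BA: "B \<subseteq> A" and "D B \<le> 0" for B
    proof -
      have le: "emeasure m B \<le> emeasure n B" using that(3) by (simp add: D_def m.emeasure_eq_measure n.emeasure_eq_measure)
      have "(\<integral>\<^sup>+x. f x * indicator B x \<partial>LI) = (\<integral>\<^sup>+x. g x * indicator B x + (f x - g x) * indicator B x \<partial>LI)"
        by (intro nn_integral_cong) (use BA in \<open>auto simp: Adef indicator_def add_diff_inverse_ennreal less_imp_le\<close>)
      also have "\<dots> = (\<integral>\<^sup>+x. g x * indicator B x \<partial>LI) + (\<integral>\<^sup>+x. (f x - g x) * indicator B x \<partial>LI)"
        by (intro nn_integral_add) auto
      finally have "emeasure m B = emeasure n B + (\<integral>\<^sup>+x. (f x - g x) * indicator B x \<partial>LI)" by (simp add: em)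
      with le have "emeasure n B + (\<integral>\<^sup>+x. (f x - g x) * indicator B x \<partial>LI) \<le> emeasure n B + 0" by simp
      then have "(\<integral>\<^sup>+x. (f x - g x) * indicator B x \<partial>LI) = 0"
        unfolding ennreal_add_left_cancel_le by (simp add: n.emeasure_eq_measure)
      then have "AE x in LI. (f x - g x) * indicator B x = 0" by (subst (asm) nn_integral_0_iff_AE) auto
      then have "AE x in LI. x \<notin> B"
        by eventually_elim (use BA in \<open>auto simp: Adef indicator_def diff_eq_0_iff_ennreal split: if_splits\<close>)
      then show ?thesis using AE_iff_null_sets[OF B] by auto
    qed
    have Dsplit: "D B = D (B \<inter> C) + D (B - C)" if "B \<in> sets LI" "C \<in> sets LI" for B C
    proof -
      have "measure m B = measure m (B \<inter> C) + measure m (B - C)" "measure n B = measure n (B \<inter> C) + measure n (B - C)"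
        using that m.finite_measure_Union[of "B \<inter> C" "B - C"] n.finite_measure_Union[of "B \<inter> C" "B - C"]
        by (auto simp: Un_Diff_Int Int_Diff_disjoint Un_commute)
      then show ?thesis by (simp add: D_def)
    qed
    define pa where "pa i = {x\<in>{0..c}. R_fibre \<beta> i x \<in> A}" for i
    have pa[measurable]: "pa i \<in> sets LI" for i unfolding pa_def by measurable
    \<comment> \<open>\<open>A\<close> is the positive set of a Hahn decomposition of
      \<open>D\<close>, hence \<open>D A\<close> is the maximum.\<close>
    have Dle: "D B \<le> D (A \<inter> B)" "D (A \<inter> B) \<le> D A" if "B \<in> sets LI" for B
      using Dsplit[OF that A] Dsplit[OF A that] out[of "B - A"] ins[of "A - B"] that by (auto simp: Int_commute)
    have "D A = (D (pa False) + D (pa True)) / 2"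
      unfolding D_def mi[OF A] ni[OF A] pa_def by (simp add: UNIV_bool field_simps)
    then have Dpa: "D (pa i) = D A" for i
      using Dle[OF pa[of True]] Dle[OF pa[of False]] by (cases i) auto
    have null: "emeasure LI (A - pa i) = 0" for i
      using Dle[OF pa[of i]] Dsplit[OF A pa[of i]] Dpa[of i] by (intro insnull) auto
    have Ab[measurable]: "A \<in> sets borel" and Ac: "A \<subseteq> {0..c}" using A by (auto simp: sLI')
    have pab[measurable]: "pa i \<in> sets borel" for i using pa[of i] by (auto simp: sLI')
    have fin: "emeasure lborel B \<noteq> \<infinity>" "B \<in> fmeasurable lborel" if "B \<subseteq> {0..c}" "B \<in> sets borel" for B
    proof -
      have "B \<in> sets LI" using that by (simp add: sLI')
      then show "emeasure lborel B \<noteq> \<infinity>" using eLI LI.emeasure_finite by fastforce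
      then show "B \<in> fmeasurable lborel" using that by (simp add: fmeasurable_def top.not_eq_extremum)
    qed
    have null': "A - pa i \<in> null_sets lborel" for i using null[of i] eLI[of "A - pa i"] by (auto simp: null_sets_def)
    have pos: "0 < measure lborel A"
      using posA eLI[OF A] fin[OF Ac] by (auto simp: measure_def enn2real_positive_iff zero_less_iff_neq_zero top.not_eq_extremum)
    have Sfin: "{1/\<beta>..c/\<beta>} \<subseteq> {0..c}" using c_div_less by auto
    \<comment> \<open>An interval where \<open>A\<close> has density at least \<open>1 - e\<close> is expanded by one affine branch as long
      as it misses a point of the switch region, so some expanded interval covers this region.\<close>
    have bound: "measure lborel ({1/\<beta>..c/\<beta>} - A) \<le> e * c" if e: "0 < e" "e < 1" for e
    proof -
      define good where "good J \<longleftrightarrow> is_interval J \<and> J \<in> sets borel \<and> J \<subseteq> {0..c} \<and>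
          (1 - e) * measure lborel J \<le> measure lborel (A \<inter> J)" for J :: "real set"
      have "\<exists>J. good J \<and> {1/\<beta>..c/\<beta>} \<subseteq> J"
      proof (rule ccontr)
        assume no: "\<not> ?thesis"
        obtain J0 where "is_interval J0" "J0 \<in> sets borel" "J0 \<subseteq> {0..c}" "0 < measure lborel (A \<inter> J0)"
            "(1 - e) * measure lborel J0 \<le> measure lborel (A \<inter> J0)"
          by (rule density_interval[OF Ab Ac pos e])
        then have J0: "good J0" "0 < measure lborel (A \<inter> J0)" by (auto simp: good_def)
        have step: "\<exists>J'. good J' \<and> \<beta> * measure lborel (A \<inter> J) \<le> measure lborel (A \<inter> J')" if J: "good J" for J
        proof -
          have Ji: "is_interval J" and Jb[measurable]: "J \<in> sets borel" and Jc: "J \<subseteq> {0..c}"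
            and Jd: "(1 - e) * measure lborel J \<le> measure lborel (A \<inter> J)" using J by (auto simp: good_def)
          obtain s where s: "s \<in> {1/\<beta>..c/\<beta>}" "s \<notin> J" using no J by blast
          \<comment> \<open>\<open>J\<close> is an interval without \<open>s\<close>, so it lies on
            one side of it. Digit 1 to the right and digit 0 to the left move all of
            \<open>J\<close> by a single branch.\<close>
          define i where "i = (\<exists>x\<in>J. s < x)"
          have R: "R_fibre \<beta> i x = \<beta> * x - of_bool i" if "x \<in> J" for x
          proof (cases i)
            case True
            then obtain y where "y \<in> J" "s < y" by (auto simp: i_def)
            then have "s < x" using mem_is_interval_1_I[OF Ji that, of y s] s(2) by force
            then show ?thesis using True s(1) Jc that by (subst R_fibre_eq) auto
          next
            case False
            then have "x < s" using s(2) that unfolding i_def by (metis linorder_neqE_linordered_idom)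
            then show ?thesis using False s(1) Jc that by (subst R_fibre_eq) auto
          qed
          define h where "h x = \<beta> * x - of_bool i" for x
          define J' where "J' = h ` J"
          have J'b[measurable]: "J' \<in> sets borel" and J'm: "measure lborel J' = \<beta> * measure lborel J"
            unfolding J'_def h_def using affine_image_lborel[OF beta0 Jb] by auto
          have hR: "h x = R_fibre \<beta> i x" if "x \<in> J" for x using R[OF that] by (simp add: h_def)
          have J'c: "J' \<subseteq> {0..c}" unfolding J'_def
          proof (rule image_subsetI)
            fix x assume "x \<in> J"
            then show "h x \<in> {0..c}" using R_fibre_I[of x i] Jc hR[of x] by auto
          qed
          have "connected (h ` J)" using Ji unfolding is_interval_connected_1
            by (intro connected_continuous_image) (auto simp: h_def intro!: continuous_intros)
          then have J'i: "is_interval J'" by (simp add: is_interval_connected_1 J'_def)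
          have "A \<inter> J \<in> fmeasurable lborel" using Jc by (intro fin) auto
          moreover have "A \<inter> J - (A - pa i) = A \<inter> J \<inter> pa i" by blast
          ultimately have "measure lborel (A \<inter> J \<inter> pa i) = measure lborel (A \<inter> J)"
            using measure_Diff_null_set[OF _ null'[of i], of "A \<inter> J"] by (simp add: fmeasurable_def)
          moreover have sub: "h ` (A \<inter> J \<inter> pa i) \<subseteq> A \<inter> J'" using hR by (auto simp: J'_def pa_def)
          moreover have "measure lborel (h ` (A \<inter> J \<inter> pa i)) \<le> measure lborel (A \<inter> J')"
          proof (rule measure_mono_fmeasurable[OF sub])
            show "h ` (A \<inter> J \<inter> pa i) \<in> sets lborel"
              unfolding h_def using affine_image_lborel(1)[OF beta0, of "A \<inter> J \<inter> pa i"] by auto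
            show "A \<inter> J' \<in> fmeasurable lborel" using J'c by (intro fin) auto
          qed
          moreover have "measure lborel (h ` (A \<inter> J \<inter> pa i)) = \<beta> * measure lborel (A \<inter> J \<inter> pa i)"
            unfolding h_def by (rule affine_image_lborel(3)[OF beta0]) simp
          ultimately have ge: "\<beta> * measure lborel (A \<inter> J) \<le> measure lborel (A \<inter> J')" by simp
          have "(1 - e) * measure lborel J' \<le> \<beta> * measure lborel (A \<inter> J)"
            using mult_left_mono[OF Jd, of \<beta>] beta0 by (simp add: J'm algebra_simps)
          then have "good J'" using J'i J'b J'c ge by (auto simp: good_def)
          then show ?thesis using ge by blast
        qed
        have grow: "\<exists>J. good J \<and> \<beta> ^ k * measure lborel (A \<inter> J0) \<le> measure lborel (A \<inter> J)" for k
        proof (induction k)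
          case 0 then show ?case using J0 by auto
        next
          case (Suc k)
          then obtain J where J: "good J" "\<beta> ^ k * measure lborel (A \<inter> J0) \<le> measure lborel (A \<inter> J)" by blast
          obtain J' where J': "good J'" "\<beta> * measure lborel (A \<inter> J) \<le> measure lborel (A \<inter> J')" using step[OF J(1)] by blast
          have "\<beta> ^ Suc k * measure lborel (A \<inter> J0) \<le> \<beta> * measure lborel (A \<inter> J)" using J(2) beta0 by simp
          then show ?case using J' by (meson order_trans)
        qed
        have "measure lborel (A \<inter> J) \<le> c" if "good J" for J
        proof -
          have "measure lborel (A \<inter> J) \<le> measure lborel {0..c}"
            using that by (intro measure_mono_fmeasurable fin) (auto simp: good_def)
          then show ?thesis using c1 by simp
        qed
        then have le: "\<beta> ^ k * measure lborel (A \<inter> J0) \<le> c" for k using grow[of k] by fastforce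
        obtain k where "c / measure lborel (A \<inter> J0) < \<beta> ^ k" using real_arch_pow[OF beta1] by blast
        then show False using le[of k] J0(2) by (simp add: field_simps)
      qed
      then obtain J where J: "good J" "{1/\<beta>..c/\<beta>} \<subseteq> J" by blast
      then have [measurable]: "J \<in> sets borel" and Jc: "J \<subseteq> {0..c}" by (auto simp: good_def)
      have "measure lborel ({1/\<beta>..c/\<beta>} - A) \<le> measure lborel (J - A)"
        using J(2) Jc by (intro measure_mono_fmeasurable fin) auto
      also have "\<dots> = measure lborel J - measure lborel (A \<inter> J)"
        using Jc fin(2)[of J] fin(2)[of "A \<inter> J"] measure_Diff[of lborel J "A \<inter> J"] fin(1)[of J]
        by (simp add: Diff_Int Int_commute Un_absorb2 le_infI1)
      also have "\<dots> \<le> e * measure lborel J" using J(1) by (simp add: good_def algebra_simps)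
      also have "\<dots> \<le> e * measure lborel {0..c}"
        using e Jc by (intro mult_left_mono measure_mono_fmeasurable fin) auto
      finally show ?thesis using c1 by simp
    qed
    show ?thesis
    proof (rule ccontr)
      assume "\<not> ?thesis"
      then have "0 < measure lborel ({1/\<beta>..c/\<beta>} - A)" by (simp add: zero_less_measure_iff)
      moreover define x where "x = measure lborel ({1/\<beta>..c/\<beta>} - A)"
      ultimately have x: "0 < x" by simp
      \<comment> \<open>This choice of \<open>e\<close> makes the bound at most half of the quantity
        that it bounds.\<close>
      have "x \<le> min (1/2) (x / (2 * c)) * c" unfolding x_def[symmetric]
        using bound[of "min (1/2) (x / (2 * c))"] x c1 by (simp add: x_def)
      also have "\<dots> \<le> x / (2 * c) * c" using c1 by (intro mult_right_mono) auto
      also have "\<dots> = x / 2" using c1 by simp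
      finally show False using x by simp
    qed
  qed
  define f where "f = RN_deriv LI \<mu>"
  define g where "g = RN_deriv LI \<nu>"
  have f: "f \<in> borel_measurable LI" "density LI f = \<mu>" and g: "g \<in> borel_measurable LI" "density LI g = \<nu>"
    using assms sm sn LI.density_RN_deriv[of \<mu>] LI.density_RN_deriv[of \<nu>] by (auto simp: f_def g_def LI_def)
  define A where "A = {x\<in>{0..c}. g x < f x}"
  define B where "B = {x\<in>{0..c}. f x < g x}"
  \<comment> \<open>For probability measures domination is equality, as one sees on
    complements.\<close>
  have le_eq: "m = n" if "prob_space m" "prob_space n" "sets m = sets LI" "sets n = sets LI"
    "\<And>B. B \<in> sets LI \<Longrightarrow> emeasure m B \<le> emeasure n B" for m n :: "real measure"
  proof (rule measure_eqI)
    interpret m: prob_space m by fact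
    interpret n: prob_space n by fact
    have sp: "space m = space LI" "space n = space LI" using sets_eq_imp_space_eq[OF that(3)] sets_eq_imp_space_eq[OF that(4)] by auto
    fix B assume "B \<in> sets m"
    then have B: "B \<in> sets LI" "space LI - B \<in> sets LI" using that by auto
    have "measure m B \<le> measure n B" "measure m (space LI - B) \<le> measure n (space LI - B)"
      using that(5)[OF B(1)] that(5)[OF B(2)] by (simp_all add: m.emeasure_eq_measure n.emeasure_eq_measure)
    then show "emeasure m B = emeasure n B"
      using m.prob_compl[of B] n.prob_compl[of B] B that(3,4) by (simp add: sp m.emeasure_eq_measure n.emeasure_eq_measure)
  qed (use that in simp)
  \<comment> \<open>Otherwise two disjoint sets would each fill the switch region up to a null set,
    and this region has positive length.\<close>
  have notboth: "emeasure LI A = 0 \<or> emeasure LI B = 0"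
  proof (rule ccontr)
    assume neg: "\<not> ?thesis"
    have a: "measure lborel ({1/\<beta>..c/\<beta>} - A) = 0"
      by (rule core[OF f(1) g(1) f(2) g(2) assms(1) assms(5) _ _ A_def]) (use neg mi ni sm sn in auto)
    have b: "measure lborel ({1/\<beta>..c/\<beta>} - B) = 0"
      by (rule core[OF g(1) f(1) g(2) f(2) assms(5) assms(1) _ _ B_def]) (use neg mi ni sm sn in auto)
    have "{x \<in> space LI. g x < f x} \<in> sets LI" "{x \<in> space LI. f x < g x} \<in> sets LI" using f g by measurable
    then have AB[measurable]: "A \<in> sets borel" "B \<in> sets borel" unfolding sLI' sLI(2) A_def B_def by blast+
    have "measure lborel {1/\<beta>..c/\<beta>} \<le> measure lborel ({1/\<beta>..c/\<beta>} - A) + measure lborel ({1/\<beta>..c/\<beta>} - B)"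
    proof -
      have "{1/\<beta>..c/\<beta>} = ({1/\<beta>..c/\<beta>} - A) \<union> ({1/\<beta>..c/\<beta>} - B)" by (auto simp: A_def B_def)
      then show ?thesis using measure_Un_le[of "{1/\<beta>..c/\<beta>} - A" lborel "{1/\<beta>..c/\<beta>} - B"] by simp
    qed
    then show False using a b c_div_less by simp
  qed
  have le: "emeasure m C \<le> emeasure n C"
    if "f \<in> borel_measurable LI" "g \<in> borel_measurable LI" "density LI f = m" "density LI g = n"
      "emeasure LI {x\<in>{0..c}. g x < f x} = 0" "C \<in> sets LI" for f g m n C
  proof -
    have s: "{x\<in>{0..c}. g x < f x} = {x \<in> space LI. \<not> f x \<le> g x}" by (auto simp: sLI not_le)
    have "AE x in LI. f x \<le> g x"
      by (subst AE_iff_measurable[OF _ s[symmetric]]) (use that(1,2,5) s in auto)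
    then show ?thesis unfolding that(3,4)[symmetric] using that(1,2,6)
      by (subst (1 2) emeasure_density) (auto intro!: nn_integral_mono_AE mult_right_mono elim: eventually_mono)
  qed
  from notboth show ?thesis
  proof
    assume "emeasure LI A = 0"
    then show ?thesis using le[OF f(1) g(1) f(2) g(2)] assms sm sn by (intro le_eq) (auto simp: A_def)
  next
    assume "emeasure LI B = 0"
    then show ?thesis using le[OF g(1) f(1) g(2) f(2)] assms sm sn by (intro le_eq[symmetric]) (auto simp: B_def)
  qed
qed


section \<open>Words and heights\<close>

text \<open>Monotone in the point: a digit that moves the end of a piece by \<open>T0\<close> moves
  the whole piece by \<open>T0\<close>. This keeps images inside the tower.\<close>

definition act1 :: "bool \<Rightarrow> real \<Rightarrow> bool" where
  "act1 i x \<longleftrightarrow> 1 / \<beta> \<le> x \<and> (i \<or> c / \<beta> < x)"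

lemma R_fibre_act1: "x \<in> {0..c} \<Longrightarrow> R_fibre \<beta> i x = \<beta> * x - of_bool (act1 i x)"
  by (subst R_fibre_eq) (use c_div_less in \<open>auto simp: act1_def\<close>)

lemma r_Nil: "r \<beta> [] = 1" by (simp add: r_def)
lemma r_snoc: "r \<beta> (w @ [i]) = R_fibre \<beta> i (r \<beta> w)" by (simp add: r_def)

lemma r_I: "r \<beta> w \<in> {0..c}"
proof (induction w rule: rev_induct)
  case Nil show ?case using c1 by (simp add: r_Nil)
next
  case (snoc i w) then show ?case unfolding r_snoc by (rule R_fibre_I)
qed

lemma r_snoc_act1: "r \<beta> (w @ [i]) = \<beta> * r \<beta> w - of_bool (act1 i (r \<beta> w))"
  unfolding r_snoc by (rule R_fibre_act1[OF r_I])

definition height :: "bool list \<Rightarrow> real" where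
  "height w = 1 / (2 * \<beta>) ^ length w"

lemma height_pos: "0 < height w" using beta0 by (simp add: height_def)
lemma height_Nil: "height [] = 1" by (simp add: height_def)
lemma height_snoc: "height (w @ [i]) = height w / (2 * \<beta>)" by (simp add: height_def field_simps)
lemma height_le1: "height w \<le> 1"
  using one_le_power[of "2 * \<beta>" "length w"] beta1 by (simp add: height_def del: power_mult_distrib)

lemma l_snoc: "l (w @ [i]) = l w + of_bool i * 2 ^ length w"
  by (simp add: l_def nth_append)

lemma l_bounds: "1 \<le> l w" "l w \<le> 2 ^ length w"
proof -
  show "1 \<le> l w" by (simp add: l_def)
  show "l w \<le> 2 ^ length w"
  proof (induction w rule: rev_induct)
    case (snoc i w) then show ?case by (cases i) (auto simp: l_snoc)
  qed (simp add: l_def)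
qed

text \<open>\<open>l w - 1\<close> is the number with binary digits \<open>w\<close>, the last digit
  being the most significant one.\<close>

lemma l_inj: "length w = length w' \<Longrightarrow> l w = l w' \<Longrightarrow> w = w'"
proof (induction w arbitrary: w' rule: rev_induct)
  case (snoc i w)
  then obtain w1 j where w': "w' = w1 @ [j]" by (metis length_0_conv rev_exhaust snoc_eq_iff_butlast)
  have len: "length w = length w1" using snoc.prems by (simp add: w')
  have "i = j" using snoc.prems(2) l_bounds[of w] l_bounds[of w1] len by (cases i; cases j) (auto simp: w' l_snoc)
  then show ?case using snoc.IH[OF len] snoc.prems(2) by (simp add: w' l_snoc len)
qed simp

lemma v_lower: "(\<Sum>k<length w. 1 / \<beta> ^ k) \<le> v \<beta> w"
  using l_bounds(1)[of w] beta0 by (simp add: v_def)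

text \<open>Level n consists of 2 ^ n intervals of length 1 / (2 \<beta>) ^ n, so it takes up
  exactly 1 / \<beta> ^ n above the lower levels.\<close>

lemma v_upper: "v \<beta> w + height w \<le> (\<Sum>k<Suc (length w). 1 / \<beta> ^ k)"
proof -
  have "real (l w) \<le> 2 ^ length w" using l_bounds(2)[of w] by (metis of_nat_le_iff of_nat_numeral of_nat_power)
  then have "real (l w) / (2 * \<beta>) ^ length w \<le> 2 ^ length w / (2 * \<beta>) ^ length w"
    using beta0 by (intro divide_right_mono) auto
  also have "\<dots> = 1 / \<beta> ^ length w" by (simp add: power_mult_distrib)
  finally show ?thesis by (simp add: v_def height_def diff_divide_distrib)
qed

lemma v_length_less:
  assumes "length w < length w'" shows "v \<beta> w + height w \<le> v \<beta> w'"
proof -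
  have "(\<Sum>k<Suc (length w). 1 / \<beta> ^ k) \<le> (\<Sum>k<length w'. 1 / \<beta> ^ k)"
    using assms beta0 by (intro sum_mono2) auto
  then show ?thesis using v_upper[of w] v_lower[of w'] by linarith
qed

lemma v_l_less:
  assumes "length w = length w'" "l w < l w'" shows "v \<beta> w + height w \<le> v \<beta> w'"
proof -
  have "real (l w) \<le> real (l w') - 1" using assms(2) by linarith
  then have "real (l w) / (2 * \<beta>) ^ length w \<le> (real (l w') - 1) / (2 * \<beta>) ^ length w"
    using beta0 by (intro divide_right_mono) auto
  then show ?thesis using assms(1) by (simp add: v_def height_def diff_divide_distrib)
qed

lemma v_separated: "w \<noteq> w' \<Longrightarrow> v \<beta> w + height w \<le> v \<beta> w' \<or> v \<beta> w' + height w' \<le> v \<beta> w"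
  using v_length_less[of w w'] v_length_less[of w' w] v_l_less[of w w'] v_l_less[of w' w] l_inj[of w w']
  by (metis linorder_neqE_nat)

lemma v_ge_1: "w \<noteq> [] \<Longrightarrow> 1 \<le> v \<beta> w"
  using v_length_less[of "[]" w] by (simp add: v_Nil height_Nil)

lemma v_nonneg: "0 \<le> v \<beta> w" using v_ge_1[of w] by (cases "w = []") (auto simp: v_Nil)

text \<open>The levels add up to a geometric series with sum \<beta> / (\<beta> - 1) = c + 1. This
  is why the tower has finite measure.\<close>

lemma v_bounded: "v \<beta> w + height w \<le> c + 1"
proof -
  have "(\<Sum>k<n. (1 / \<beta>) ^ k) \<le> c + 1" for n
  proof -
    have "(\<Sum>k<n. (1 / \<beta>) ^ k) = (1 - (1 / \<beta>) ^ n) / (1 - 1 / \<beta>)"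
      using beta1 by (subst sum_gp_strict) auto
    also have "\<dots> \<le> 1 / (1 - 1 / \<beta>)" using beta1 by (intro divide_right_mono) auto
    also have "\<dots> = c + 1" using beta1 by (simp add: c_def field_simps)
    finally show ?thesis .
  qed
  then show ?thesis using v_upper[of w] by (metis (no_types, lifting) order_trans power_one_over sum.cong)
qed

lemma v_unique: "\<lbrakk>v \<beta> w \<le> y; y < v \<beta> w + height w; v \<beta> w' \<le> y; y < v \<beta> w' + height w'\<rbrakk> \<Longrightarrow> w = w'"
  using v_separated[of w w'] by force

subsection \<open>The strips filling the base\<close>

text \<open>
  \<open>returns\<close> collects the words \<open>w\<close> and digits \<open>i\<close> of Case 2, where the part \<open>x < 1 / \<beta>\<close> of the piece
  goes back to the base; \<open>strip w i\<close> is the lower end of the strip of the base where it arrives.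
\<close>

definition returns :: "(bool list \<times> bool) set" where
  "returns = {(a, j). act1 j (r \<beta> a)}"

definition strip :: "bool list \<Rightarrow> bool \<Rightarrow> real" where
  "strip w i = (\<Sum>(a, j) \<in> {(a, j). (a, j) \<in> returns \<and> (v \<beta> a < v \<beta> w \<or> a = w \<and> j < i)}. height (a @ [j]))"

lemma returns_iff: "(a, j) \<in> returns \<longleftrightarrow> r \<beta> (a @ [j]) = T1 \<beta> (r \<beta> a)"
  by (simp add: returns_def r_snoc_act1 T1_def)

lemma C2_eq: "C2 \<beta> w i = strip w i - v \<beta> w / (2 * \<beta>)"
  unfolding C2_def strip_def returns_iff height_def by simp

text \<open>The measure of the n-th level of the tower, as the streams have total mass 1.\<close>

definition mass :: "nat \<Rightarrow> real" where
  "mass n = (\<Sum>w | length w = n. r \<beta> w * height w)"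

lemma mass_nonneg: "0 \<le> mass n"
  unfolding mass_def by (intro sum_nonneg mult_nonneg_nonneg) (use r_I height_pos in \<open>auto intro: less_imp_le\<close>)

lemma finite_words: "finite {w :: bool list. length w = n}" "finite {w :: bool list. length w < n}"
  "finite {(a :: bool list, j :: bool). length a < n \<and> A a j}"
proof -
  show "finite {w :: bool list. length w = n}" using finite_lists_length_eq[of "UNIV :: bool set" n] by simp
  have *: "finite {w :: bool list. length w \<le> n}" using finite_lists_length_le[of "UNIV :: bool set" n] by simp
  then show 2: "finite {w :: bool list. length w < n}" by (rule rev_finite_subset) auto
  have "finite ({w :: bool list. length w < n} \<times> (UNIV :: bool set))" using 2 by simp
  then show "finite {(a :: bool list, j :: bool). length a < n \<and> A a j}" by (rule rev_finite_subset) auto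
qed

lemma sum_words_Suc:
  fixes f :: "bool list \<Rightarrow> 'b::comm_monoid_add"
  shows "(\<Sum>w | length w = Suc n. f w) = (\<Sum>w | length w = n. f (w @ [False]) + f (w @ [True]))"
proof -
  have "bij_betw (\<lambda>(w, i). w @ [i]) ({w. length w = n} \<times> UNIV) {w :: bool list. length w = Suc n}"
  proof (rule bij_betw_imageI)
    show "(\<lambda>(w, i). w @ [i]) ` ({w. length w = n} \<times> UNIV) = {w :: bool list. length w = Suc n}"
      by (force simp: image_iff length_Suc_conv_rev)
  qed (auto simp: inj_on_def)
  from sum.reindex_bij_betw[OF this, of f]
  have "(\<Sum>w | length w = Suc n. f w) = (\<Sum>(w, i)\<in>{w. length w = n} \<times> UNIV. f (w @ [i]))" by (simp add: case_prod_unfold)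
  also have "\<dots> = (\<Sum>w | length w = n. f (w @ [False]) + f (w @ [True]))"
    by (subst sum.cartesian_product[symmetric]) (simp add: UNIV_bool add.commute)
  finally show ?thesis .
qed

text \<open>
  Going up one level, each piece passes on its mass \<open>r h\<close> except for what returns to the base. This
  is why the strips fit into the base.
\<close>

lemma mass_balance: "(\<Sum>(a, j) | length a < n \<and> (a, j) \<in> returns. height (a @ [j])) = 1 - mass n"
proof (induction n)
  case 0
  show ?case by (simp add: mass_def r_Nil height_Nil)
next
  case (Suc n)
  have split: "{(a, j). length a < Suc n \<and> (a, j) \<in> returns} =
      {(a, j). length a < n \<and> (a, j) \<in> returns} \<union> {(a, j). length a = n \<and> (a, j) \<in> returns}" by auto
  have fin: "finite {(a, j). length a = n \<and> (a, j) \<in> returns}"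
    by (rule finite_subset[OF _ finite_words(3)[of "Suc n" "\<lambda>_ _. True"]]) auto
  have "(\<Sum>(a, j) | length a < Suc n \<and> (a, j) \<in> returns. height (a @ [j])) =
      (1 - mass n) + (\<Sum>(a, j) | length a = n \<and> (a, j) \<in> returns. height (a @ [j]))"
    unfolding split by (subst sum.union_disjoint) (use fin finite_words(3)[of n "\<lambda>a j. (a, j) \<in> returns"] Suc in auto)
  also have "(\<Sum>(a, j) | length a = n \<and> (a, j) \<in> returns. height (a @ [j])) =
      (\<Sum>(a, j)\<in>{a. length a = n} \<times> UNIV. of_bool (act1 j (r \<beta> a)) * height (a @ [j]))"
    by (rule sum.mono_neutral_cong_left) (use finite_words(1)[of n] in \<open>auto simp: returns_def\<close>)
  also have "\<dots> = (\<Sum>a | length a = n. (of_bool (act1 False (r \<beta> a)) + of_bool (act1 True (r \<beta> a))) * height (a @ [False]))"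
    by (subst sum.cartesian_product[symmetric]) (simp add: UNIV_bool height_def algebra_simps add_divide_distrib)
  \<comment> \<open>Each digit leads to the end \<beta> r, less 1 if \<open>T1\<close> acts, over a
    height divided by 2 \<beta>. Over both digits this is the whole mass of the piece minus the
    strips that return.\<close>
  also have "\<dots> = (\<Sum>a | length a = n. r \<beta> a * height a - r \<beta> (a @ [False]) * height (a @ [False]) - r \<beta> (a @ [True]) * height (a @ [True]))"
    by (intro sum.cong refl) (use beta0 in \<open>simp add: height_snoc r_snoc_act1 field_simps\<close>)
  also have "\<dots> = mass n - mass (Suc n)"
    unfolding mass_def sum_words_Suc by (simp add: sum_subtractf sum.distrib)
  finally show ?case by simp
qed

lemma finite_before: "finite {(a, j). (a, j) \<in> returns \<and> (v \<beta> a < v \<beta> w \<or> a = w \<and> j < i)}"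
proof (rule finite_subset[OF _ finite_words(3)[of "Suc (length w)" "\<lambda>_ _. True"]])
  show "{(a, j). (a, j) \<in> returns \<and> (v \<beta> a < v \<beta> w \<or> a = w \<and> j < i)} \<subseteq> {(a, j). length a < Suc (length w) \<and> True}"
    using v_length_less[of w] height_pos[of w] by (force simp: not_less_eq)
qed

lemma strip_nonneg: "0 \<le> strip w i"
  unfolding strip_def by (intro sum_nonneg) (auto intro: less_imp_le height_pos)

text \<open>Adding the height of the strip itself to the heights of all earlier ones gives its upper
  end, and a later strip sums over at least these terms.\<close>

lemma strip_less:
  assumes "(w, i) \<in> returns" "v \<beta> w < v \<beta> w' \<or> w = w' \<and> i < i'"
  shows "strip w i + height (w @ [i]) \<le> strip w' i'"
proof -
  let ?B = "\<lambda>w i. {(a, j). (a, j) \<in> returns \<and> (v \<beta> a < v \<beta> w \<or> a = w \<and> j < i)}"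
  have "strip w i + height (w @ [i]) = (\<Sum>(a, j)\<in>insert (w, i) (?B w i). height (a @ [j]))"
    unfolding strip_def using finite_before by (subst sum.insert) auto
  also have "\<dots> \<le> (\<Sum>(a, j)\<in>?B w' i'. height (a @ [j]))"
    using assms finite_before by (intro sum_mono2) (auto intro: less_imp_le height_pos)
  finally show ?thesis by (simp add: strip_def)
qed

lemma strip_separated:
  assumes "(w, i) \<in> returns" "(w', i') \<in> returns" "(w, i) \<noteq> (w', i')"
  shows "strip w i + height (w @ [i]) \<le> strip w' i' \<or> strip w' i' + height (w' @ [i']) \<le> strip w i"
proof -
  have "v \<beta> w < v \<beta> w' \<or> v \<beta> w' < v \<beta> w" if "w \<noteq> w'"
    using v_separated[OF that] height_pos[of w] height_pos[of w'] by linarith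
  moreover have "i < i' \<or> i' < i" if "i \<noteq> i'" using that by auto
  ultimately show ?thesis using strip_less[of w i w' i'] strip_less[of w' i' w i] assms by blast
qed

text \<open>By \<open>mass_balance\<close> the strips that leave the levels up to that of
  \<open>w\<close> have total height 1 minus a nonnegative mass.\<close>

lemma strip_le_1:
  assumes "(w, i) \<in> returns"
  shows "strip w i + height (w @ [i]) \<le> 1"
proof -
  let ?B = "{(a, j). (a, j) \<in> returns \<and> (v \<beta> a < v \<beta> w \<or> a = w \<and> j < i)}"
  have "strip w i + height (w @ [i]) = (\<Sum>(a, j)\<in>insert (w, i) ?B. height (a @ [j]))"
    unfolding strip_def using finite_before by (subst sum.insert) auto
  also have "\<dots> \<le> (\<Sum>(a, j) | length a < Suc (length w) \<and> (a, j) \<in> returns. height (a @ [j]))"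
  proof (rule sum_mono2[OF finite_words(3)])
    show "insert (w, i) ?B \<subseteq> {(a, j). length a < Suc (length w) \<and> (a, j) \<in> returns}"
      using assms v_length_less[of w] height_pos[of w] by (force simp: not_less_eq)
  qed (auto intro: less_imp_le height_pos)
  also have "\<dots> \<le> 1" using mass_balance[of "Suc (length w)"] mass_nonneg[of "Suc (length w)"] by simp
  finally show ?thesis .
qed

lemma strip_unique:
  "\<lbrakk>(w, i) \<in> returns; (w', i') \<in> returns; strip w i \<le> y; y < strip w i + height (w @ [i]);
    strip w' i' \<le> y; y < strip w' i' + height (w' @ [i'])\<rbrakk> \<Longrightarrow> w = w' \<and> i = i'"
  using strip_separated[of w i w' i'] by fastforce


section \<open>The maps on the tower\<close>

abbreviation S :: "bool stream \<times> real \<times> real \<Rightarrow> bool stream \<times> real \<times> real" where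
  "S \<equiv> psi_tilde \<beta>"

lemma mem_piece: "(\<eta>, x, y) \<in> piece \<beta> w \<longleftrightarrow> x \<in> {0..r \<beta> w} \<and> v \<beta> w \<le> y \<and> y < v \<beta> w + height w"
  by (auto simp: piece_def height_def)

lemma mem_E: "(\<eta>, x, y) \<in> E \<beta> \<longleftrightarrow> (\<exists>w. (\<eta>, x, y) \<in> piece \<beta> w)"
  by (auto simp: E_def)

lemma word_of_piece: "z \<in> piece \<beta> w \<Longrightarrow> word_of \<beta> z = w"
  unfolding word_of_def by (cases z) (auto simp: mem_piece intro: v_unique)

lemma P_eq: "P \<beta> (\<eta>, x, y) = (smap Not \<eta>, c - x, - y)"
  by (simp add: P_def c_def)

lemma mem_P_image: "z \<in> P \<beta> ` A \<longleftrightarrow> P \<beta> z \<in> A"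
  by (metis P_P image_iff)

lemma psi_E_piece:
  assumes "(\<eta>, x, y) \<in> piece \<beta> w"
  shows "psi_E \<beta> (\<eta>, x, y) =
    (if \<not> act1 (shd \<eta>) (r \<beta> w) then (stl \<eta>, \<beta> * x, v \<beta> (w @ [shd \<eta>]) + (y - v \<beta> w) / (2 * \<beta>))
     else if x < 1 / \<beta> then (stl \<eta>, \<beta> * x, strip w (shd \<eta>) + (y - v \<beta> w) / (2 * \<beta>))
     else (stl \<eta>, \<beta> * x - 1, v \<beta> (w @ [shd \<eta>]) + (y - v \<beta> w) / (2 * \<beta>)))"
proof -
  have x: "x \<in> {0..c}" using assms r_I[of w] by (auto simp: mem_piece)
  have "x \<in> reg_S \<beta> \<union> reg_R \<beta> \<longleftrightarrow> \<not> x < 1 / \<beta>"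
    using x c_div_less by (auto simp: reg_S_def reg_R_def c_div c_def[symmetric])
  then show ?thesis
    unfolding psi_E_def Let_def prod.case word_of_piece[OF assms]
    by (simp add: R_fibre_act1[OF r_I] T0_def T1_def C1_def C2_eq diff_divide_distrib)
qed

definition crossing :: "(bool stream \<times> real \<times> real) set" where
  "crossing = (\<Union>w. psi_E \<beta> ` F \<beta> w)"

text \<open>\<open>T1\<close> maps the switch region onto \<open>{0..c - 1}\<close>, and the shift
  removes the digit 0 and reaches every stream. So each image of an \<open>F \<beta> w\<close> is a
  full product, free of conditions on the stream.\<close>

lemma mem_crossing:
  "(\<eta>, x, y) \<in> crossing \<longleftrightarrow> (\<exists>w. c / \<beta> < r \<beta> w \<and> 0 \<le> x \<and> x \<le> c - 1 \<and>
     v \<beta> (w @ [False]) \<le> y \<and> y < v \<beta> (w @ [False]) + height (w @ [False]))"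
proof
  assume "(\<eta>, x, y) \<in> crossing"
  then obtain w \<eta>' x' y' where F: "(\<eta>', x', y') \<in> F \<beta> w" and eq: "(\<eta>, x, y) = psi_E \<beta> (\<eta>', x', y')"
    by (auto simp: crossing_def)
  then have r: "c / \<beta> < r \<beta> w" and p: "(\<eta>', x', y') \<in> piece \<beta> w" "\<not> shd \<eta>'" and x': "1 / \<beta> \<le> x'" "x' \<le> c / \<beta>"
    by (auto simp: F_def reg_R_def reg_S_def c_div split: if_splits)
  have act: "act1 False (r \<beta> w)" using r c_div_less by (auto simp: act1_def)
  have "y' - v \<beta> w < height w" "0 \<le> y' - v \<beta> w" using p by (auto simp: mem_piece)
  then have "(y' - v \<beta> w) / (2 * \<beta>) < height (w @ [False])" "0 \<le> (y' - v \<beta> w) / (2 * \<beta>)"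
    using beta0 by (auto simp: height_snoc divide_strict_right_mono)
  moreover have "0 \<le> \<beta> * x' - 1" "\<beta> * x' - 1 \<le> c - 1" using x' beta0 by (auto simp: field_simps)
  ultimately show "\<exists>w. c / \<beta> < r \<beta> w \<and> 0 \<le> x \<and> x \<le> c - 1 \<and>
     v \<beta> (w @ [False]) \<le> y \<and> y < v \<beta> (w @ [False]) + height (w @ [False])"
    using eq p act x' r unfolding psi_E_piece[OF p(1)] by (auto intro!: exI[of _ w])
next
  assume "\<exists>w. c / \<beta> < r \<beta> w \<and> 0 \<le> x \<and> x \<le> c - 1 \<and>
     v \<beta> (w @ [False]) \<le> y \<and> y < v \<beta> (w @ [False]) + height (w @ [False])"
  then obtain w where w: "c / \<beta> < r \<beta> w" "0 \<le> x" "x \<le> c - 1"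
     "v \<beta> (w @ [False]) \<le> y" "y < v \<beta> (w @ [False]) + height (w @ [False])" by blast
  \<comment> \<open>The preimage under the affine branch; the removed digit 0 is put back in front
    of the stream.\<close>
  define x' where "x' = (x + 1) / \<beta>"
  define y' where "y' = v \<beta> w + 2 * \<beta> * (y - v \<beta> (w @ [False]))"
  have x': "1 / \<beta> \<le> x'" "x' \<le> c / \<beta>" "\<beta> * x' - 1 = x" using w beta0 by (auto simp: x'_def divide_right_mono)
  have y': "v \<beta> w \<le> y'" "y' < v \<beta> w + height w" "v \<beta> (w @ [False]) + (y' - v \<beta> w) / (2 * \<beta>) = y"
    using w(4,5) beta0 by (auto simp: y'_def height_snoc field_simps)
  have act: "act1 False (r \<beta> w)" using w c_div_less by (auto simp: act1_def)
  have p: "(False ## \<eta>, x', y') \<in> piece \<beta> w" using x' y' w(1) c_div_less order_trans[of 0 "1/\<beta>" x'] by (auto simp: mem_piece)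
  have "r \<beta> w \<in> reg_R \<beta>" using w(1) r_I[of w] by (auto simp: reg_R_def c_div c_def)
  then have "(False ## \<eta>, x', y') \<in> F \<beta> w" using p x' by (auto simp: F_def reg_S_def c_div)
  moreover have "psi_E \<beta> (False ## \<eta>, x', y') = (\<eta>, x, y)"
    unfolding psi_E_piece[OF p] using act x' y' by auto
  ultimately show "(\<eta>, x, y) \<in> crossing" unfolding crossing_def by (metis UN_iff UNIV_I image_eqI)
qed

lemma crossing_ge_1: "(\<eta>, x, y) \<in> crossing \<Longrightarrow> 1 \<le> y"
  unfolding mem_crossing using v_ge_1 by (meson order_trans snoc_eq_iff_butlast)

lemma crossing_bar: "(\<Union>w. psi_E_bar \<beta> ` F_bar \<beta> w) = P \<beta> ` crossing"
proof -
  have "psi_E_bar \<beta> ` F_bar \<beta> w = P \<beta> ` psi_E \<beta> ` F \<beta> (map Not w)" for w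
    by (simp add: psi_E_bar_def F_bar_def image_comp comp_def P_P)
  then have "(\<Union>w. psi_E_bar \<beta> ` F_bar \<beta> w) = P \<beta> ` (\<Union>w. psi_E \<beta> ` F \<beta> (map Not w))" by auto
  also have "(\<Union>w. psi_E \<beta> ` F \<beta> (map Not w)) = crossing"
  proof -
    have "surj (map Not)" by (rule surjI[of _ "map Not"]) (simp add: comp_def)
    then show ?thesis unfolding crossing_def by (metis (no_types, lifting) SUP_cong UN_extend_simps(10) image_image)
  qed
  finally show ?thesis .
qed

lemma Q_eq: "Q \<beta> (\<eta>, x, y) = (if (\<eta>, x, y) \<in> crossing then (\<eta>, x + 1, - y)
     else if P \<beta> (\<eta>, x, y) \<in> crossing then (\<eta>, x - 1, - y) else (\<eta>, x, y))"
  unfolding Q_def prod.case crossing_bar mem_P_image crossing_def[symmetric] by simp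

lemma smap_Not_Not [simp]: "smap Not (smap Not \<eta>) = \<eta>"
  by (simp add: stream.map_comp stream.map_ident comp_def)

lemma crossing_cong: "(\<eta>, x, y) \<in> crossing \<longleftrightarrow> (\<eta>', x, y) \<in> crossing"
  unfolding mem_crossing ..

text \<open>\<open>P\<close> turns the moved point (x + 1, - y) into (c - 1 - x, y). This symmetry
  is what makes \<open>Q\<close> an involution that exchanges \<open>crossing\<close> with its
  mirror image.\<close>

lemma crossing_mirror: "(\<eta>, x, y) \<in> crossing \<longleftrightarrow> (\<eta>, c - 1 - x, y) \<in> crossing"
  unfolding mem_crossing by (rule ex_cong1) auto

lemma Q_Q: "Q \<beta> (Q \<beta> z) = z"
proof -
  obtain \<eta> x y where z: "z = (\<eta>, x, y)" by (cases z)
  consider "(\<eta>, x, y) \<in> crossing" | "(\<eta>, x, y) \<notin> crossing" "P \<beta> (\<eta>, x, y) \<in> crossing"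
    | "(\<eta>, x, y) \<notin> crossing" "P \<beta> (\<eta>, x, y) \<notin> crossing" by blast
  then show ?thesis
  proof cases
    case 1
    have "(\<eta>, x + 1, - y) \<notin> crossing" using crossing_ge_1[OF 1] crossing_ge_1[of \<eta> "x + 1" "- y"] by auto
    moreover have "P \<beta> (\<eta>, x + 1, - y) \<in> crossing"
      using 1 crossing_mirror[of "smap Not \<eta>" x y] crossing_cong[of \<eta> x y "smap Not \<eta>"] by (simp add: P_eq algebra_simps)
    ultimately show ?thesis using 1 by (simp add: z Q_eq)
  next
    case 2
    then have "(smap Not \<eta>, c - x, - y) \<in> crossing" by (simp add: P_eq)
    then have "(\<eta>, x - 1, - y) \<in> crossing"
      using crossing_mirror[of \<eta> "c - x" "- y"] crossing_cong[of \<eta> "c - x" "- y" "smap Not \<eta>"] by (simp add: algebra_simps)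
    then show ?thesis using 2 by (simp add: z Q_eq)
  qed (simp add: z Q_eq)
qed

text \<open>For y > -1 the mirror image of \<open>crossing\<close> is out of reach, so only the
  first branch of \<open>Q\<close> can move the point and only the second can move its mirror
  point.\<close>

lemma Q_P: "y > -1 \<Longrightarrow> Q \<beta> (P \<beta> (\<eta>, x, y)) = P \<beta> (Q \<beta> (\<eta>, x, y))"
proof -
  assume y: "y > -1"
  have n1: "P \<beta> (\<eta>, x, y) \<notin> crossing" using y crossing_ge_1[of "smap Not \<eta>" "c - x" "- y"] by (auto simp: P_eq)
  have "Q \<beta> (smap Not \<eta>, c - x, - y) = (if P \<beta> (smap Not \<eta>, c - x, - y) \<in> crossing then (smap Not \<eta>, c - x - 1, y) else (smap Not \<eta>, c - x, - y))"
    using n1 by (simp add: Q_eq P_eq)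
  also have "P \<beta> (smap Not \<eta>, c - x, - y) = (\<eta>, x, y)" by (simp add: P_eq)
  finally show ?thesis using n1 by (simp add: Q_eq P_eq)
qed

lemma psi_E_nonneg: "(\<eta>, x, y) \<in> piece \<beta> w \<Longrightarrow> 0 \<le> snd (snd (psi_E \<beta> (\<eta>, x, y)))"
  using v_nonneg strip_nonneg beta0 by (auto simp: psi_E_piece mem_piece)

text \<open>The third branch is the effect of \<open>Q\<close>: \<open>T1\<close> followed by adding
  1 is \<open>T0\<close>. It occurs where digit 0 meets a point of the switch region in a piece
  whose end moves by \<open>T1\<close>, and it makes the projection follow
  \<open>R_fibre\<close>.\<close>

lemma psi_tilde_E:
  assumes p: "(\<eta>, x, y) \<in> piece \<beta> w"
  shows "S (\<eta>, x, y) =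
    (if \<not> act1 (shd \<eta>) (r \<beta> w) then (stl \<eta>, \<beta> * x, v \<beta> (w @ [shd \<eta>]) + (y - v \<beta> w) / (2 * \<beta>))
     else if x < 1 / \<beta> then (stl \<eta>, \<beta> * x, strip w (shd \<eta>) + (y - v \<beta> w) / (2 * \<beta>))
     else if \<not> shd \<eta> \<and> x \<le> c / \<beta> then (stl \<eta>, \<beta> * x, - (v \<beta> (w @ [shd \<eta>]) + (y - v \<beta> w) / (2 * \<beta>)))
     else (stl \<eta>, \<beta> * x - 1, v \<beta> (w @ [shd \<eta>]) + (y - v \<beta> w) / (2 * \<beta>)))"
proof -
  let ?t = "(y - v \<beta> w) / (2 * \<beta>)" and ?i = "shd \<eta>"
  have x: "0 \<le> x" "x \<le> r \<beta> w" and y: "0 \<le> y - v \<beta> w" "y - v \<beta> w < height w" using p by (auto simp: mem_piece)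
  have t: "0 \<le> ?t" "?t < height (w @ [i])" for i using y beta0 by (auto simp: height_snoc divide_strict_right_mono)
  have S: "S (\<eta>, x, y) = Q \<beta> (psi_E \<beta> (\<eta>, x, y))" using p by (auto simp: psi_tilde_def psi_def mem_E)
  have notbar: "P \<beta> (\<eta>', x', y') \<notin> crossing" if "0 \<le> y'" for \<eta>' x' y'
    using crossing_ge_1[of "smap Not \<eta>'" "c - x'" "- y'"] that by (auto simp: P_eq)
  \<comment> \<open>This height lies in the interval of \<open>w @ [?i]\<close> and of no other
    word, so only \<open>w\<close> can witness membership in \<open>crossing\<close>.\<close>
  have level: "(\<eta>', x', v \<beta> (w @ [?i]) + ?t) \<in> crossing \<longleftrightarrow> \<not> ?i \<and> c / \<beta> < r \<beta> w \<and> 0 \<le> x' \<and> x' \<le> c - 1" for \<eta>' x'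
  proof
    assume "(\<eta>', x', v \<beta> (w @ [?i]) + ?t) \<in> crossing"
    then obtain w' where w': "c / \<beta> < r \<beta> w'" "0 \<le> x'" "x' \<le> c - 1" "v \<beta> (w' @ [False]) \<le> v \<beta> (w @ [?i]) + ?t"
       "v \<beta> (w @ [?i]) + ?t < v \<beta> (w' @ [False]) + height (w' @ [False])" unfolding mem_crossing by blast
    have "w @ [?i] = w' @ [False]" by (rule v_unique[OF _ _ w'(4,5)]) (use t(1) t(2)[of ?i] in auto)
    then show "\<not> ?i \<and> c / \<beta> < r \<beta> w \<and> 0 \<le> x' \<and> x' \<le> c - 1" using w' by auto
  next
    assume "\<not> ?i \<and> c / \<beta> < r \<beta> w \<and> 0 \<le> x' \<and> x' \<le> c - 1"
    then show "(\<eta>', x', v \<beta> (w @ [?i]) + ?t) \<in> crossing"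
      unfolding mem_crossing using t by (auto intro!: exI[of _ w])
  qed
  have vt: "0 \<le> v \<beta> (w @ [?i]) + ?t" using v_nonneg t by (simp add: add_nonneg_nonneg)
  show ?thesis
  proof (cases "act1 ?i (r \<beta> w)")
    case False
    then have "\<not> (\<not> ?i \<and> c / \<beta> < r \<beta> w)" using c_div_less by (auto simp: act1_def)
    then show ?thesis unfolding S psi_E_piece[OF p] using False level notbar[OF vt] by (auto simp: Q_eq)
  next
    case True
    show ?thesis
    proof (cases "x < 1 / \<beta>")
      case True
      have "(w, ?i) \<in> returns" using \<open>act1 ?i (r \<beta> w)\<close> by (simp add: returns_def)
      \<comment> \<open>Returning points arrive below height 1, where \<open>crossing\<close> has no
        points.\<close>
      then have lt: "strip w ?i + ?t < 1" using strip_le_1[of w ?i] t(2)[of ?i] by linarith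
      have "0 \<le> strip w ?i + ?t" using strip_nonneg t by (simp add: add_nonneg_nonneg)
      moreover have "(\<eta>', x', strip w ?i + ?t) \<notin> crossing" for \<eta>' x' using crossing_ge_1 lt by fastforce
      ultimately show ?thesis unfolding S psi_E_piece[OF p] using True \<open>act1 ?i (r \<beta> w)\<close> notbar by (auto simp: Q_eq)
    next
      case False
      have x1: "0 \<le> \<beta> * x - 1" "\<beta> * x - 1 \<le> c - 1 \<longleftrightarrow> x \<le> c / \<beta>" using False beta0 by (auto simp: field_simps)
      have "c / \<beta> < r \<beta> w" if "\<not> ?i" using True that by (auto simp: act1_def)
      then show ?thesis unfolding S psi_E_piece[OF p] using True False level x1 notbar[OF vt] by (auto simp: Q_eq)
    qed
  qed
qed

lemma psi_tilde_P:
  assumes z: "z \<in> E \<beta>" "P \<beta> z \<notin> E \<beta>"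
  shows "S (P \<beta> z) = P \<beta> (S z)"
proof -
  obtain \<eta> x y where u: "psi_E \<beta> z = (\<eta>, x, y)" by (cases "psi_E \<beta> z")
  have "0 \<le> y" using z(1) psi_E_nonneg u by (metis E_def UN_E prod_cases3 snd_conv)
  then have "Q \<beta> (P \<beta> (psi_E \<beta> z)) = P \<beta> (Q \<beta> (psi_E \<beta> z))" unfolding u by (intro Q_P) simp
  then show ?thesis using z by (simp add: psi_tilde_def psi_def psi_E_bar_def P_P)
qed

end

section \<open>Images under the branches\<close>

text \<open>Formulated with images of subsets, so that it can be checked branch by branch and passes
  to compositions; injectivity then keeps the images of different branches disjoint.\<close>

definition forward_preserving :: "'a measure \<Rightarrow> ('a \<Rightarrow> 'a) \<Rightarrow> 'a set \<Rightarrow> bool" where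
  "forward_preserving M f G \<longleftrightarrow>
     (\<forall>A\<in>sets M. A \<subseteq> G \<longrightarrow> f ` A \<in> sets M \<and> emeasure M (f ` A) = emeasure M A)"

lemma forward_preserving_UN:
  assumes I: "countable I" and A[measurable]: "\<And>i. i \<in> I \<Longrightarrow> A i \<in> sets M" and dj: "disjoint_family_on A I"
    and G: "G \<subseteq> (\<Union>i\<in>I. A i)" and inj: "inj_on f G"
    and f: "\<And>i. i \<in> I \<Longrightarrow> forward_preserving M f (A i)"
  shows "forward_preserving M f G"
  unfolding forward_preserving_def
proof (intro ballI impI)
  fix B assume [measurable]: "B \<in> sets M" and BG: "B \<subseteq> G"
  have B: "B = (\<Union>i\<in>I. B \<inter> A i)" using BG G by blast
  have fA: "f ` (B \<inter> A i) \<in> sets M" "emeasure M (f ` (B \<inter> A i)) = emeasure M (B \<inter> A i)" if "i \<in> I" for i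
    using f[OF that] that unfolding forward_preserving_def by auto
  have djB: "disjoint_family_on (\<lambda>i. B \<inter> A i) I" using dj by (auto simp: disjoint_family_on_def)
  have djf: "disjoint_family_on (\<lambda>i. f ` (B \<inter> A i)) I"
    unfolding disjoint_family_on_def
  proof (intro ballI impI)
    fix i j assume "i \<in> I" "j \<in> I" "i \<noteq> j"
    then have "(B \<inter> A i) \<inter> (B \<inter> A j) = {}" using djB by (auto simp: disjoint_family_on_def)
    then show "f ` (B \<inter> A i) \<inter> f ` (B \<inter> A j) = {}"
      using inj_on_image_Int[OF inj, of "B \<inter> A i" "B \<inter> A j"] BG by blast
  qed
  have fB: "f ` B = (\<Union>i\<in>I. f ` (B \<inter> A i))" by (subst B) blast
  have "f ` B \<in> sets M" unfolding fB by (rule sets.countable_UN'[OF I]) (use fA in blast)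
  moreover have "emeasure M (f ` B) = (\<integral>\<^sup>+i. emeasure M (f ` (B \<inter> A i)) \<partial>count_space I)"
    unfolding fB by (rule emeasure_UN_countable[OF _ I djf]) (rule fA)
  moreover have "\<dots> = (\<integral>\<^sup>+i. emeasure M (B \<inter> A i) \<partial>count_space I)"
    by (intro nn_integral_cong) (simp add: fA)
  moreover have "\<dots> = emeasure M (\<Union>i\<in>I. B \<inter> A i)"
    by (rule emeasure_UN_countable[OF _ I djB, symmetric]) auto
  ultimately show "f ` B \<in> sets M \<and> emeasure M (f ` B) = emeasure M B" using B by simp
qed

lemma forward_preserving_comp:
  assumes "forward_preserving M f G" "f ` G \<subseteq> H" "forward_preserving M g H"
  shows "forward_preserving M (\<lambda>x. g (f x)) G"
  unfolding forward_preserving_def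
proof (intro ballI impI)
  fix A assume A: "A \<in> sets M" "A \<subseteq> G"
  then have "f ` A \<in> sets M" "f ` A \<subseteq> H" "emeasure M (f ` A) = emeasure M A"
    using assms(1,2) by (auto simp: forward_preserving_def)
  then show "(\<lambda>x. g (f x)) ` A \<in> sets M \<and> emeasure M ((\<lambda>x. g (f x)) ` A) = emeasure M A"
    using assms(3) unfolding forward_preserving_def by (metis image_image)
qed

text \<open>Images under an involution are preimages, so ordinary invariance of the measure is
  enough.\<close>

lemma forward_preserving_involution:
  assumes f[measurable]: "f \<in> M \<rightarrow>\<^sub>M M" and ff: "\<And>x. f (f x) = x" and M: "space M = UNIV"
    and mp: "\<And>A. A \<in> sets M \<Longrightarrow> emeasure M (f -` A) = emeasure M A"
  shows "forward_preserving M f G"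
proof -
  have "f ` A = f -` A" for A
  proof (intro equalityI subsetI)
    fix x assume "x \<in> f -` A"
    then show "x \<in> f ` A" using image_eqI[of x f "f x" A] ff by simp
  qed (use ff in auto)
  then show ?thesis using measurable_sets[OF f] mp by (auto simp: forward_preserving_def M)
qed

lemma forward_preserving_cong:
  assumes "forward_preserving M f G" "\<And>x. x \<in> G \<Longrightarrow> f x = g x"
  shows "forward_preserving M g G"
proof -
  have "f ` A = g ` A" if "A \<subseteq> G" for A using assms(2) that by (intro image_cong) auto
  then show ?thesis using assms(1) by (auto simp: forward_preserving_def)
qed

lemma forward_preserving_subset: "forward_preserving M f G \<Longrightarrow> H \<subseteq> G \<Longrightarrow> forward_preserving M f H"
  by (auto simp: forward_preserving_def)

section \<open>The Bernoulli measure and its product with planar Lebesgue measure\<close>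

lemma sets_bernoulli[measurable_cong]: "sets bernoulli_measure = sets (stream_space (count_space UNIV))"
  unfolding bernoulli_measure_def by (rule sets_stream_space_cong) simp

lemma space_bernoulli[simp]: "space bernoulli_measure = UNIV"
  by (simp add: bernoulli_measure_def space_stream_space)

interpretation bernoulli: prob_space bernoulli_measure
  unfolding bernoulli_measure_def by (rule prob_space.prob_space_stream_space) (rule prob_space_measure_pmf)

lemma nn_integral_bernoulli:
  assumes f[measurable]: "f \<in> borel_measurable bernoulli_measure"
  shows "(\<integral>\<^sup>+\<eta>. f \<eta> \<partial>bernoulli_measure) =
     ennreal (1/2) * (\<integral>\<^sup>+\<eta>. f (True ## \<eta>) \<partial>bernoulli_measure) + ennreal (1/2) * (\<integral>\<^sup>+\<eta>. f (False ## \<eta>) \<partial>bernoulli_measure)"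
proof -
  have f': "f \<in> borel_measurable (stream_space (measure_pmf (bernoulli_pmf (1/2))))" using f by (simp add: bernoulli_measure_def)
  have "(\<integral>\<^sup>+\<eta>. f \<eta> \<partial>bernoulli_measure) =
      (\<integral>\<^sup>+i. \<integral>\<^sup>+\<eta>. f (i ## \<eta>) \<partial>bernoulli_measure \<partial>measure_pmf (bernoulli_pmf (1/2)))"
    unfolding bernoulli_measure_def
    by (rule prob_space.nn_integral_stream_space[OF prob_space_measure_pmf f'])
  also have "\<dots> = ennreal (1/2) * (\<integral>\<^sup>+\<eta>. f (True ## \<eta>) \<partial>bernoulli_measure) + ennreal (1/2) * (\<integral>\<^sup>+\<eta>. f (False ## \<eta>) \<partial>bernoulli_measure)"
    by (subst nn_integral_bernoulli_pmf) (auto simp: mult.commute)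
  finally show ?thesis .
qed

text \<open>A cylinder of length n has mass (1/2) ^ n whatever its digits, and cylinders determine
  the measure.\<close>

lemma bernoulli_smap_Not: "distr bernoulli_measure bernoulli_measure (smap Not) = bernoulli_measure"
proof (rule stream_space_eq_sstart[of UNIV])
  have [measurable]: "smap Not \<in> bernoulli_measure \<rightarrow>\<^sub>M bernoulli_measure" by measurable
  show "prob_space (distr bernoulli_measure bernoulli_measure (smap Not))" by (rule bernoulli.prob_space_distr) simp
  have half: "emeasure bernoulli_measure (sstart UNIV xs) = ennreal ((1/2) ^ length xs)" for xs :: "bool list"
  proof (induction xs)
    case Nil then show ?case using bernoulli.emeasure_space_1 by simp
  next
    case (Cons i xs)
    have [measurable]: "sstart UNIV zs \<in> sets bernoulli_measure" for zs :: "bool list"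
      using sets_sstart[of UNIV zs] by (simp add: sets_bernoulli)
    have "emeasure bernoulli_measure (sstart UNIV (i # xs)) = (\<integral>\<^sup>+\<eta>. indicator (sstart UNIV (i # xs)) \<eta> \<partial>bernoulli_measure)" by simp
    also have "\<dots> = ennreal (1/2) * (\<integral>\<^sup>+\<eta>. indicator (sstart UNIV xs) \<eta> \<partial>bernoulli_measure)"
    proof -
      have ind: "indicator (sstart UNIV (i # xs)) (j ## \<eta>) = (if i = j then indicator (sstart UNIV xs) \<eta> else 0 :: ennreal)" for j \<eta>
        by (simp add: indicator_def)
      have "indicator (sstart UNIV (i # xs)) \<in> borel_measurable bernoulli_measure" by measurable
      from nn_integral_bernoulli[OF this] show ?thesis unfolding ind by (cases i) (simp_all del: nn_integral_indicator)
    qed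
    also have "\<dots> = ennreal (1/2) * ennreal ((1/2) ^ length xs)" using Cons by simp
    also have "\<dots> = ennreal ((1/2) * (1/2) ^ length xs)" by (rule ennreal_mult'[symmetric]) simp
    finally show ?case by simp
  qed
  fix xs :: "bool list"
  have "smap Not -` sstart UNIV xs \<inter> space bernoulli_measure = sstart UNIV (map Not xs)"
    by (auto simp: sstart_eq)
  moreover have "sstart UNIV xs \<in> sets bernoulli_measure" using sets_sstart[of UNIV xs] by (simp add: sets_bernoulli)
  ultimately show "emeasure (distr bernoulli_measure bernoulli_measure (smap Not)) (sstart UNIV xs) =
      emeasure bernoulli_measure (sstart UNIV xs)"
    by (subst emeasure_distr) (auto simp: half)
qed (auto simp: sets_bernoulli bernoulli.prob_space_axioms)

abbreviation K :: "(bool stream \<times> real \<times> real) measure" where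
  "K \<equiv> bernoulli_measure \<Otimes>\<^sub>M lborel \<Otimes>\<^sub>M lborel"

lemma space_K[simp]: "space K = UNIV" by (simp add: space_pair_measure)

lemma nn_integral_K:
  assumes [measurable]: "f \<in> borel_measurable K"
  shows "(\<integral>\<^sup>+z. f z \<partial>K) = (\<integral>\<^sup>+x. \<integral>\<^sup>+y. \<integral>\<^sup>+\<eta>. f (\<eta>, x, y) \<partial>bernoulli_measure \<partial>lborel \<partial>lborel)"
proof -
  interpret p: pair_sigma_finite bernoulli_measure "lborel \<Otimes>\<^sub>M lborel :: (real \<times> real) measure"
    by (intro pair_sigma_finite.intro bernoulli.sigma_finite_measure_axioms lborel_pair.sigma_finite_measure_axioms)
  have "(\<integral>\<^sup>+z. f z \<partial>K) = (\<integral>\<^sup>+u. \<integral>\<^sup>+\<eta>. f (\<eta>, u) \<partial>bernoulli_measure \<partial>(lborel \<Otimes>\<^sub>M lborel))"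
    by (rule p.nn_integral_snd[symmetric]) simp
  also have "\<dots> = (\<integral>\<^sup>+x. \<integral>\<^sup>+y. \<integral>\<^sup>+\<eta>. f (\<eta>, x, y) \<partial>bernoulli_measure \<partial>lborel \<partial>lborel)"
    by (rule lborel.nn_integral_fst[symmetric]) simp
  finally show ?thesis .
qed

lemma nn_integral_affine:
  fixes a b :: real
  assumes [measurable]: "f \<in> borel_measurable borel" and "a \<noteq> 0"
  shows "(\<integral>\<^sup>+x. f (b + a * x) \<partial>lborel) = ennreal (1 / \<bar>a\<bar>) * (\<integral>\<^sup>+x. f x \<partial>lborel)"
proof -
  have "ennreal (1 / \<bar>a\<bar>) * (\<integral>\<^sup>+x. f x \<partial>lborel) = ennreal (1 / \<bar>a\<bar>) * (ennreal \<bar>a\<bar> * (\<integral>\<^sup>+x. f (b + a * x) \<partial>lborel))"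
    using nn_integral_real_affine[of f a b] assms by simp
  also have "\<dots> = (\<integral>\<^sup>+x. f (b + a * x) \<partial>lborel)"
    using assms by (simp add: mult.assoc[symmetric] ennreal_mult'[symmetric])
  finally show ?thesis by simp
qed

text \<open>\<kappa> is the factor by which \<open>h\<close> changes integrals of functions
  supported in \<open>H\<close>; it has to compensate the two scalings. For an inverse branch
  \<kappa> = 2 comes from prefixing a digit, against the scalings 1 / \<beta> and 2 \<beta>. For
  reflections \<kappa> = 1.\<close>

lemma emeasure_K_affine_vimage:
  fixes a1 a2 b1 b2 :: real
  assumes A[measurable]: "A \<in> sets K" and a: "a1 \<noteq> 0" "a2 \<noteq> 0"
    and h[measurable]: "h \<in> bernoulli_measure \<rightarrow>\<^sub>M bernoulli_measure"
    and hint: "\<And>f. f \<in> borel_measurable bernoulli_measure \<Longrightarrow> (\<And>\<eta>. \<eta> \<notin> H \<Longrightarrow> f \<eta> = 0) \<Longrightarrow>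
        (\<integral>\<^sup>+\<eta>. f (h \<eta>) \<partial>bernoulli_measure) = ennreal \<kappa> * (\<integral>\<^sup>+\<eta>. f \<eta> \<partial>bernoulli_measure)"
    and AH: "A \<subseteq> H \<times> UNIV" and \<kappa>: "0 \<le> \<kappa>" "\<kappa> = \<bar>a1\<bar> * \<bar>a2\<bar>"
  shows "(\<lambda>(\<eta>, x, y). (h \<eta>, b1 + a1 * x, b2 + a2 * y)) -` A \<in> sets K"
    and "emeasure K ((\<lambda>(\<eta>, x, y). (h \<eta>, b1 + a1 * x, b2 + a2 * y)) -` A) = emeasure K A"
proof -
  let ?g = "\<lambda>(\<eta>, x, y). (h \<eta>, b1 + a1 * x, b2 + a2 * y)"
  have g[measurable]: "?g \<in> K \<rightarrow>\<^sub>M K" by measurable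
  show gA[measurable]: "?g -` A \<in> sets K" using measurable_sets[OF g A] by simp
  define J where "J x y = (\<integral>\<^sup>+\<eta>. indicator A (\<eta>, x, y) \<partial>bernoulli_measure)" for x y
  have Jm[measurable]: "(\<lambda>(x, y). J x y) \<in> borel_measurable (borel \<Otimes>\<^sub>M borel)" unfolding J_def by measurable
  have "emeasure K (?g -` A) = (\<integral>\<^sup>+z. indicator A (?g z) \<partial>K)"
    by (subst nn_integral_indicator[OF gA, symmetric]) (auto intro!: nn_integral_cong simp: indicator_def)
  also have "\<dots> = (\<integral>\<^sup>+x. \<integral>\<^sup>+y. \<integral>\<^sup>+\<eta>. indicator A (h \<eta>, b1 + a1 * x, b2 + a2 * y) \<partial>bernoulli_measure \<partial>lborel \<partial>lborel)"
    by (subst nn_integral_K) auto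
  also have "\<dots> = (\<integral>\<^sup>+x. \<integral>\<^sup>+y. ennreal \<kappa> * J (b1 + a1 * x) (b2 + a2 * y) \<partial>lborel \<partial>lborel)"
    unfolding J_def by (intro nn_integral_cong hint) (use AH in \<open>auto simp: indicator_def\<close>)
  also have "\<dots> = (\<integral>\<^sup>+x. ennreal \<kappa> * (\<integral>\<^sup>+y. J (b1 + a1 * x) (b2 + a2 * y) \<partial>lborel) \<partial>lborel)"
    by (intro nn_integral_cong nn_integral_cmult) measurable
  also have "\<dots> = ennreal \<kappa> * (\<integral>\<^sup>+x. (\<integral>\<^sup>+y. J (b1 + a1 * x) (b2 + a2 * y) \<partial>lborel) \<partial>lborel)"
    by (intro nn_integral_cmult) measurable
  also have "(\<integral>\<^sup>+x. (\<integral>\<^sup>+y. J (b1 + a1 * x) (b2 + a2 * y) \<partial>lborel) \<partial>lborel) =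
      (\<integral>\<^sup>+x. ennreal (1 / \<bar>a2\<bar>) * (\<integral>\<^sup>+y. J (b1 + a1 * x) y \<partial>lborel) \<partial>lborel)"
    by (intro nn_integral_cong nn_integral_affine a) measurable
  also have "\<dots> = ennreal (1 / \<bar>a1\<bar>) * (\<integral>\<^sup>+x. ennreal (1 / \<bar>a2\<bar>) * (\<integral>\<^sup>+y. J x y \<partial>lborel) \<partial>lborel)"
    by (rule nn_integral_affine[of "\<lambda>x. ennreal (1 / \<bar>a2\<bar>) * (\<integral>\<^sup>+y. J x y \<partial>lborel)"]) (use a in measurable)
  also have "\<dots> = ennreal (1 / \<bar>a1\<bar>) * (ennreal (1 / \<bar>a2\<bar>) * (\<integral>\<^sup>+x. \<integral>\<^sup>+y. J x y \<partial>lborel \<partial>lborel))"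
    by (subst nn_integral_cmult) measurable
  also have "ennreal \<kappa> * \<dots> = (\<integral>\<^sup>+x. \<integral>\<^sup>+y. J x y \<partial>lborel \<partial>lborel)"
    using a by (simp add: \<kappa>(2) mult.assoc[symmetric] ennreal_mult'[symmetric])
  also have "\<dots> = emeasure K A"
    unfolding J_def nn_integral_indicator[OF A, symmetric] by (rule nn_integral_K[symmetric]) simp
  finally show "emeasure K (?g -` A) = emeasure K A" .
qed

lemma forward_preserving_branch:
  assumes "0 < b"
  shows "forward_preserving K (\<lambda>(\<eta>, x, y). (stl \<eta>, b * x - d, y / (2 * b) + C)) {z. shd (fst z) = i}"
  unfolding forward_preserving_def
proof (intro ballI impI)
  fix A assume A: "A \<in> sets K" "A \<subseteq> {z. shd (fst z) = i}"
  let ?a = "\<lambda>(\<eta>, x, y). (stl \<eta>, b * x - d, y / (2 * b) + C) :: bool stream \<times> real \<times> real"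
  let ?g = "\<lambda>(\<eta>, x, y). (i ## \<eta>, d / b + (1 / b) * x, - (2 * b * C) + (2 * b) * y) :: bool stream \<times> real \<times> real"
  have ag: "?a (?g z) = z" for z using assms by (cases z) (auto simp: field_simps)
  have ga: "?g (?a z) = z" if "z \<in> A" for z
  proof -
    have "shd (fst z) = i" using that A(2) by auto
    moreover have "shd (fst z) ## stl (fst z) = fst z" by (rule stream.collapse)
    ultimately have "i ## stl (fst z) = fst z" by (simp only:)
    then show ?thesis using assms by (cases z) (auto simp: field_simps)
  qed
  \<comment> \<open>The image under the branch is the preimage under its inverse \<open>?g\<close>,
    to which the affine preimage lemma applies.\<close>
  have im: "?a ` A = ?g -` A"
  proof (intro equalityI subsetI)
    fix z assume "z \<in> ?a ` A" then show "z \<in> ?g -` A" using ga by auto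
  next
    fix z assume "z \<in> ?g -` A" then show "z \<in> ?a ` A" using ag[of z] by (metis (no_types, lifting) image_eqI vimageD)
  qed
  have hint: "(\<integral>\<^sup>+\<eta>. f (i ## \<eta>) \<partial>bernoulli_measure) = ennreal 2 * (\<integral>\<^sup>+\<eta>. f \<eta> \<partial>bernoulli_measure)"
    if f: "f \<in> borel_measurable bernoulli_measure" "\<And>\<eta>. \<eta> \<notin> {\<eta>. shd \<eta> = i} \<Longrightarrow> f \<eta> = 0" for f
  proof -
    have "(\<integral>\<^sup>+\<eta>. f \<eta> \<partial>bernoulli_measure) = ennreal (1/2) * (\<integral>\<^sup>+\<eta>. f (i ## \<eta>) \<partial>bernoulli_measure)"
      using f(2) by (subst nn_integral_bernoulli[OF f(1)]) (cases i; simp)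
    then have "ennreal 2 * (\<integral>\<^sup>+\<eta>. f \<eta> \<partial>bernoulli_measure) = ennreal 2 * ennreal (1/2) * (\<integral>\<^sup>+\<eta>. f (i ## \<eta>) \<partial>bernoulli_measure)"
      by (simp only: mult.assoc)
    also have "ennreal 2 * ennreal (1/2) = 1" by (subst ennreal_mult'[symmetric]) auto
    finally show ?thesis by simp
  qed
  have *: "?g -` A \<in> sets K" "emeasure K (?g -` A) = emeasure K A"
    by (rule emeasure_K_affine_vimage[where H = "{\<eta>. shd \<eta> = i}" and \<kappa> = 2, OF A(1) _ _ _ hint];
        (use assms A(2) in \<open>auto simp: subset_iff\<close>))+
  show "?a ` A \<in> sets K \<and> emeasure K (?a ` A) = emeasure K A" unfolding im using * by blast
qed

context beta_expansion
begin

section \<open>Measure preservation by the mirror map and by \<open>Q\<close>\<close>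

lemma P_measurable[measurable]: "P \<beta> \<in> K \<rightarrow>\<^sub>M K"
  unfolding P_def by measurable

lemma emeasure_P_vimage:
  assumes A: "A \<in> sets K" shows "emeasure K (P \<beta> -` A) = emeasure K A"
proof -
  have eq: "P \<beta> = (\<lambda>(\<eta>, x, y). (smap Not \<eta>, c + (-1) * x, 0 + (-1) * y))" by (auto simp: P_eq)
  have "(\<integral>\<^sup>+\<eta>. f (smap Not \<eta>) \<partial>bernoulli_measure) = ennreal 1 * (\<integral>\<^sup>+\<eta>. f \<eta> \<partial>bernoulli_measure)"
    if [measurable]: "f \<in> borel_measurable bernoulli_measure" for f :: "bool stream \<Rightarrow> ennreal"
  proof -
    have "(\<integral>\<^sup>+\<eta>. f \<eta> \<partial>distr bernoulli_measure bernoulli_measure (smap Not)) = (\<integral>\<^sup>+\<eta>. f (smap Not \<eta>) \<partial>bernoulli_measure)"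
      by (rule nn_integral_distr) measurable
    then show ?thesis by (simp add: bernoulli_smap_Not)
  qed
  then show ?thesis unfolding eq
    by (intro emeasure_K_affine_vimage(2)[where H = UNIV and \<kappa> = 1, OF A]) auto
qed

lemma forward_preserving_P: "forward_preserving K (P \<beta>) H"
  by (rule forward_preserving_involution) (simp_all add: P_P emeasure_P_vimage)

lemma crossing_sets[measurable]: "crossing \<in> sets K"
proof -
  have "crossing = {z \<in> space K. \<exists>w\<in>{w. c / \<beta> < r \<beta> w}. 0 \<le> fst (snd z) \<and> fst (snd z) \<le> c - 1 \<and>
     v \<beta> (w @ [False]) \<le> snd (snd z) \<and> snd (snd z) < v \<beta> (w @ [False]) + height (w @ [False])}"
    by (auto simp: mem_crossing)
  also have "\<dots> \<in> sets K" by measurable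
  finally show ?thesis .
qed

lemma crossing_bar_sets[measurable]: "P \<beta> -` crossing \<in> sets K"
  using measurable_sets[OF P_measurable crossing_sets] by simp

lemma Q_measurable[measurable]: "Q \<beta> \<in> K \<rightarrow>\<^sub>M K"
proof -
  have "Q \<beta> = (\<lambda>z. if z \<in> crossing then (fst z, fst (snd z) + 1, - snd (snd z))
     else if z \<in> P \<beta> -` crossing then (fst z, fst (snd z) - 1, - snd (snd z)) else z)"
    by (auto simp: Q_eq)
  also have "\<dots> \<in> K \<rightarrow>\<^sub>M K" by measurable
  finally show ?thesis .
qed

text \<open>The two moves of \<open>Q\<close> are \<open>reflect 1\<close> on
  \<open>crossing\<close> and \<open>reflect (-1)\<close> on its mirror image.\<close>

definition reflect :: "real \<Rightarrow> bool stream \<times> real \<times> real \<Rightarrow> bool stream \<times> real \<times> real" where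
  "reflect d = (\<lambda>(\<eta>, x, y). (\<eta>, x + d, - y))"

lemma emeasure_reflect_vimage:
  assumes A: "A \<in> sets K"
  shows "reflect d -` A \<in> sets K" "emeasure K (reflect d -` A) = emeasure K A"
proof -
  have eq: "reflect d = (\<lambda>(\<eta>, x, y). (\<eta>, d + 1 * x, 0 + (-1) * y))" by (auto simp: reflect_def)
  show "reflect d -` A \<in> sets K" "emeasure K (reflect d -` A) = emeasure K A"
    unfolding eq by (rule emeasure_K_affine_vimage[where H = UNIV and \<kappa> = 1, OF A]; simp)+
qed

lemma crossing_reflect: "reflect 1 z \<in> P \<beta> -` crossing \<longleftrightarrow> z \<in> crossing" "reflect (-1) z \<in> crossing \<longleftrightarrow> z \<in> P \<beta> -` crossing"
proof -
  have *: "(\<eta>, x, y) \<in> crossing \<longleftrightarrow> P \<beta> (\<eta>, x + 1, - y) \<in> crossing" for \<eta> x y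
    using crossing_mirror[of "smap Not \<eta>" x y] crossing_cong[of \<eta> x y "smap Not \<eta>"] by (simp add: P_eq algebra_simps)
  obtain \<eta> x y where z: "z = (\<eta>, x, y)" by (cases z)
  show "reflect 1 z \<in> P \<beta> -` crossing \<longleftrightarrow> z \<in> crossing" using *[of \<eta> x y] by (simp add: z reflect_def)
  show "reflect (-1) z \<in> crossing \<longleftrightarrow> z \<in> P \<beta> -` crossing" using *[of \<eta> "x - 1" "- y"] by (simp add: z reflect_def)
qed

lemma crossing_disjoint: "z \<in> crossing \<Longrightarrow> P \<beta> z \<notin> crossing"
proof -
  obtain \<eta> x y where z: "z = (\<eta>, x, y)" by (cases z)
  assume "z \<in> crossing"
  then show ?thesis using crossing_ge_1[of \<eta> x y] crossing_ge_1[of "smap Not \<eta>" "c - x" "- y"] by (auto simp: z P_eq)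
qed

text \<open>\<open>Q\<close> exchanges \<open>crossing\<close> with its mirror image by rigid
  motions and fixes everything else, so the measure can be compared on three disjoint parts.\<close>

lemma emeasure_Q_vimage:
  assumes A[measurable]: "A \<in> sets K" shows "emeasure K (Q \<beta> -` A) = emeasure K A"
proof -
  let ?D = crossing and ?D' = "P \<beta> -` crossing"
  let ?A1 = "reflect 1 -` (A \<inter> ?D')" and ?A2 = "reflect (-1) -` (A \<inter> ?D)" and ?A3 = "A - ?D - ?D'"
  have split: "emeasure K (B \<union> (C \<union> D)) = emeasure K B + (emeasure K C + emeasure K D)"
    if "B \<in> sets K" "C \<in> sets K" "D \<in> sets K" "B \<inter> (C \<union> D) = {}" "C \<inter> D = {}" for B C D
    using plus_emeasure[of B K "C \<union> D"] plus_emeasure[of C K D] that by auto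
  have mem: "z \<in> ?A1 \<longleftrightarrow> z \<in> ?D \<and> reflect 1 z \<in> A" "z \<in> ?A2 \<longleftrightarrow> z \<in> ?D' \<and> reflect (-1) z \<in> A" for z
    using crossing_reflect by auto
  have eq: "Q \<beta> -` A = ?A1 \<union> (?A2 \<union> ?A3)"
  proof (intro set_eqI)
    fix z :: "bool stream \<times> real \<times> real"
    have "Q \<beta> z = (if z \<in> ?D then reflect 1 z else if z \<in> ?D' then reflect (-1) z else z)"
      by (cases z) (simp add: Q_eq reflect_def)
    then show "z \<in> Q \<beta> -` A \<longleftrightarrow> z \<in> ?A1 \<union> (?A2 \<union> ?A3)"
      using mem[of z] crossing_disjoint[of z] by (auto split: if_splits)
  qed
  have D: "A \<inter> ?D' \<in> sets K" "A \<inter> ?D \<in> sets K" "?A3 \<in> sets K"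
    using A crossing_sets crossing_bar_sets by blast+
  note s = emeasure_reflect_vimage(1)[OF D(1), of 1] emeasure_reflect_vimage(1)[OF D(2), of "-1"] D(3)
  have "emeasure K (Q \<beta> -` A) = emeasure K ?A1 + (emeasure K ?A2 + emeasure K ?A3)"
    unfolding eq by (rule split[OF s]) (use mem crossing_disjoint in blast)+
  also have "\<dots> = emeasure K (A \<inter> ?D') + (emeasure K (A \<inter> ?D) + emeasure K ?A3)"
    by (simp only: emeasure_reflect_vimage(2)[OF D(1)] emeasure_reflect_vimage(2)[OF D(2)])
  also have "\<dots> = emeasure K ((A \<inter> ?D') \<union> ((A \<inter> ?D) \<union> ?A3))"
    by (rule split[OF D, symmetric]) (use crossing_disjoint in blast)+
  also have "(A \<inter> ?D') \<union> ((A \<inter> ?D) \<union> ?A3) = A" by blast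
  finally show ?thesis .
qed

lemma forward_preserving_Q: "forward_preserving K (Q \<beta>) H"
  by (rule forward_preserving_involution) (simp_all add: Q_Q emeasure_Q_vimage)

text \<open>The bottom edges of the pieces are left out, so that the two towers become disjoint.\<close>

definition cell :: "bool list \<Rightarrow> (bool stream \<times> real \<times> real) set" where
  "cell w = UNIV \<times> {0..r \<beta> w} \<times> {v \<beta> w <..< v \<beta> w + height w}"

lemma mem_cell: "(\<eta>, x, y) \<in> cell w \<longleftrightarrow> x \<in> {0..r \<beta> w} \<and> v \<beta> w < y \<and> y < v \<beta> w + height w"
  by (auto simp: cell_def)

lemma cell_piece: "cell w \<subseteq> piece \<beta> w"
  by (auto simp: mem_cell mem_piece)

lemma piece_sets[measurable]: "piece \<beta> w \<in> sets K" and cell_sets[measurable]: "cell w \<in> sets K"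
proof -
  have "piece \<beta> w = {z \<in> space K. 0 \<le> fst (snd z) \<and> fst (snd z) \<le> r \<beta> w \<and> v \<beta> w \<le> snd (snd z) \<and> snd (snd z) < v \<beta> w + height w}"
    by (auto simp: mem_piece)
  also have "\<dots> \<in> sets K" by measurable
  finally show "piece \<beta> w \<in> sets K" .
  have "cell w = {z \<in> space K. 0 \<le> fst (snd z) \<and> fst (snd z) \<le> r \<beta> w \<and> v \<beta> w < snd (snd z) \<and> snd (snd z) < v \<beta> w + height w}"
    by (auto simp: mem_cell)
  also have "\<dots> \<in> sets K" by measurable
  finally show "cell w \<in> sets K" .
qed

section \<open>Oriented cells, states and injectivity\<close>

definition flip :: "bool \<Rightarrow> bool stream \<times> real \<times> real \<Rightarrow> bool stream \<times> real \<times> real" where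
  "flip b z = (if b then P \<beta> z else z)"

definition ocell :: "bool \<times> bool list \<Rightarrow> (bool stream \<times> real \<times> real) set" where
  "ocell \<sigma> = flip (fst \<sigma>) -` cell (snd \<sigma>)"

definition G :: "(bool stream \<times> real \<times> real) set" where
  "G = (\<Union>\<sigma>. ocell \<sigma>)"

lemma flip_flip: "flip b (flip b z) = z" by (simp add: flip_def P_P)

lemma mem_ocell: "z \<in> ocell (b, w) \<longleftrightarrow> flip b z \<in> cell w" by (simp add: ocell_def)

lemma flip_measurable[measurable]: "flip b \<in> K \<rightarrow>\<^sub>M K" unfolding flip_def by measurable

lemma ocell_sets[measurable]: "ocell \<sigma> \<in> sets K"
  using measurable_sets[OF flip_measurable cell_sets] by (simp add: ocell_def)

lemma G_sets[measurable]: "G \<in> sets K" unfolding G_def by measurable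

lemma ocell_height: "(\<eta>, x, y) \<in> ocell (b, w) \<Longrightarrow> (if b then y < 0 else 0 < y)"
  using v_nonneg[of w] by (auto simp: mem_ocell flip_def P_eq mem_cell split: if_splits)

lemma ocell_unique: "z \<in> ocell \<sigma> \<Longrightarrow> z \<in> ocell \<tau> \<Longrightarrow> \<sigma> = \<tau>"
proof -
  assume a: "z \<in> ocell \<sigma>" "z \<in> ocell \<tau>"
  obtain \<eta> x y where z: "z = (\<eta>, x, y)" by (cases z)
  obtain b w b' w' where s: "\<sigma> = (b, w)" "\<tau> = (b', w')" by (cases \<sigma>, cases \<tau>)
  have b: "b = b'" using ocell_height[of \<eta> x y b w] ocell_height[of \<eta> x y b' w'] a unfolding z s by (cases b; cases b') auto
  have "w = w'" using a unfolding z s b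
    by (cases b') (auto simp: mem_ocell flip_def P_eq mem_cell intro: v_unique[OF less_imp_le _ less_imp_le])
  then show ?thesis using b s by simp
qed

lemma cell_unique: "z \<in> cell w \<Longrightarrow> z \<in> cell w' \<Longrightarrow> w = w'"
  using ocell_unique[of z "(False, w)" "(False, w')"] by (simp add: mem_ocell flip_def)

definition st :: "bool stream \<times> real \<times> real \<Rightarrow> bool \<times> bool list" where
  "st z = (THE \<sigma>. z \<in> ocell \<sigma>)"

lemma st_ocell: "z \<in> ocell \<sigma> \<Longrightarrow> st z = \<sigma>"
  unfolding st_def using ocell_unique by blast

lemma ocell_st: "z \<in> G \<Longrightarrow> z \<in> ocell (st z)"
  unfolding G_def using st_ocell by (metis UN_E)

text \<open>An interior point of a cell has positive height, so its mirror point is outside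
  \<open>E \<beta>\<close> and is moved by the mirrored branch of \<open>psi\<close>. With
  \<open>flip b\<close> both towers are treated at once.\<close>

lemma S_flip:
  assumes "z \<in> cell w" shows "S (flip b z) = Q \<beta> (flip b (psi_E \<beta> z))"
proof -
  obtain \<eta> x y where z: "z = (\<eta>, x, y)" by (cases z)
  have E: "z \<in> E \<beta>" using assms cell_piece by (auto simp: E_def)
  have "0 < y" using assms v_nonneg[of w] by (auto simp: z mem_cell)
  then have "P \<beta> z \<notin> E \<beta>" unfolding z P_eq mem_E mem_piece using v_nonneg by (smt (verit))
  then show ?thesis using E by (simp add: flip_def psi_tilde_def psi_def psi_E_bar_def P_P)
qed

lemma psi_E_pos: "(\<eta>, x, y) \<in> cell w \<Longrightarrow> 0 < snd (snd (psi_E \<beta> (\<eta>, x, y)))"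
proof -
  assume c: "(\<eta>, x, y) \<in> cell w"
  then have "0 < (y - v \<beta> w) / (2 * \<beta>)" using beta0 by (auto simp: mem_cell)
  then show ?thesis using psi_E_piece[OF subsetD[OF cell_piece c]] v_nonneg strip_nonneg by (auto simp: add_nonneg_pos)
qed

text \<open>The height of the image decides everything: below 1 the point has returned and its strip
  reveals word and digit; from 1 on it has climbed and its interval reveals \<open>w @ [i]\<close>.
  Once word and digit are known, one injective affine branch remains.\<close>

lemma inj_psi_E: "inj_on (psi_E \<beta>) (\<Union>w. cell w)"
proof (rule inj_onI)
  fix z z' assume "z \<in> (\<Union>w. cell w)" "z' \<in> (\<Union>w. cell w)" and eq: "psi_E \<beta> z = psi_E \<beta> z'"
  then obtain w w' \<eta> x y \<eta>' x' y' where z: "z = (\<eta>, x, y)" "z' = (\<eta>', x', y')"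
    and c: "(\<eta>, x, y) \<in> cell w" "(\<eta>', x', y') \<in> cell w'" by (metis UN_E prod_cases3)
  note p = subsetD[OF cell_piece c(1)] subsetD[OF cell_piece c(2)]
  define t t' where "t = (y - v \<beta> w) / (2 * \<beta>)" and "t' = (y' - v \<beta> w') / (2 * \<beta>)"
  have t: "0 \<le> t" "t < height (w @ [i])" "0 \<le> t'" "t' < height (w' @ [i])" for i
    using c beta0 by (auto simp: t_def t'_def mem_cell height_snoc divide_strict_right_mono)
  let ?i = "shd \<eta>" and ?i' = "shd \<eta>'"
  let ?b = "act1 ?i (r \<beta> w) \<and> x < 1 / \<beta>" and ?b' = "act1 ?i' (r \<beta> w') \<and> x' < 1 / \<beta>"
  have low: "strip w ?i + t < 1" if ?b using strip_le_1[of w ?i] t(2)[of ?i] that by (simp add: returns_def)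
  have low': "strip w' ?i' + t' < 1" if ?b' using strip_le_1[of w' ?i'] t(4)[of ?i'] that by (simp add: returns_def)
  have high: "1 \<le> v \<beta> (w @ [i]) + t" "1 \<le> v \<beta> (w' @ [i]) + t'" for i
    using v_ge_1[of "w @ [i]"] v_ge_1[of "w' @ [i]"] t by (auto simp: add_increasing2)
  note e = eq[unfolded z psi_E_piece[OF p(1)] psi_E_piece[OF p(2)] t_def[symmetric] t'_def[symmetric]]
  have bb: "?b \<longleftrightarrow> ?b'" using e low low' high[of ?i] high[of ?i'] by (auto split: if_splits)
  have wi: "w = w' \<and> ?i = ?i' \<and> t = t'"
  proof (cases ?b)
    case True
    then have e': "strip w ?i + t = strip w' ?i' + t'" using e bb by simp
    have "w = w' \<and> ?i = ?i'"
      by (rule strip_unique[of w ?i w' ?i' "strip w ?i + t"])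
        (use True bb t(1,3) t(2)[of ?i] t(4)[of ?i'] e' in \<open>auto simp: returns_def\<close>)
    then show ?thesis using e' by simp
  next
    case False
    then have e': "v \<beta> (w @ [?i]) + t = v \<beta> (w' @ [?i']) + t'" using e bb by (auto split: if_splits)
    have "w @ [?i] = w' @ [?i']"
      by (rule v_unique[of _ "v \<beta> (w @ [?i]) + t"]) (use t(1,3) t(2)[of ?i] t(4)[of ?i'] e' in auto)
    then show ?thesis using e' by simp
  qed
  have "stl \<eta> = stl \<eta>'" using e by (auto split: if_splits)
  then have "\<eta> = \<eta>'" using wi by (intro stream.expand) simp
  moreover have "x = x'" using e wi bb beta0 by (auto split: if_splits)
  moreover have "y = y'" using wi beta0 by (auto simp: t_def t'_def)
  ultimately show "z = z'" by (simp add: z)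
qed

text \<open>\<open>Q\<close> cancels, being an involution, and the sign of the height before
  \<open>Q\<close> tells which tower the point came from.\<close>

lemma inj_S: "inj_on S G"
proof (rule inj_onI)
  fix z z' assume "z \<in> G" "z' \<in> G" and eq: "S z = S z'"
  then obtain b w b' w' where zz: "flip b z \<in> cell w" "flip b' z' \<in> cell w'"
    unfolding G_def by (auto simp: ocell_def)
  define u u' where "u = flip b z" and "u' = flip b' z'"
  have z: "z = flip b u" "z' = flip b' u'" by (simp_all add: u_def u'_def flip_flip)
  have u: "u \<in> cell w" "u' \<in> cell w'" using zz by (simp_all add: u_def u'_def)
  have "flip b (psi_E \<beta> u) = flip b' (psi_E \<beta> u')"
    using eq unfolding z S_flip[OF u(1)] S_flip[OF u(2)] by (metis Q_Q)
  moreover obtain \<eta> x y \<eta>' x' y' where uu: "u = (\<eta>, x, y)" "u' = (\<eta>', x', y')" by (cases u, cases u')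
  moreover obtain e1 e2 e3 f1 f2 f3 where ef: "psi_E \<beta> u = (e1, e2, e3)" "psi_E \<beta> u' = (f1, f2, f3)"
    by (cases "psi_E \<beta> u", cases "psi_E \<beta> u'")
  moreover have "0 < e3" "0 < f3" using psi_E_pos[of \<eta> x y w] psi_E_pos[of \<eta>' x' y' w'] u uu ef by auto
  ultimately have "b = b'" by (cases b; cases b') (auto simp: flip_def P_eq)
  then have "flip b (flip b (psi_E \<beta> u)) = flip b (flip b (psi_E \<beta> u'))"
    using \<open>flip b (psi_E \<beta> u) = flip b' (psi_E \<beta> u')\<close> by simp
  then have "psi_E \<beta> u = psi_E \<beta> u'" by (simp only: flip_flip)
  then have "u = u'" using inj_onD[OF inj_psi_E] u by blast
  then show "z = z'" using \<open>b = b'\<close> by (simp add: z)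
qed

text \<open>Word, first digit and side of 1 / \<beta> single out countably many parts, on each of
  which \<open>psi_E\<close> is one affine branch.\<close>

lemma forward_preserving_psi_E: "forward_preserving K (psi_E \<beta>) (\<Union>w. cell w)"
proof (rule forward_preserving_UN[where I = "UNIV :: (bool list \<times> bool \<times> bool) set"
      and A = "\<lambda>(w, i, k). {z \<in> cell w. shd (fst z) = i \<and> (fst (snd z) < 1 / \<beta> \<longleftrightarrow> k)}"])
  show "disjoint_family_on (\<lambda>(w, i, k). {z \<in> cell w. shd (fst z) = i \<and> (fst (snd z) < 1 / \<beta> \<longleftrightarrow> k)}) UNIV"
    unfolding disjoint_family_on_def using cell_unique by fastforce
  show "(\<Union>w. cell w) \<subseteq> (\<Union>(w, i, k)\<in>UNIV. {z \<in> cell w. shd (fst z) = i \<and> (fst (snd z) < 1 / \<beta> \<longleftrightarrow> k)})" by auto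
  show "inj_on (psi_E \<beta>) (\<Union>w. cell w)" by (rule inj_psi_E)
  fix j :: "bool list \<times> bool \<times> bool"
  obtain w i k where j: "j = (w, i, k)" by (cases j)
  let ?A = "{z \<in> cell w. shd (fst z) = i \<and> (fst (snd z) < 1 / \<beta> \<longleftrightarrow> k)}"
  have "?A = {z \<in> space K. z \<in> cell w \<and> shd (fst z) = i \<and> (fst (snd z) < 1 / \<beta> \<longleftrightarrow> k)}" by simp
  also have "\<dots> \<in> sets K" by measurable
  finally show "(case j of (w, i, k) \<Rightarrow> {z \<in> cell w. shd (fst z) = i \<and> (fst (snd z) < 1 / \<beta> \<longleftrightarrow> k)}) \<in> sets K"
    by (simp add: j)
  define d where "d = (if act1 i (r \<beta> w) \<and> \<not> k then 1 else 0 :: real)"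
  define C where "C = (if act1 i (r \<beta> w) \<and> k then strip w i else v \<beta> (w @ [i])) - v \<beta> w / (2 * \<beta>)"
  have "forward_preserving K (psi_E \<beta>) ?A"
  proof (rule forward_preserving_cong)
    show "forward_preserving K (\<lambda>(\<eta>, x, y). (stl \<eta>, \<beta> * x - d, y / (2 * \<beta>) + C)) ?A"
      by (rule forward_preserving_subset[OF forward_preserving_branch[OF beta0, of d C i]]) auto
    fix z assume z: "z \<in> ?A"
    obtain \<eta> x y where zz: "z = (\<eta>, x, y)" by (cases z)
    have p: "(\<eta>, x, y) \<in> piece \<beta> w" using z cell_piece zz by auto
    show "(case z of (\<eta>, x, y) \<Rightarrow> (stl \<eta>, \<beta> * x - d, y / (2 * \<beta>) + C)) = psi_E \<beta> z"
      unfolding zz prod.case psi_E_piece[OF p] using z by (auto simp: zz d_def C_def diff_divide_distrib)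
  qed
  then show "forward_preserving K (psi_E \<beta>) (case j of (w, i, k) \<Rightarrow> {z \<in> cell w. shd (fst z) = i \<and> (fst (snd z) < 1 / \<beta> \<longleftrightarrow> k)})"
    by (simp add: j)
qed simp

lemma forward_preserving_S: "forward_preserving K S G"
proof (rule forward_preserving_UN[where I = UNIV and A = "\<lambda>b. flip b -` (\<Union>w. cell w)", OF _ _ _ _ inj_S])
  show "flip b -` (\<Union>w. cell w) \<in> sets K" for b
  proof -
    have "(\<Union>w. cell w) \<in> sets K" by (intro sets.countable_UN) (use cell_sets in blast)
    then show ?thesis using measurable_sets[OF flip_measurable, of "\<Union>w. cell w" b] by simp
  qed
  show "disjoint_family_on (\<lambda>b. flip b -` (\<Union>w. cell w)) UNIV"
    unfolding disjoint_family_on_def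
  proof (intro ballI impI)
    fix b b' :: bool assume "b \<noteq> b'"
    then show "flip b -` (\<Union>w. cell w) \<inter> flip b' -` (\<Union>w. cell w) = {}"
    proof (intro equalityI subsetI)
      fix z assume "z \<in> flip b -` (\<Union>w. cell w) \<inter> flip b' -` (\<Union>w. cell w)"
      then obtain w w' where "z \<in> ocell (b, w)" "z \<in> ocell (b', w')" by (auto simp: mem_ocell)
      then show "z \<in> {}" using ocell_unique \<open>b \<noteq> b'\<close> by blast
    qed simp
  qed
  show "G \<subseteq> (\<Union>b\<in>UNIV. flip b -` (\<Union>w. cell w))" by (auto simp: G_def ocell_def)
  fix b
  have fl: "forward_preserving K (flip b) H" for H
  proof (cases b)
    case True
    then have "flip b = P \<beta>" by (auto simp: flip_def)
    then show ?thesis using forward_preserving_P by simp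
  next
    case False
    then have "flip b = (\<lambda>z. z)" by (auto simp: flip_def)
    then show ?thesis by (simp add: forward_preserving_def)
  qed
  have "forward_preserving K (\<lambda>z. Q \<beta> (flip b (psi_E \<beta> (flip b z)))) (flip b -` (\<Union>w. cell w))"
    by (rule forward_preserving_comp[OF forward_preserving_comp[OF forward_preserving_comp[OF fl _ forward_preserving_psi_E] _ fl] _ forward_preserving_Q])
      (auto simp: image_subset_iff)
  then show "forward_preserving K S (flip b -` (\<Union>w. cell w))"
    by (rule forward_preserving_cong) (use S_flip[of "flip b _" _ b] in \<open>auto simp: flip_flip\<close>)
qed simp


section \<open>The state dynamics\<close>

text \<open>A return to the base resets the word. The bit is set exactly where \<open>Q\<close>
  takes the image to the other tower.\<close>

definition stepE :: "bool list \<Rightarrow> real \<Rightarrow> bool \<Rightarrow> bool \<times> bool list" where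
  "stepE w x i = (if \<not> act1 i (r \<beta> w) then (False, w @ [i]) else if x < 1 / \<beta> then (False, [])
     else (\<not> i \<and> x \<le> c / \<beta>, w @ [i]))"

text \<open>
  A point has the state \<open>(b, w)\<close> if it lies in the piece of \<open>w\<close> (\<open>b = False\<close>) or in its mirror image
  (\<open>b = True\<close>). In the second case it is folded back by \<open>P\<close>, which replaces \<open>x\<close> by \<open>c - x\<close> and
  negates the digit.
\<close>

definition step :: "bool \<times> bool list \<Rightarrow> real \<Rightarrow> bool \<Rightarrow> bool \<times> bool list" where
  "step \<sigma> x i = apfst ((\<noteq>) (fst \<sigma>)) (stepE (snd \<sigma>) (if fst \<sigma> then c - x else x) (i \<noteq> fst \<sigma>))"

text \<open>The height at which the bottom edge of the piece arrives, before \<open>Q\<close> may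
  change its sign.\<close>

definition bottom :: "bool list \<Rightarrow> real \<Rightarrow> bool \<Rightarrow> real" where
  "bottom w x i = (if act1 i (r \<beta> w) \<and> x < 1 / \<beta> then strip w i else v \<beta> (w @ [i]))"

definition mirror :: "bool \<Rightarrow> real \<Rightarrow> real" where
  "mirror b x = (if b then c - x else x)"

lemma flip_eq: "flip b (\<eta>, x, y) = (if b then smap Not \<eta> else \<eta>, mirror b x, if b then - y else y)"
  by (simp add: flip_def P_eq mirror_def)

lemma S_piece:
  assumes p: "(\<eta>, x, y) \<in> piece \<beta> w"
  defines "i \<equiv> shd \<eta>" and "t \<equiv> (y - v \<beta> w) / (2 * \<beta>)" and "b' \<equiv> fst (stepE w x (shd \<eta>))" and "w' \<equiv> snd (stepE w x (shd \<eta>))"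
  shows "S (\<eta>, x, y) = flip b' (if b' then smap Not (stl \<eta>) else stl \<eta>, mirror b' (R_fibre \<beta> i x), bottom w x i + t)"
    and "mirror b' (R_fibre \<beta> i x) \<in> {0..r \<beta> w'}" and "v \<beta> w' \<le> bottom w x i" and "bottom w x i + t < v \<beta> w' + height w'"
proof -
  have x: "0 \<le> x" "x \<le> r \<beta> w" and y: "0 \<le> y - v \<beta> w" "y - v \<beta> w < height w" using p by (auto simp: mem_piece)
  have xc: "x \<in> {0..c}" using x r_I[of w] by auto
  have t: "0 \<le> t" "t < height (w @ [j])" for j using y beta0 by (auto simp: t_def height_snoc divide_strict_right_mono)
  have bx: "\<beta> * x \<le> \<beta> * r \<beta> w" using x(2) beta0 by simp
  note R = R_fibre_act1[OF xc, of i]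
  have xi: "x < 1 / \<beta> \<longleftrightarrow> \<beta> * x < 1" "x \<le> c / \<beta> \<longleftrightarrow> \<beta> * x \<le> c" "c / \<beta> < r \<beta> w \<longleftrightarrow> c < \<beta> * r \<beta> w" "1 / \<beta> \<le> x \<longleftrightarrow> 1 \<le> \<beta> * x"
    using beta0 by (auto simp: field_simps)
  have bx0: "0 \<le> \<beta> * x" using x beta0 by simp
  consider (a) "\<not> act1 i (r \<beta> w)" | (b) "act1 i (r \<beta> w)" "x < 1 / \<beta>" | (cr) "act1 i (r \<beta> w)" "\<not> x < 1 / \<beta>" "\<not> i" "x \<le> c / \<beta>"
    | (d) "act1 i (r \<beta> w)" "\<not> x < 1 / \<beta>" "i \<or> c / \<beta> < x" by fastforce
  then have "S (\<eta>, x, y) = flip b' (if b' then smap Not (stl \<eta>) else stl \<eta>, mirror b' (R_fibre \<beta> i x), bottom w x i + t) \<and>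
    mirror b' (R_fibre \<beta> i x) \<in> {0..r \<beta> w'} \<and> v \<beta> w' \<le> bottom w x i \<and> bottom w x i + t < v \<beta> w' + height w'"
  proof cases
    case a
    have s: "b' = False" "w' = w @ [i]" using a by (auto simp: b'_def w'_def stepE_def i_def)
    \<comment> \<open>The point does not exceed the end of the piece and \<open>act1\<close> is
      monotone.\<close>
    have "\<not> act1 i x" using a x(2) by (auto simp: act1_def)
    then show ?thesis using a R bx bx0 t(2)[of i]
      by (simp add: s flip_eq mirror_def psi_tilde_E[OF p] bottom_def r_snoc_act1 flip: i_def t_def)
  next
    case b
    have s: "b' = False" "w' = []" using b by (auto simp: b'_def w'_def stepE_def i_def)
    have "\<not> act1 i x" using b(2) by (auto simp: act1_def)
    moreover have "strip w i + t < 1" using strip_le_1[of w i] t(2)[of i] b(1) by (simp add: returns_def)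
    ultimately show ?thesis using b R bx0 xi strip_nonneg[of w i]
      by (simp add: s flip_eq mirror_def psi_tilde_E[OF p] bottom_def r_Nil v_Nil height_Nil flip: i_def t_def)
  next
    case cr
    have s: "b' = True" "w' = w @ [i]" using cr by (auto simp: b'_def w'_def stepE_def i_def)
    have na: "\<not> act1 i x" using cr by (auto simp: act1_def)
    \<comment> \<open>The mirrored image fits: \<beta> x is at least 1, so c - \<beta> x is at most
      c - 1, which is below \<beta> r - 1, the end of the new piece.\<close>
    have "c / \<beta> < r \<beta> w" using cr by (auto simp: act1_def)
    then show ?thesis using cr R na xi t(2)[of i]
      by (simp add: s flip_eq mirror_def psi_tilde_E[OF p] bottom_def r_snoc_act1 flip: i_def t_def)
  next
    case d
    have s: "b' = False" "w' = w @ [i]" using d by (auto simp: b'_def w'_def stepE_def i_def)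
    have na: "act1 i x" using d by (auto simp: act1_def)
    have "\<not> (\<not> i \<and> x \<le> c / \<beta>)" using d by auto
    then show ?thesis using d R na xi t(2)[of i] bx
      by (simp add: s flip_eq mirror_def psi_tilde_E[OF p] bottom_def r_snoc_act1 flip: i_def t_def)
  qed
  then show "S (\<eta>, x, y) = flip b' (if b' then smap Not (stl \<eta>) else stl \<eta>, mirror b' (R_fibre \<beta> i x), bottom w x i + t)"
    and "mirror b' (R_fibre \<beta> i x) \<in> {0..r \<beta> w'}" and "v \<beta> w' \<le> bottom w x i" and "bottom w x i + t < v \<beta> w' + height w'"
    by blast+
qed

lemma fst_S_piece: "(\<eta>, x, y) \<in> piece \<beta> w \<Longrightarrow> fst (S (\<eta>, x, y)) = stl \<eta>"
  and snd_S_piece: "(\<eta>, x, y) \<in> piece \<beta> w \<Longrightarrow> fst (snd (S (\<eta>, x, y))) = R_fibre \<beta> (shd \<eta>) x"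
  by (simp_all add: S_piece(1) flip_eq mirror_def)

lemma S_cell_ocell:
  assumes "(\<eta>, x, y) \<in> cell w" shows "S (\<eta>, x, y) \<in> ocell (stepE w x (shd \<eta>))"
proof -
  have p: "(\<eta>, x, y) \<in> piece \<beta> w" using assms cell_piece by auto
  have "0 < (y - v \<beta> w) / (2 * \<beta>)" using assms beta0 by (auto simp: mem_cell)
  then show ?thesis using S_piece(2-4)[OF p] S_piece(1)[OF p]
    by (simp add: ocell_def flip_flip mem_cell)
qed

lemma S_piece_space:
  assumes "z \<in> piece \<beta> w" shows "S z \<in> E \<beta> \<union> E_bar \<beta>"
proof -
  obtain \<eta> x y where z: "z = (\<eta>, x, y)" by (cases z)
  have p: "(\<eta>, x, y) \<in> piece \<beta> w" using assms z by simp
  have t: "0 \<le> (y - v \<beta> w) / (2 * \<beta>)" using p beta0 by (auto simp: mem_piece)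
  let ?b' = "fst (stepE w x (shd \<eta>))" and ?w' = "snd (stepE w x (shd \<eta>))"
  have "flip ?b' (S z) \<in> piece \<beta> ?w'"
    using S_piece(2-4)[OF p] S_piece(1)[OF p] t by (simp add: flip_flip mem_piece z)
  then have "flip ?b' (S z) \<in> E \<beta>" by (auto simp: E_def)
  then show ?thesis by (auto simp: flip_def E_bar_def mem_P_image split: if_splits)
qed

lemma S_E: "z \<in> E \<beta> \<Longrightarrow> S z \<in> E \<beta> \<union> E_bar \<beta>"
  unfolding E_def[of \<beta>] using S_piece_space[unfolded E_def] by blast

lemma S_bar: "z \<in> E_bar \<beta> \<Longrightarrow> z \<notin> E \<beta> \<Longrightarrow> S z = P \<beta> (S (P \<beta> z))"
  using psi_tilde_P[of "P \<beta> z"] by (simp add: E_bar_def mem_P_image P_P)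

lemma S_space:
  assumes "z \<in> E \<beta> \<union> E_bar \<beta>" shows "S z \<in> E \<beta> \<union> E_bar \<beta>"
proof (cases "z \<in> E \<beta>")
  case False
  then have "S z = P \<beta> (S (P \<beta> z))" using S_bar assms by blast
  moreover have "P \<beta> z \<in> E \<beta>" using assms False by (simp add: E_bar_def mem_P_image)
  ultimately show ?thesis using S_E[of "P \<beta> z"] by (auto simp: E_bar_def mem_P_image P_P)
qed (rule S_E)

text \<open>Reflection exchanges the left and the right region, half-open on opposite sides, and
  keeps the closed switch region. Since \<beta> c = c + 1, it conjugates \<open>T0\<close> to
  \<open>T1\<close>.\<close>

lemma R_fibre_mirror: "x \<in> {0..c} \<Longrightarrow> R_fibre \<beta> (i \<noteq> b) (mirror b x) = mirror b (R_fibre \<beta> i x)"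
proof (cases b)
  case True
  assume x: "x \<in> {0..c}"
  then have x': "c - x \<in> {0..c}" by auto
  have "act1 (\<not> i) (c - x) \<longleftrightarrow> \<not> act1 i x" using c_div' c_div_less by (auto simp: act1_def)
  then show ?thesis using True beta_c
    by (simp add: mirror_def R_fibre_act1[OF x] R_fibre_act1[OF x'] algebra_simps)
qed (simp add: mirror_def)

lemma ocell_x: "(\<eta>, x, y) \<in> ocell \<sigma> \<Longrightarrow> mirror (fst \<sigma>) x \<in> {0..r \<beta> (snd \<sigma>)}"
  by (simp add: ocell_def flip_eq mem_cell)

lemma ocell_I: "(\<eta>, x, y) \<in> ocell \<sigma> \<Longrightarrow> x \<in> {0..c}"
  using ocell_x[of \<eta> x y \<sigma>] r_I[of "snd \<sigma>"] by (auto simp: mirror_def split: if_splits)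

lemma S_ocell:
  assumes z: "(\<eta>, x, y) \<in> ocell \<sigma>"
  shows "S (\<eta>, x, y) \<in> ocell (step \<sigma> x (shd \<eta>))" "fst (S (\<eta>, x, y)) = stl \<eta>"
    "fst (snd (S (\<eta>, x, y))) = R_fibre \<beta> (shd \<eta>) x"
proof -
  obtain b w where \<sigma>: "\<sigma> = (b, w)" by (cases \<sigma>)
  have "S (\<eta>, x, y) \<in> ocell (step \<sigma> x (shd \<eta>)) \<and> fst (S (\<eta>, x, y)) = stl \<eta> \<and>
    fst (snd (S (\<eta>, x, y))) = R_fibre \<beta> (shd \<eta>) x"
  proof (cases b)
    case False
    then have cz: "(\<eta>, x, y) \<in> cell w" using z by (simp add: \<sigma> mem_ocell flip_def)
    then have p: "(\<eta>, x, y) \<in> piece \<beta> w" using cell_piece by auto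
    have "step \<sigma> x (shd \<eta>) = stepE w x (shd \<eta>)" using False by (simp add: step_def \<sigma>) (metis prod.collapse apfst_conv eq_id_iff)
    then show ?thesis using S_cell_ocell[OF cz] fst_S_piece[OF p] snd_S_piece[OF p] by simp
  next
    case True
    define u where "u = (smap Not \<eta>, c - x, - y)"
    have u: "P \<beta> u = (\<eta>, x, y)" by (simp add: u_def P_eq)
    have uc: "u \<in> cell w" using z True by (simp add: \<sigma> mem_ocell flip_def P_eq u_def)
    then have p: "u \<in> piece \<beta> w" using cell_piece by auto
    have "0 < - y" using uc v_nonneg[of w] by (auto simp: u_def mem_cell)
    then have "P \<beta> u \<notin> E \<beta>" unfolding u mem_E mem_piece using v_nonneg by (smt (verit))
    then have SP: "S (\<eta>, x, y) = P \<beta> (S u)" using psi_tilde_P[of u] p by (auto simp: u E_def)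
    have oc: "S u \<in> ocell (stepE w (c - x) (\<not> shd \<eta>))" using S_cell_ocell[of "smap Not \<eta>" "c - x" "- y" w] uc by (simp add: u_def)
    have st: "step \<sigma> x (shd \<eta>) = apfst Not (stepE w (c - x) (\<not> shd \<eta>))"
      using True by (simp add: step_def \<sigma>)
    obtain b' w' where s': "stepE w (c - x) (\<not> shd \<eta>) = (b', w')" by (cases "stepE w (c - x) (\<not> shd \<eta>)")
    have "P \<beta> (S u) \<in> ocell (step \<sigma> x (shd \<eta>))"
      using oc unfolding st s' by (cases b') (auto simp: mem_ocell flip_def P_P)
    moreover have "fst (S u) = smap Not (stl \<eta>)" "fst (snd (S u)) = R_fibre \<beta> (\<not> shd \<eta>) (c - x)"
      using fst_S_piece[of "smap Not \<eta>" "c - x" "- y" w] snd_S_piece[of "smap Not \<eta>" "c - x" "- y" w] p by (auto simp: u_def)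
    moreover have "R_fibre \<beta> (\<not> shd \<eta>) (c - x) = c - R_fibre \<beta> (shd \<eta>) x"
      using R_fibre_mirror[OF ocell_I[OF z], of "shd \<eta>" True] by (simp add: mirror_def)
    ultimately show ?thesis unfolding SP by (cases "S u") (simp add: P_eq)
  qed
  then show "S (\<eta>, x, y) \<in> ocell (step \<sigma> x (shd \<eta>))" "fst (S (\<eta>, x, y)) = stl \<eta>"
    "fst (snd (S (\<eta>, x, y))) = R_fibre \<beta> (shd \<eta>) x" by blast+
qed

text \<open>The branch is chosen by the state, the point x and the digit, never by the height, so
  both heights undergo one affine map of slope 1 / (2 \<beta>) up to sign.\<close>

lemma S_contracts:
  assumes z: "(\<eta>, x, y) \<in> ocell \<sigma>" "(\<eta>, x, y') \<in> ocell \<sigma>"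
  shows "\<bar>snd (snd (S (\<eta>, x, y))) - snd (snd (S (\<eta>, x, y')))\<bar> = \<bar>y - y'\<bar> / (2 * \<beta>)"
proof -
  obtain b w where \<sigma>: "\<sigma> = (b, w)" by (cases \<sigma>)
  have E: "\<bar>snd (snd (S (\<eta>, x, y))) - snd (snd (S (\<eta>, x, y')))\<bar> = \<bar>y - y'\<bar> / (2 * \<beta>)"
    if "(\<eta>, x, y) \<in> piece \<beta> w" "(\<eta>, x, y') \<in> piece \<beta> w" for \<eta> x y y'
  proof -
    have "\<bar>snd (snd (S (\<eta>, x, y))) - snd (snd (S (\<eta>, x, y')))\<bar> = \<bar>(y - v \<beta> w) / (2 * \<beta>) - (y' - v \<beta> w) / (2 * \<beta>)\<bar>"
      unfolding S_piece(1)[OF that(1)] S_piece(1)[OF that(2)] flip_eq by auto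
    also have "\<dots> = \<bar>(y - y') / (2 * \<beta>)\<bar>" by (simp add: diff_divide_distrib)
    finally show ?thesis using beta0 by simp
  qed
  show ?thesis
  proof (cases b)
    case False
    then show ?thesis using z cell_piece by (intro E) (auto simp: \<sigma> mem_ocell flip_def)
  next
    case True
    have bar: "S (\<eta>, x, y) = P \<beta> (S (smap Not \<eta>, c - x, - y)) \<and> (smap Not \<eta>, c - x, - y) \<in> piece \<beta> w"
      if "(\<eta>, x, y) \<in> ocell \<sigma>" for y
    proof -
      have cw: "(smap Not \<eta>, c - x, - y) \<in> cell w" using that True by (simp add: \<sigma> mem_ocell flip_def P_eq)
      then have p: "(smap Not \<eta>, c - x, - y) \<in> piece \<beta> w" using cell_piece by auto
      have "y < 0" using ocell_height[of \<eta> x y b w] that True by (simp add: \<sigma>)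
      then have "(\<eta>, x, y) \<notin> E \<beta>" unfolding mem_E mem_piece using v_nonneg by (smt (verit))
      then show ?thesis using psi_tilde_P[of "(smap Not \<eta>, c - x, - y)"] p by (auto simp: P_eq E_def)
    qed
    have "\<bar>snd (snd (P \<beta> u)) - snd (snd (P \<beta> u'))\<bar> = \<bar>snd (snd u) - snd (snd u')\<bar>" for u u'
      by (cases u; cases u') (simp add: P_eq)
    then show ?thesis using bar[OF z(1)] bar[OF z(2)] E[of "smap Not \<eta>" "c - x" "- y" "- y'"] by (simp add: abs_minus_commute)
  qed
qed

lemma S_G: "S ` G \<subseteq> G"
proof (rule image_subsetI)
  fix z assume "z \<in> G"
  then obtain \<sigma> where "z \<in> ocell \<sigma>" by (auto simp: G_def)
  then show "S z \<in> G" using S_ocell(1)[of "fst z" "fst (snd z)" "snd (snd z)" \<sigma>] unfolding G_def prod.collapse by blast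
qed

subsection \<open>The measure space of the tower\<close>

lemma E_sets[measurable]: "E \<beta> \<in> sets K" unfolding E_def by (intro sets.countable_UN) (use piece_sets in blast)

lemma E_bar_eq: "E_bar \<beta> = P \<beta> -` E \<beta>" unfolding E_bar_def by (intro set_eqI) (simp add: mem_P_image)

lemma E_bar_sets[measurable]: "E_bar \<beta> \<in> sets K"
  using measurable_sets[OF P_measurable E_sets] by (simp add: E_bar_eq)

lemma space_sets: "E \<beta> \<union> E_bar \<beta> \<in> sets K" using E_sets E_bar_sets by blast

lemma psi_E_measurable: "psi_E \<beta> \<in> restrict_space K (E \<beta>) \<rightarrow>\<^sub>M K"
proof -
  define f where "f wi = (\<lambda>z :: bool stream \<times> real \<times> real.
    if \<not> act1 (snd wi) (r \<beta> (fst wi)) then (stl (fst z), \<beta> * fst (snd z), v \<beta> (fst wi @ [snd wi]) + (snd (snd z) - v \<beta> (fst wi)) / (2 * \<beta>))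
     else if fst (snd z) < 1 / \<beta> then (stl (fst z), \<beta> * fst (snd z), strip (fst wi) (snd wi) + (snd (snd z) - v \<beta> (fst wi)) / (2 * \<beta>))
     else (stl (fst z), \<beta> * fst (snd z) - 1, v \<beta> (fst wi @ [snd wi]) + (snd (snd z) - v \<beta> (fst wi)) / (2 * \<beta>)))" for wi :: "bool list \<times> bool"
  have f: "f wi \<in> K \<rightarrow>\<^sub>M K" for wi unfolding f_def by measurable
  have wo: "word_of \<beta> \<in> restrict_space K (E \<beta>) \<rightarrow>\<^sub>M count_space UNIV"
  proof (rule measurable_count_space_eq_countable[THEN iffD2])
    show "word_of \<beta> \<in> space (restrict_space K (E \<beta>)) \<rightarrow> UNIV \<and>
      (\<forall>w\<in>UNIV. word_of \<beta> -` {w} \<inter> space (restrict_space K (E \<beta>)) \<in> sets (restrict_space K (E \<beta>)))"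
    proof (intro conjI ballI)
      fix w :: "bool list"
      have "word_of \<beta> -` {w} \<inter> space (restrict_space K (E \<beta>)) = piece \<beta> w"
        by (auto simp: space_restrict_space E_def word_of_piece)
      moreover have "piece \<beta> w \<in> sets (restrict_space K (E \<beta>))"
        using piece_sets[of w] E_sets by (subst sets_restrict_space_iff) (auto simp: E_def)
      ultimately show "word_of \<beta> -` {w} \<inter> space (restrict_space K (E \<beta>)) \<in> sets (restrict_space K (E \<beta>))" by simp
    qed simp
  qed simp
  have sh: "(\<lambda>z. shd (fst z)) \<in> restrict_space K (E \<beta>) \<rightarrow>\<^sub>M count_space UNIV"
    by (rule measurable_restrict_space1) measurable
  have "(\<lambda>z. f (w, shd (fst z)) z) \<in> restrict_space K (E \<beta>) \<rightarrow>\<^sub>M K" for w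
    by (rule measurable_compose_countable[OF _ sh]) (rule measurable_restrict_space1[OF f])
  then have "(\<lambda>z. f (word_of \<beta> z, shd (fst z)) z) \<in> restrict_space K (E \<beta>) \<rightarrow>\<^sub>M K"
    by (rule measurable_compose_countable[OF _ wo])
  moreover have "psi_E \<beta> z = f (word_of \<beta> z, shd (fst z)) z" if "z \<in> space (restrict_space K (E \<beta>))" for z
  proof -
    obtain \<eta> x y where z: "z = (\<eta>, x, y)" by (cases z)
    have "z \<in> E \<beta>" using that by (simp add: space_restrict_space)
    then obtain w where w: "z \<in> piece \<beta> w" unfolding E_def by blast
    show ?thesis using psi_E_piece[of \<eta> x y w] w by (simp add: f_def word_of_piece[OF w]) (simp add: z)
  qed
  ultimately show ?thesis by (simp cong: measurable_cong)
qed

abbreviation N0 :: "(bool stream \<times> real \<times> real) measure" where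
  "N0 \<equiv> lambda_tilde \<beta>"

lemma space_N0: "space N0 = E \<beta> \<union> E_bar \<beta>"
  by (simp add: lambda_tilde_def space_restrict_space)

lemma sets_N0: "A \<in> sets N0 \<longleftrightarrow> A \<in> sets K \<and> A \<subseteq> E \<beta> \<union> E_bar \<beta>"
  unfolding lambda_tilde_def using space_sets by (subst sets_restrict_space_iff) auto

lemma emeasure_N0: "A \<in> sets N0 \<Longrightarrow> emeasure N0 A = emeasure K A"
  unfolding lambda_tilde_def using space_sets by (subst emeasure_restrict_space) (auto simp: sets_N0[unfolded lambda_tilde_def])

lemma S_measurable: "S \<in> N0 \<rightarrow>\<^sub>M N0"
proof -
  have "psi \<beta> \<in> restrict_space K (E \<beta> \<union> E_bar \<beta>) \<rightarrow>\<^sub>M K"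
  proof -
    have eq: "psi \<beta> = (\<lambda>z. if z \<in> E \<beta> then psi_E \<beta> z else psi_E_bar \<beta> z)" by (auto simp: psi_def)
    have "psi_E \<beta> \<in> restrict_space (restrict_space K (E \<beta> \<union> E_bar \<beta>)) {z. z \<in> E \<beta>} \<rightarrow>\<^sub>M K"
    proof -
      have "restrict_space (restrict_space K (E \<beta> \<union> E_bar \<beta>)) {z. z \<in> E \<beta>} = restrict_space K (E \<beta>)"
        using space_sets E_sets by (subst restrict_restrict_space) (auto intro!: arg_cong[of _ _ "restrict_space K"])
      then show ?thesis using psi_E_measurable by simp
    qed
    moreover have "psi_E_bar \<beta> \<in> restrict_space (restrict_space K (E \<beta> \<union> E_bar \<beta>)) {z. z \<notin> E \<beta>} \<rightarrow>\<^sub>M K"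
    proof -
      have "restrict_space (restrict_space K (E \<beta> \<union> E_bar \<beta>)) {z. z \<notin> E \<beta>} = restrict_space K (E_bar \<beta> - E \<beta>)"
      proof -
        have "{z. z \<notin> E \<beta>} \<in> sets K" using sets.compl_sets[OF E_sets] by (simp add: Compl_eq_Diff_UNIV[symmetric] Compl_eq)
        then show ?thesis using space_sets by (subst restrict_restrict_space) (auto intro!: arg_cong[of _ _ "restrict_space K"])
      qed
      moreover have "P \<beta> \<in> restrict_space K (E_bar \<beta> - E \<beta>) \<rightarrow>\<^sub>M restrict_space K (E \<beta>)"
        by (rule measurable_restrict_space3) (auto simp: E_bar_eq)
      ultimately show ?thesis unfolding psi_E_bar_def
        using measurable_comp[OF measurable_comp[OF _ psi_E_measurable] P_measurable] by (simp add: comp_assoc)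
    qed
    moreover have "{z \<in> space (restrict_space K (E \<beta> \<union> E_bar \<beta>)). z \<in> E \<beta>} \<in> sets (restrict_space K (E \<beta> \<union> E_bar \<beta>))"
    proof -
      have "{z \<in> space (restrict_space K (E \<beta> \<union> E_bar \<beta>)). z \<in> E \<beta>} = E \<beta>" by (auto simp: space_restrict_space)
      then show ?thesis using space_sets E_sets by (simp only:) (subst sets_restrict_space_iff, auto)
    qed
    ultimately show ?thesis unfolding eq by (subst measurable_If_restrict_space_iff) blast+
  qed
  then have "S \<in> restrict_space K (E \<beta> \<union> E_bar \<beta>) \<rightarrow>\<^sub>M K"
    unfolding psi_tilde_def by (rule measurable_comp) (rule Q_measurable)
  then show ?thesis unfolding lambda_tilde_def
    by (intro measurable_restrict_space2) (use S_space in \<open>auto simp: space_restrict_space\<close>)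
qed

end

lemma emeasure_bernoulli_shd: "emeasure bernoulli_measure {\<eta>. shd \<eta> = i} = ennreal (1/2)"
proof -
  have s: "{\<eta>. shd \<eta> = i} \<in> sets bernoulli_measure"
  proof -
    have "{\<eta> \<in> space bernoulli_measure. shd \<eta> = i} \<in> sets bernoulli_measure" by measurable
    then show ?thesis by simp
  qed
  have "emeasure bernoulli_measure {\<eta>. shd \<eta> = i} = (\<integral>\<^sup>+\<eta>. indicator {\<eta>. shd \<eta> = i} \<eta> \<partial>bernoulli_measure)"
    using s by simp
  also have "\<dots> = ennreal (1/2) * of_bool i + ennreal (1/2) * of_bool (\<not> i)"
  proof -
    have ind: "indicator {\<eta>. shd \<eta> = i} (j ## \<eta>) = (of_bool (i = j) :: ennreal)" for j \<eta> by (auto simp: indicator_def)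
    show ?thesis using bernoulli.emeasure_space_1
      by (subst nn_integral_bernoulli) (use s in \<open>auto simp: ind simp del: nn_integral_indicator\<close>)
  qed
  finally show ?thesis by (cases i) simp_all
qed

context beta_expansion
begin

section \<open>Invariance of product measures under the random map\<close>

lemma R_map_eq: "R_map \<beta> (\<eta>, x) = (stl \<eta>, R_fibre \<beta> (shd \<eta>) x)"
  by (simp add: R_map_def)

lemma R_map_measurable:
  assumes "sets \<nu> = sets (restrict_space borel {0..c})"
  shows "R_map \<beta> \<in> bernoulli_measure \<Otimes>\<^sub>M \<nu> \<rightarrow>\<^sub>M bernoulli_measure \<Otimes>\<^sub>M \<nu>"
proof -
  have R: "R_fibre \<beta> i \<in> \<nu> \<rightarrow>\<^sub>M \<nu>" for i
  proof -
    have "R_fibre \<beta> i \<in> restrict_space borel {0..c} \<rightarrow>\<^sub>M restrict_space borel {0..c}"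
      by (rule measurable_restrict_space3) (use R_fibre_I in auto)
    then show ?thesis using assms by (simp cong: measurable_cong_sets)
  qed
  have "(\<lambda>z. R_fibre \<beta> (shd (fst z)) (snd z)) \<in> bernoulli_measure \<Otimes>\<^sub>M \<nu> \<rightarrow>\<^sub>M \<nu>"
  proof (rule measurable_compose_countable)
    show "(\<lambda>z. shd (fst z)) \<in> bernoulli_measure \<Otimes>\<^sub>M \<nu> \<rightarrow>\<^sub>M count_space UNIV" by measurable
    show "(\<lambda>z. R_fibre \<beta> i (snd z)) \<in> bernoulli_measure \<Otimes>\<^sub>M \<nu> \<rightarrow>\<^sub>M \<nu>" for i
      using measurable_compose[OF measurable_snd R] .
  qed
  moreover have "R_map \<beta> = (\<lambda>z. (stl (fst z), R_fibre \<beta> (shd (fst z)) (snd z)))" by (auto simp: R_map_def)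
  ultimately show ?thesis by simp
qed

text \<open>One step of the random map reads only the first digit, a fair coin independent of x, so
  invariance becomes a mean over the two fibre maps.\<close>

lemma invariant_fibre:
  assumes "prob_space \<nu>" and s: "sets \<nu> = sets (restrict_space borel {0..c})"
    and inv: "distr (bernoulli_measure \<Otimes>\<^sub>M \<nu>) (bernoulli_measure \<Otimes>\<^sub>M \<nu>) (R_map \<beta>) = bernoulli_measure \<Otimes>\<^sub>M \<nu>"
    and B: "B \<in> sets \<nu>"
  shows "measure \<nu> B = (\<Sum>i\<in>UNIV. measure \<nu> {x\<in>{0..c}. R_fibre \<beta> i x \<in> B}) / 2"
proof -
  interpret n: prob_space \<nu> by fact
  have sp: "space \<nu> = {0..c}" using sets_eq_imp_space_eq[OF s] by simp
  define pa where "pa i = {x\<in>{0..c}. R_fibre \<beta> i x \<in> B}" for i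
  have pa: "pa i \<in> sets \<nu>" for i
  proof -
    have R: "R_fibre \<beta> i \<in> restrict_space borel {0..c} \<rightarrow>\<^sub>M restrict_space borel {0..c}"
      by (rule measurable_restrict_space3) (use R_fibre_I in auto)
    have "R_fibre \<beta> i -` B \<inter> space (restrict_space borel {0..c}) \<in> sets (restrict_space borel {0..c})"
      by (rule measurable_sets[OF R]) (use B s in simp)
    moreover have "R_fibre \<beta> i -` B \<inter> space (restrict_space borel {0..c}) = pa i" by (auto simp: pa_def)
    ultimately show ?thesis using s by simp
  qed
  have sh: "{\<eta>. shd \<eta> = i} \<in> sets bernoulli_measure" for i
  proof -
    have "{\<eta> \<in> space bernoulli_measure. shd \<eta> = i} \<in> sets bernoulli_measure" by measurable
    then show ?thesis by simp
  qed
  have UB: "UNIV \<times> B \<in> sets (bernoulli_measure \<Otimes>\<^sub>M \<nu>)" using B sets.top[of bernoulli_measure] by (intro pair_measureI) auto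
  have "emeasure \<nu> B = emeasure (bernoulli_measure \<Otimes>\<^sub>M \<nu>) (UNIV \<times> B)"
    using B sets.top[of bernoulli_measure] bernoulli.emeasure_space_1 by (subst n.emeasure_pair_measure_Times) auto
  also have "\<dots> = emeasure (distr (bernoulli_measure \<Otimes>\<^sub>M \<nu>) (bernoulli_measure \<Otimes>\<^sub>M \<nu>) (R_map \<beta>)) (UNIV \<times> B)"
    by (simp add: inv)
  also have "\<dots> = emeasure (bernoulli_measure \<Otimes>\<^sub>M \<nu>) (R_map \<beta> -` (UNIV \<times> B) \<inter> space (bernoulli_measure \<Otimes>\<^sub>M \<nu>))"
    by (rule emeasure_distr[OF R_map_measurable[OF s] UB])
  also have "R_map \<beta> -` (UNIV \<times> B) \<inter> space (bernoulli_measure \<Otimes>\<^sub>M \<nu>) =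
      {\<eta>. shd \<eta> = True} \<times> pa True \<union> {\<eta>. shd \<eta> = False} \<times> pa False"
  proof (intro set_eqI)
    fix z :: "bool stream \<times> real"
    obtain \<eta> x where z: "z = (\<eta>, x)" by (cases z)
    show "z \<in> R_map \<beta> -` (UNIV \<times> B) \<inter> space (bernoulli_measure \<Otimes>\<^sub>M \<nu>) \<longleftrightarrow>
      z \<in> {\<eta>. shd \<eta> = True} \<times> pa True \<union> {\<eta>. shd \<eta> = False} \<times> pa False"
      by (cases "shd \<eta>") (auto simp: z R_map_eq space_pair_measure sp pa_def)
  qed
  also have "emeasure (bernoulli_measure \<Otimes>\<^sub>M \<nu>) \<dots> = ennreal (1/2) * emeasure \<nu> (pa True) + ennreal (1/2) * emeasure \<nu> (pa False)"
  proof -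
    have p: "{\<eta>. shd \<eta> = i} \<times> pa i \<in> sets (bernoulli_measure \<Otimes>\<^sub>M \<nu>)" for i by (rule pair_measureI[OF sh pa])
    have e: "emeasure (bernoulli_measure \<Otimes>\<^sub>M \<nu>) ({\<eta>. shd \<eta> = i} \<times> pa i) = ennreal (1/2) * emeasure \<nu> (pa i)" for i
      by (simp only: n.emeasure_pair_measure_Times[OF sh pa] emeasure_bernoulli_shd)
    have "({\<eta>. shd \<eta> = True} \<times> pa True) \<inter> ({\<eta>. shd \<eta> = False} \<times> pa False) = {}" by auto
    from plus_emeasure[OF p p this, symmetric] show ?thesis by (simp only: e)
  qed
  also have "\<dots> = ennreal ((measure \<nu> (pa True) + measure \<nu> (pa False)) / 2)"
    by (simp add: n.emeasure_eq_measure ennreal_mult'[symmetric] ennreal_plus[symmetric] field_simps del: ennreal_plus ennreal_half)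
  finally show ?thesis
    by (simp add: n.emeasure_eq_measure UNIV_bool pa_def add.commute)
qed

section \<open>Finite measure, normalisation and invertibility of the tower\<close>

lemma space_bounded: "E \<beta> \<union> E_bar \<beta> \<subseteq> UNIV \<times> {0..c} \<times> {- (c + 1)..c + 1}"
proof
  fix z assume "z \<in> E \<beta> \<union> E_bar \<beta>"
  then obtain b where "flip b z \<in> E \<beta>" by (auto simp: E_bar_eq flip_def intro: that[of True] that[of False])
  then obtain w where w: "flip b z \<in> piece \<beta> w" unfolding E_def by blast
  show "z \<in> UNIV \<times> {0..c} \<times> {- (c + 1)..c + 1}"
    using w r_I[of w] v_bounded[of w] v_nonneg[of w] by (cases z) (auto simp: flip_eq mem_piece mirror_def split: if_splits)
qed

lemma emeasure_K_Times:
  assumes "A \<in> sets bernoulli_measure" "B \<in> sets borel" "C \<in> sets borel"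
  shows "emeasure K (A \<times> B \<times> C) = emeasure bernoulli_measure A * (emeasure lborel B * emeasure lborel C)"
proof -
  have "emeasure K (A \<times> B \<times> C) = emeasure bernoulli_measure A * emeasure (lborel \<Otimes>\<^sub>M lborel) (B \<times> C)"
    using assms by (intro sigma_finite_measure.emeasure_pair_measure_Times lborel_pair.sigma_finite_measure_axioms) (auto intro!: pair_measureI)
  also have "emeasure (lborel \<Otimes>\<^sub>M lborel) (B \<times> C) = emeasure lborel B * emeasure lborel C"
    using assms by (intro lborel.emeasure_pair_measure_Times) auto
  finally show ?thesis .
qed

lemma emeasure_N0_space: "emeasure N0 (space N0) < \<infinity>" "0 < emeasure N0 (space N0)"
proof -
  have U: "UNIV \<in> sets bernoulli_measure" using sets.top[of bernoulli_measure] by simp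
  have "emeasure K (E \<beta> \<union> E_bar \<beta>) \<le> emeasure K (UNIV \<times> {0..c} \<times> {- (c + 1)..c + 1})"
    by (rule emeasure_mono[OF space_bounded]) (use U in \<open>auto intro!: pair_measureI\<close>)
  also have "\<dots> < \<infinity>" using c1 U bernoulli.emeasure_space_1
    by (subst emeasure_K_Times) (auto simp: ennreal_mult_less_top)
  finally show "emeasure N0 (space N0) < \<infinity>" using space_sets by (simp add: emeasure_N0 sets_N0 space_N0)
  have "emeasure K (cell []) = 1" unfolding cell_def v_Nil r_Nil height_Nil using U bernoulli.emeasure_space_1
    by (subst emeasure_K_Times) auto
  moreover have "emeasure K (cell []) \<le> emeasure K (E \<beta> \<union> E_bar \<beta>)"
    by (rule emeasure_mono[OF _ space_sets]) (use cell_piece[of "[]"] in \<open>auto simp: E_def\<close>)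
  ultimately show "0 < emeasure N0 (space N0)" using space_sets by (simp add: emeasure_N0 sets_N0 space_N0 less_le_trans[of 0 "1::ennreal"])
qed

lemma G_subset: "G \<subseteq> E \<beta> \<union> E_bar \<beta>"
proof
  fix z assume "z \<in> G"
  then obtain b w where "flip b z \<in> cell w" by (auto simp: G_def ocell_def)
  then have "flip b z \<in> E \<beta>" using cell_piece[of w] by (auto simp: E_def)
  then show "z \<in> E \<beta> \<union> E_bar \<beta>" by (auto simp: flip_def E_bar_eq split: if_splits)
qed

lemma G_N0: "G \<in> sets N0" using G_subset G_sets by (simp add: sets_N0)

text \<open>What is missing from \<open>G\<close> lies on bottom edges of pieces, hence at countably
  many heights.\<close>

lemma G_full: "space N0 - G \<in> null_sets N0"
proof -
  define C where "C = range (v \<beta>) \<union> uminus ` range (v \<beta>)"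
  have "countable C" by (simp add: C_def)
  then have C: "emeasure lborel C = 0" "C \<in> sets borel"
    by (auto simp: emeasure_lborel_countable sets.countable)
  have U: "UNIV \<in> sets bernoulli_measure" using sets.top[of bernoulli_measure] by simp
  have sub: "space N0 - G \<subseteq> UNIV \<times> UNIV \<times> C"
  proof
    fix z assume z: "z \<in> space N0 - G"
    then obtain b where "flip b z \<in> E \<beta>" by (auto simp: space_N0 E_bar_eq flip_def intro: that[of True] that[of False])
    then obtain w where w: "flip b z \<in> piece \<beta> w" unfolding E_def by blast
    moreover have "flip b z \<notin> cell w" using z by (auto simp: G_def ocell_def)
    ultimately have "(if b then - snd (snd z) else snd (snd z)) = v \<beta> w"
      by (cases z) (auto simp: flip_eq mem_piece mem_cell split: if_splits)
    then have "snd (snd z) \<in> C" unfolding C_def by (cases b) (auto simp: image_iff intro: exI[of _ w])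
    then show "z \<in> UNIV \<times> UNIV \<times> C" by (cases z) auto
  qed
  have "emeasure K (space N0 - G) \<le> emeasure K (UNIV \<times> UNIV \<times> C)"
    by (rule emeasure_mono[OF sub]) (use U C in \<open>auto intro!: pair_measureI\<close>)
  also have "\<dots> = 0" using C U by (subst emeasure_K_Times) auto
  finally have "emeasure K (space N0 - G) = 0" by simp
  moreover have "space N0 - G \<in> sets N0" using G_N0 by auto
  ultimately show ?thesis by (auto simp: null_sets_def emeasure_N0)
qed

abbreviation N1 :: "(bool stream \<times> real \<times> real) measure" where
  "N1 \<equiv> normalised N0"

lemma sets_N1: "sets N1 = sets N0" and space_N1: "space N1 = space N0"
proof -
  show "sets N1 = sets N0" by (simp add: normalised_def)
  then show "space N1 = space N0" by (rule sets_eq_imp_space_eq)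
qed

definition \<kappa> :: ennreal where "\<kappa> = 1 / emeasure N0 (space N0)"

lemma emeasure_N1: "emeasure N1 A = \<kappa> * emeasure N0 A"
  by (simp add: normalised_def \<kappa>_def)

lemma \<kappa>_finite: "\<kappa> < \<infinity>" and \<kappa>_pos: "\<kappa> \<noteq> 0" and \<kappa>_space: "\<kappa> * emeasure N0 (space N0) = 1"
proof -
  obtain a where a: "emeasure N0 (space N0) = ennreal a" "0 < a"
    using emeasure_N0_space by (cases "emeasure N0 (space N0)") auto
  then have "\<kappa> = ennreal (1 / a)" by (simp add: \<kappa>_def divide_ennreal flip: ennreal_1)
  then show "\<kappa> < \<infinity>" "\<kappa> \<noteq> 0" "\<kappa> * emeasure N0 (space N0) = 1"
    using a by (auto simp: ennreal_mult'[symmetric])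
qed

lemma prob_space_N1: "prob_space N1"
  by (rule prob_spaceI) (simp add: emeasure_N1 space_N1 \<kappa>_space)

lemma null_sets_N1: "null_sets N1 = null_sets N0"
  using \<kappa>_pos by (auto simp: null_sets_def sets_N1 emeasure_N1)

lemma S_N1: "distr N1 N1 S = N1" "invertible_on N1 S (\<Inter>n. (S ^^ n) ` G)" "S \<in> N1 \<rightarrow>\<^sub>M N1"
proof -
  show m: "S \<in> N1 \<rightarrow>\<^sub>M N1" using S_measurable by (simp add: sets_N1 cong: measurable_cong_sets)
  have fw: "S ` A \<in> sets N1 \<and> emeasure N1 (S ` A) = emeasure N1 A" if "A \<in> sets N1" "A \<subseteq> G" for A
  proof -
    have A: "A \<in> sets K" "A \<in> sets N0" using that by (auto simp: sets_N1 sets_N0)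
    then have SA: "S ` A \<in> sets K" "emeasure K (S ` A) = emeasure K A"
      using forward_preserving_S that(2) by (auto simp: forward_preserving_def)
    have "S ` A \<subseteq> E \<beta> \<union> E_bar \<beta>" using that(2) S_G G_subset by blast
    then have "S ` A \<in> sets N0" using SA by (simp add: sets_N0)
    then show ?thesis using A SA by (simp add: sets_N1 emeasure_N1 emeasure_N0)
  qed
  have fin: "finite_measure N1" using prob_space_N1 by (simp add: prob_space_def)
  have G: "G \<in> sets N1" "space N1 - G \<in> null_sets N1" using G_N0 G_full by (simp_all add: sets_N1 space_N1 null_sets_N1)
  show "distr N1 N1 S = N1" by (rule forward_invertible(1)[OF fin m G inj_S S_G fw])
  show "invertible_on N1 S (\<Inter>n. (S ^^ n) ` G)" by (rule forward_invertible(2)[OF fin m G inj_S S_G fw])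
qed


section \<open>The factor map\<close>

abbreviation pr :: "bool stream \<times> real \<times> real \<Rightarrow> bool stream \<times> real" where
  "pr \<equiv> \<lambda>(\<omega>, x, y). (\<omega>, x)"

lemma pr_eq: "pr = (\<lambda>z. (fst z, fst (snd z)))" by auto

lemma space_cong: "(\<eta>, u) \<in> E \<beta> \<union> E_bar \<beta> \<longleftrightarrow> (\<eta>', u) \<in> E \<beta> \<union> E_bar \<beta>"
  by (cases u) (auto simp: E_bar_eq P_eq mem_E mem_piece)

lemma measurable_N1:
  assumes "f \<in> K \<rightarrow>\<^sub>M M" shows "f \<in> N1 \<rightarrow>\<^sub>M M"
proof -
  have "f \<in> N0 \<rightarrow>\<^sub>M M" unfolding lambda_tilde_def by (rule measurable_restrict_space1[OF assms])
  then show ?thesis by (simp add: sets_N1 cong: measurable_cong_sets)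
qed

lemma pr_S: "z \<in> G \<Longrightarrow> pr (S z) = R_map \<beta> (pr z)"
proof -
  assume "z \<in> G"
  then obtain \<sigma> where \<sigma>: "z \<in> ocell \<sigma>" by (auto simp: G_def)
  obtain \<eta> x y where z: "z = (\<eta>, x, y)" by (cases z)
  show ?thesis using S_ocell(2,3)[of \<eta> x y \<sigma>] \<sigma> by (simp add: z pr_eq R_map_eq)
qed

lemma AE_G: "AE z in N1. z \<in> G"
  by (rule AE_I'[of "space N1 - G"]) (use G_full in \<open>auto simp: null_sets_N1 space_N1\<close>)

lemma x_measurable: "(\<lambda>z. fst (snd z)) \<in> N1 \<rightarrow>\<^sub>M restrict_space borel {0..c}"
proof (rule measurable_restrict_space2)
  show "(\<lambda>z. fst (snd z)) \<in> borel_measurable N1" by (rule measurable_N1) measurable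
  show "(\<lambda>z. fst (snd z)) \<in> space N1 \<rightarrow> {0..c}" using space_bounded by (auto simp: space_N1 space_N0)
qed

lemma pr_measurable:
  assumes "sets \<nu> = sets (restrict_space borel {0..c})"
  shows "pr \<in> N1 \<rightarrow>\<^sub>M bernoulli_measure \<Otimes>\<^sub>M \<nu>"
proof -
  have "(\<lambda>z. fst (snd z)) \<in> N1 \<rightarrow>\<^sub>M \<nu>" using x_measurable assms by (simp cong: measurable_cong_sets)
  moreover have "fst \<in> N1 \<rightarrow>\<^sub>M bernoulli_measure" by (rule measurable_N1) measurable
  ultimately show ?thesis unfolding pr_eq by measurable
qed

definition \<nu> :: "real measure" where
  "\<nu> = distr N1 (restrict_space borel {0..c}) (\<lambda>z. fst (snd z))"

lemma sets_\<nu>: "sets \<nu> = sets (restrict_space borel {0..c})" by (simp add: \<nu>_def)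

lemma prob_space_\<nu>: "prob_space \<nu>"
  unfolding \<nu>_def by (rule prob_space.prob_space_distr[OF prob_space_N1 x_measurable])

text \<open>Membership in the towers is a condition on x and y alone, so the space is the product of
  all streams with a planar set, and the projected measure is a product too.\<close>

lemma emeasure_N1_rectangle:
  assumes A: "A \<in> sets bernoulli_measure" and B: "B \<in> sets \<nu>"
  shows "emeasure N1 ({z. fst z \<in> A \<and> fst (snd z) \<in> B} \<inter> space N1) = emeasure bernoulli_measure A * emeasure \<nu> B"
proof -
  have Bb: "B \<in> sets borel" using B by (auto simp: sets_\<nu> sets_restrict_space_iff)
  \<comment> \<open>Any stream cuts out the same planar section; \<open>sconst True\<close> is an
    arbitrary choice.\<close>
  define \<Lambda> where "\<Lambda> = Pair (sconst True) -` (E \<beta> \<union> E_bar \<beta>) \<inter> B \<times> UNIV"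
  have \<Lambda>: "\<Lambda> \<in> sets (lborel \<Otimes>\<^sub>M lborel)"
    unfolding \<Lambda>_def using sets_Pair1[OF space_sets, of "sconst True"] Bb by (intro sets.Int pair_measureI) auto
  have eq: "{z. fst z \<in> A' \<and> fst (snd z) \<in> B} \<inter> space N1 = A' \<times> \<Lambda>" for A'
    using space_cong[of _ _ "sconst True"] unfolding space_N1 space_N0 \<Lambda>_def by fastforce
  have sN: "A' \<times> \<Lambda> \<in> sets N0" if "A' \<in> sets bernoulli_measure" for A'
  proof -
    have "A' \<times> \<Lambda> \<subseteq> E \<beta> \<union> E_bar \<beta>" using eq[of A'] by (auto simp: space_N1 space_N0)
    then show ?thesis using that \<Lambda> by (auto simp: sets_N0)
  qed
  have K: "emeasure N1 (A' \<times> \<Lambda>) = \<kappa> * (emeasure bernoulli_measure A' * emeasure (lborel \<Otimes>\<^sub>M lborel) \<Lambda>)"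
    if "A' \<in> sets bernoulli_measure" for A'
    using that \<Lambda> by (simp add: emeasure_N1 emeasure_N0[OF sN]
      sigma_finite_measure.emeasure_pair_measure_Times[OF lborel_pair.sigma_finite_measure_axioms])
  have U: "UNIV \<in> sets bernoulli_measure" using sets.top[of bernoulli_measure] by simp
  have "emeasure \<nu> B = emeasure N1 ({z. fst z \<in> UNIV \<and> fst (snd z) \<in> B} \<inter> space N1)"
    unfolding \<nu>_def using B by (subst emeasure_distr[OF x_measurable]) (auto simp: sets_\<nu> vimage_def)
  also have "\<dots> = \<kappa> * emeasure (lborel \<Otimes>\<^sub>M lborel) \<Lambda>"
    unfolding eq K[OF U] using bernoulli.emeasure_space_1 by simp
  finally show ?thesis unfolding eq K[OF A] by (simp add: mult.assoc mult.left_commute)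
qed

lemma distr_pr: "bernoulli_measure \<Otimes>\<^sub>M \<nu> = distr N1 (bernoulli_measure \<Otimes>\<^sub>M \<nu>) pr"
proof (rule pair_measure_eqI)
  interpret n: prob_space \<nu> by (rule prob_space_\<nu>)
  show "sigma_finite_measure bernoulli_measure" "sigma_finite_measure \<nu>"
    by (rule bernoulli.sigma_finite_measure_axioms, rule n.sigma_finite_measure_axioms)
  fix A B assume AB: "A \<in> sets bernoulli_measure" "B \<in> sets \<nu>"
  have "emeasure (distr N1 (bernoulli_measure \<Otimes>\<^sub>M \<nu>) pr) (A \<times> B) = emeasure N1 (pr -` (A \<times> B) \<inter> space N1)"
    using AB by (intro emeasure_distr pr_measurable sets_\<nu>) auto
  also have "pr -` (A \<times> B) \<inter> space N1 = {z. fst z \<in> A \<and> fst (snd z) \<in> B} \<inter> space N1" by (auto simp: pr_eq)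
  finally show "emeasure bernoulli_measure A * emeasure \<nu> B = emeasure (distr N1 (bernoulli_measure \<Otimes>\<^sub>M \<nu>) pr) (A \<times> B)"
    using emeasure_N1_rectangle[OF AB] by simp
qed simp

lemma R_map_\<nu>: "distr (bernoulli_measure \<Otimes>\<^sub>M \<nu>) (bernoulli_measure \<Otimes>\<^sub>M \<nu>) (R_map \<beta>) = bernoulli_measure \<Otimes>\<^sub>M \<nu>"
proof -
  let ?M = "bernoulli_measure \<Otimes>\<^sub>M \<nu>"
  note pm = pr_measurable[OF sets_\<nu>] and Rm = R_map_measurable[OF sets_\<nu>]
  have "distr ?M ?M (R_map \<beta>) = distr (distr N1 ?M pr) ?M (R_map \<beta>)" using distr_pr by simp
  also have "\<dots> = distr N1 ?M (R_map \<beta> \<circ> pr)" by (rule distr_distr[OF Rm pm])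
  also have "\<dots> = distr N1 ?M (pr \<circ> S)"
    by (rule distr_cong_AE[OF refl refl _ measurable_comp[OF pm Rm] measurable_comp[OF S_N1(3) pm]])
      (use AE_G in eventually_elim, simp only: comp_apply pr_S)
  also have "\<dots> = distr (distr N1 N1 S) ?M pr" by (rule distr_distr[OF pm S_N1(3), symmetric])
  also have "\<dots> = ?M" using S_N1(1) distr_pr by simp
  finally show ?thesis .
qed

lemma \<nu>_absolutely_continuous: "absolutely_continuous (restrict_space lborel {0..c}) \<nu>"
  unfolding absolutely_continuous_def
proof
  fix B assume B: "B \<in> null_sets (restrict_space lborel {0..c})"
  then have Bs: "B \<in> sets borel" "B \<subseteq> {0..c}" and B0: "emeasure lborel B = 0"
    by (subst (asm) null_sets_restrict_space; force simp: null_sets_def)+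
  have U: "UNIV \<in> sets bernoulli_measure" using sets.top[of bernoulli_measure] by simp
  have B\<nu>: "B \<in> sets \<nu>" using Bs by (simp add: sets_\<nu> sets_restrict_space_iff)
  have "emeasure \<nu> B = emeasure N1 ((\<lambda>z. fst (snd z)) -` B \<inter> space N1)"
    unfolding \<nu>_def using B\<nu> by (intro emeasure_distr x_measurable) (simp add: sets_\<nu>)
  also have "\<dots> = \<kappa> * emeasure K ((\<lambda>z. fst (snd z)) -` B \<inter> space N1)"
    using measurable_sets[OF x_measurable, of B] B\<nu> by (simp add: emeasure_N1 emeasure_N0 sets_N1 sets_\<nu>)
  also have "emeasure K ((\<lambda>z. fst (snd z)) -` B \<inter> space N1) = 0"
  proof -
    have "emeasure K ((\<lambda>z. fst (snd z)) -` B \<inter> space N1) \<le> emeasure K (UNIV \<times> B \<times> UNIV)"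
      by (rule emeasure_mono) (use U Bs in \<open>auto intro!: pair_measureI\<close>)
    also have "emeasure K (UNIV \<times> B \<times> UNIV) = 0" using U Bs B0 by (subst emeasure_K_Times) auto
    finally show ?thesis by simp
  qed
  finally show "B \<in> null_sets \<nu>" using B\<nu> by (auto simp: null_sets_def)
qed

lemma invariant_eq_\<nu>:
  assumes "prob_space \<mu>" "sets \<mu> = sets (restrict_space borel {0..c})"
    and "absolutely_continuous (restrict_space lborel {0..c}) \<mu>"
    and "distr (bernoulli_measure \<Otimes>\<^sub>M \<mu>) (bernoulli_measure \<Otimes>\<^sub>M \<mu>) (R_map \<beta>) = bernoulli_measure \<Otimes>\<^sub>M \<mu>"
  shows "\<mu> = \<nu>"
  by (rule absolutely_continuous_invariant_unique[OF assms(1-3) invariant_fibre[OF assms(1,2,4)]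
        prob_space_\<nu> sets_\<nu> \<nu>_absolutely_continuous invariant_fibre[OF prob_space_\<nu> sets_\<nu> R_map_\<nu>]])

lemma factor_map_pr: "factor_map N1 S pr (bernoulli_measure \<Otimes>\<^sub>M \<nu>) (R_map \<beta>)"
  unfolding factor_map_def
proof (intro conjI)
  show "pr \<in> N1 \<rightarrow>\<^sub>M bernoulli_measure \<Otimes>\<^sub>M \<nu>" by (rule pr_measurable[OF sets_\<nu>])
  show "distr N1 (bernoulli_measure \<Otimes>\<^sub>M \<nu>) pr = bernoulli_measure \<Otimes>\<^sub>M \<nu>" by (rule distr_pr[symmetric])
  show "AE z in N1. pr (S z) = R_map \<beta> (pr z)" using AE_G by eventually_elim (rule pr_S)
qed


section \<open>Coalescence of states\<close>

text \<open>
  The probability that the states \<open>\<sigma>\<close> and \<open>\<tau>\<close> of two points over the same \<open>(\<omega>, x)\<close> are still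
  different after \<open>n\<close> random digits.
\<close>

primrec apart :: "nat \<Rightarrow> real \<Rightarrow> bool \<times> bool list \<Rightarrow> bool \<times> bool list \<Rightarrow> real" where
  "apart 0 x \<sigma> \<tau> = of_bool (\<sigma> \<noteq> \<tau>)"
| "apart (Suc n) x \<sigma> \<tau> = (apart n (R_fibre \<beta> False x) (step \<sigma> x False) (step \<tau> x False) +
      apart n (R_fibre \<beta> True x) (step \<sigma> x True) (step \<tau> x True)) / 2"

lemma apart_bounds: "0 \<le> apart n x \<sigma> \<tau>" "apart n x \<sigma> \<tau> \<le> 1"
proof -
  have "0 \<le> apart n x \<sigma> \<tau> \<and> apart n x \<sigma> \<tau> \<le> 1"
  proof (induction n arbitrary: x \<sigma> \<tau>)
    case (Suc n)
    have "0 \<le> (a + b) / 2 \<and> (a + b) / 2 \<le> 1" if "0 \<le> a \<and> a \<le> 1" "0 \<le> b \<and> b \<le> 1" for a b :: real using that by simp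
    from this[OF Suc.IH Suc.IH] show ?case unfolding apart.simps .
  qed simp
  then show "0 \<le> apart n x \<sigma> \<tau>" "apart n x \<sigma> \<tau> \<le> 1" by auto
qed

lemma apart_refl: "apart n x \<sigma> \<sigma> = 0" by (induction n arbitrary: x \<sigma>) auto

lemma apart_sym: "apart n x \<sigma> \<tau> = apart n x \<tau> \<sigma>" by (induction n arbitrary: x \<sigma> \<tau>) auto

text \<open>Once two states agree they agree forever, since the same x and the same digits drive
  both.\<close>

lemma apart_Suc_le: "apart (Suc n) x \<sigma> \<tau> \<le> apart n x \<sigma> \<tau>"
proof (induction n arbitrary: x \<sigma> \<tau>)
  case 0
  show ?case using apart_bounds(2)[of "Suc 0" x \<sigma> \<tau>] apart_refl[of "Suc 0" x \<sigma>] by (cases "\<sigma> = \<tau>") auto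
next
  case (Suc n)
  show ?case unfolding apart.simps(2)[of "Suc n"] apart.simps(2)[of n x]
    by (intro divide_right_mono add_mono Suc) simp
qed

lemma apart_antimono: "m \<le> n \<Longrightarrow> apart n x \<sigma> \<tau> \<le> apart m x \<sigma> \<tau>"
  by (rule lift_Suc_antimono_le[of "\<lambda>n. apart n x \<sigma> \<tau>"]) (rule apart_Suc_le)

text \<open>\<open>apart n\<close> is the mean of 2 ^ n outcomes 0 or 1, so its values are multiples
  of (1/2) ^ n.\<close>

lemma apart_gap: "apart n x \<sigma> \<tau> < 1 \<Longrightarrow> apart n x \<sigma> \<tau> \<le> 1 - (1/2) ^ n"
proof (induction n arbitrary: x \<sigma> \<tau>)
  case (Suc n)
  let ?a = "\<lambda>i. apart n (R_fibre \<beta> i x) (step \<sigma> x i) (step \<tau> x i)"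
  have "\<exists>i. ?a i < 1"
  proof (rule ccontr)
    assume "\<not> ?thesis"
    then have "1 \<le> ?a False" "1 \<le> ?a True" by (auto simp: not_less)
    then show False using Suc.prems by simp
  qed
  then obtain i where i: "?a i \<le> 1 - (1/2) ^ n" using Suc.IH by blast
  have "?a (\<not> i) \<le> 1" by (rule apart_bounds)
  then have "?a False + ?a True \<le> 2 - (1/2) ^ n" using i by (cases i) auto
  then show ?case by simp
qed auto

section \<open>Points over which two states never merge\<close>

definition compat :: "bool \<times> bool list \<Rightarrow> real set" where
  "compat \<sigma> = {x. mirror (fst \<sigma>) x \<in> {0..r \<beta> (snd \<sigma>)}}"

lemma compat_I: "compat \<sigma> \<subseteq> {0..c}"
  using r_I[of "snd \<sigma>"] by (auto simp: compat_def mirror_def split: if_splits)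

lemma compat_sets[measurable]: "compat \<sigma> \<in> sets borel"
  by (cases "fst \<sigma>") (simp_all add: compat_def mirror_def)

lemma ocell_compat: "(\<eta>, x, y) \<in> ocell \<sigma> \<Longrightarrow> x \<in> compat \<sigma>"
  unfolding compat_def using ocell_x by blast

text \<open>The point at the middle height of the cell; through such a point facts about
  \<open>S\<close> become facts about states.\<close>

lemma compat_ocell:
  assumes "x \<in> compat \<sigma>"
  shows "(\<eta>, x, (if fst \<sigma> then - 1 else 1) * (v \<beta> (snd \<sigma>) + height (snd \<sigma>) / 2)) \<in> ocell \<sigma>"
  using assms height_pos[of "snd \<sigma>"] by (auto simp: compat_def ocell_def flip_eq mem_cell)

lemma compat_step: "x \<in> compat \<sigma> \<Longrightarrow> R_fibre \<beta> i x \<in> compat (step \<sigma> x i)"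
proof -
  assume x: "x \<in> compat \<sigma>"
  \<comment> \<open>One step reads only the first digit, so the stream may continue
    arbitrarily.\<close>
  note oc = S_ocell[OF compat_ocell[OF x, of "i ## undefined"]]
  let ?z = "S (i ## undefined, x, (if fst \<sigma> then - 1 else 1) * (v \<beta> (snd \<sigma>) + height (snd \<sigma>) / 2))"
  have "(fst ?z, fst (snd ?z), snd (snd ?z)) \<in> ocell (step \<sigma> x i)" using oc(1) by simp
  then have "fst (snd ?z) \<in> compat (step \<sigma> x i)" by (rule ocell_compat)
  then show ?thesis using oc(3) by simp
qed

lemma step_measurable[measurable]: "(\<lambda>x. step \<sigma> x i) \<in> borel \<rightarrow>\<^sub>M count_space UNIV"
proof -
  have "(\<lambda>x. stepE w (if b then c - x else x) j) \<in> borel \<rightarrow>\<^sub>M count_space UNIV" for w b j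
    unfolding stepE_def by (cases b) (simp_all, measurable)
  from measurable_compose[OF this, of "apfst ((\<noteq>) (fst \<sigma>))"] show ?thesis unfolding step_def by simp
qed

lemma apart_measurable[measurable]: "(\<lambda>x. apart n x \<sigma> \<tau>) \<in> borel_measurable borel"
proof (induction n arbitrary: \<sigma> \<tau>)
  case (Suc n)
  have 1: "(\<lambda>x. apart n (R_fibre \<beta> i x) s t) \<in> borel_measurable borel" for i s t
    using measurable_compose[OF R_fibre_measurable Suc] .
  have 2: "(\<lambda>x. apart n (R_fibre \<beta> i x) s (step \<tau> x i)) \<in> borel_measurable borel" for i s
    by (rule measurable_compose_countable[where f = "\<lambda>t x. apart n (R_fibre \<beta> i x) s t", OF 1 step_measurable])
  have "(\<lambda>x. apart n (R_fibre \<beta> i x) (step \<sigma> x i) (step \<tau> x i)) \<in> borel_measurable borel" for i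
    by (rule measurable_compose_countable[where f = "\<lambda>s x. apart n (R_fibre \<beta> i x) s (step \<tau> x i)", OF 2 step_measurable])
  then show ?case by simp
qed simp

lemma step_mirror: "step (\<not> b, w) (c - x) (\<not> i) = apfst Not (step (b, w) x i)"
proof -
  have "(\<not> i) \<noteq> (\<not> b) \<longleftrightarrow> i \<noteq> b" by auto
  moreover have "(if \<not> b then c - (c - x) else c - x) = (if b then c - x else x)" by simp
  moreover have "apfst ((\<noteq>) (\<not> b)) p = apfst Not (apfst ((\<noteq>) b) p)" for p :: "bool \<times> bool list" by (cases p) auto
  ultimately show ?thesis by (simp add: step_def)
qed

lemma apart_mirror: "x \<in> {0..c} \<Longrightarrow> apart n (c - x) (apfst Not \<sigma>) (apfst Not \<tau>) = apart n x \<sigma> \<tau>"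
proof (induction n arbitrary: x \<sigma> \<tau>)
  case 0 show ?case by (cases \<sigma>; cases \<tau>) auto
next
  case (Suc n)
  have R: "R_fibre \<beta> (\<not> i) (c - x) = c - R_fibre \<beta> i x" for i
    using R_fibre_mirror[OF Suc.prems, of i True] by (simp add: mirror_def)
  have s: "step (apfst Not \<rho>) (c - x) (\<not> i) = apfst Not (step \<rho> x i)" for \<rho> i
    using step_mirror[of "fst \<rho>" "snd \<rho>"] by (cases \<rho>) simp
  have "apart n (R_fibre \<beta> (\<not> i) (c - x)) (step (apfst Not \<sigma>) (c - x) (\<not> i)) (step (apfst Not \<tau>) (c - x) (\<not> i)) =
      apart n (R_fibre \<beta> i x) (step \<sigma> x i) (step \<tau> x i)" for i
    unfolding R s by (rule Suc.IH[OF R_fibre_I[OF Suc.prems]])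
  from this[of False] this[of True] show ?case by (simp add: add.commute)
qed

text \<open>The points over which no word of digits merges the two states.\<close>

definition Bad :: "bool \<times> bool list \<Rightarrow> bool \<times> bool list \<Rightarrow> real set" where
  "Bad \<sigma> \<tau> = {x \<in> compat \<sigma> \<inter> compat \<tau>. \<forall>n. apart n x \<sigma> \<tau> = 1}"

lemma Bad_I: "Bad \<sigma> \<tau> \<subseteq> {0..c}" unfolding Bad_def using compat_I[of \<sigma>] by blast

lemma Bad_sets[measurable]: "Bad \<sigma> \<tau> \<in> sets borel"
proof -
  have "Bad \<sigma> \<tau> = {x \<in> space borel. x \<in> compat \<sigma> \<and> x \<in> compat \<tau> \<and> (\<forall>n. apart n x \<sigma> \<tau> = 1)}" by (auto simp: Bad_def)
  also have "\<dots> \<in> sets borel" by measurable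
  finally show ?thesis .
qed

lemma Bad_refl: "Bad \<sigma> \<sigma> = {}" by (auto simp: Bad_def apart_refl)

lemma Bad_sym: "Bad \<sigma> \<tau> = Bad \<tau> \<sigma>" by (auto simp: Bad_def apart_sym)

text \<open>A mean of two numbers at most 1 equals 1 only if both do, so no digit can lead out of
  the bad points.\<close>

lemma Bad_step: "x \<in> Bad \<sigma> \<tau> \<Longrightarrow> R_fibre \<beta> i x \<in> Bad (step \<sigma> x i) (step \<tau> x i)"
proof -
  assume x: "x \<in> Bad \<sigma> \<tau>"
  have "apart n (R_fibre \<beta> i x) (step \<sigma> x i) (step \<tau> x i) = 1" for n
  proof -
    have "apart (Suc n) x \<sigma> \<tau> = 1" using x by (simp only: Bad_def mem_Collect_eq)
    then show ?thesis using apart_bounds(2)[of n "R_fibre \<beta> False x" "step \<sigma> x False" "step \<tau> x False"]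
        apart_bounds(2)[of n "R_fibre \<beta> True x" "step \<sigma> x True" "step \<tau> x True"]
      by (cases i) auto
  qed
  then show ?thesis using x compat_step by (auto simp: Bad_def)
qed

lemma Bad_mirror: "x \<in> Bad \<sigma> \<tau> \<Longrightarrow> c - x \<in> Bad (apfst Not \<sigma>) (apfst Not \<tau>)"
proof -
  assume x: "x \<in> Bad \<sigma> \<tau>"
  have "c - x \<in> compat (apfst Not \<rho>)" if "x \<in> compat \<rho>" for \<rho>
    using that by (cases \<rho>) (auto simp: compat_def mirror_def split: if_splits)
  moreover have "apart n (c - x) (apfst Not \<sigma>) (apfst Not \<tau>) = 1" for n
    using apart_mirror[OF subsetD[OF Bad_I x], of n \<sigma> \<tau>] x by (simp add: Bad_def)
  ultimately show ?thesis using x unfolding Bad_def by blast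
qed

abbreviation lm :: "real set \<Rightarrow> real" where "lm \<equiv> measure lborel"

lemma fmeasurable_I: "B \<in> sets borel \<Longrightarrow> B \<subseteq> {0..c} \<Longrightarrow> B \<in> fmeasurable lborel"
proof -
  assume B: "B \<in> sets borel" "B \<subseteq> {0..c}"
  have "{0..c} \<in> fmeasurable lborel" by (auto simp: fmeasurable_def emeasure_lborel_Icc_eq)
  then show ?thesis by (rule fmeasurableI2) (use B in auto)
qed

lemma lm_mono: "A \<in> sets borel \<Longrightarrow> B \<in> sets borel \<Longrightarrow> A \<subseteq> B \<Longrightarrow> B \<subseteq> {0..c} \<Longrightarrow> lm A \<le> lm B"
  by (intro measure_mono_fmeasurable fmeasurable_I) auto

lemma lm_le_c: "B \<in> sets borel \<Longrightarrow> B \<subseteq> {0..c} \<Longrightarrow> lm B \<le> c"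
  using lm_mono[of B "{0..c}"] c1 by simp

text \<open>One round of the expansion argument. It asks that the digit acts on all of
  \<open>A\<close> by one branch and leads to one pair of states, so that the image is not
  cut.\<close>

lemma Bad_expand:
  assumes A: "A \<in> sets borel" "A \<subseteq> Bad \<sigma> \<tau>"
    and steps: "\<And>x. x \<in> A \<Longrightarrow> R_fibre \<beta> i x = \<beta> * x - d \<and> step \<sigma> x i = \<sigma>' \<and> step \<tau> x i = \<tau>'"
  shows "(\<lambda>x. \<beta> * x - d) ` A \<subseteq> Bad \<sigma>' \<tau>'" "\<beta> * lm A \<le> lm (Bad \<sigma>' \<tau>')"
proof -
  show sub: "(\<lambda>x. \<beta> * x - d) ` A \<subseteq> Bad \<sigma>' \<tau>'"
  proof (rule image_subsetI)
    fix x assume "x \<in> A"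
    then show "\<beta> * x - d \<in> Bad \<sigma>' \<tau>'" using Bad_step[of x \<sigma> \<tau> i] A(2) steps[of x] by auto
  qed
  have "\<beta> * lm A = lm ((\<lambda>x. \<beta> * x - d) ` A)" by (rule affine_image_lborel(3)[OF beta0 A(1), symmetric])
  also have "\<dots> \<le> lm (Bad \<sigma>' \<tau>')"
    by (rule lm_mono[OF affine_image_lborel(1)[OF beta0 A(1)] Bad_sets sub Bad_I])
  finally show "\<beta> * lm A \<le> lm (Bad \<sigma>' \<tau>')" .
qed

lemma power_growth_bounded:
  assumes "\<And>n. \<beta> ^ n * a \<le> c" shows "a \<le> 0"
proof (rule ccontr)
  assume "\<not> a \<le> 0"
  then have a: "0 < a" by simp
  obtain n where "c / a < \<beta> ^ n" using real_arch_pow[OF beta1] by blast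
  then show False using assms[of n] a by (simp add: field_simps)
qed

lemma step_E: "step (False, w) x i = stepE w x i"
  by (cases "stepE w x i") (simp add: step_def)

lemma step_bar: "step (True, w) x i = apfst Not (stepE w (c - x) (\<not> i))"
  by (cases "stepE w (c - x) (\<not> i)") (simp add: step_def)

text \<open>
  The digit \<open>1\<close> keeps both points in the tower \<open>E\<close>, and neither the expansion nor a return to the base
  cuts the set of bad points; hence this set would grow by the factor \<open>\<beta>\<close> forever.
\<close>

lemma Bad_E_E: "lm (Bad (False, w1) (False, w2)) = 0"
proof -
  have ex: "\<exists>w1' w2'. \<beta> * lm (Bad (False, w1) (False, w2)) \<le> lm (Bad (False, w1') (False, w2'))" for w1 w2
  proof (cases "1 / \<beta> \<le> r \<beta> w1 \<and> 1 / \<beta> \<le> r \<beta> w2")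
    case True
    then have act: "act1 True (r \<beta> w1)" "act1 True (r \<beta> w2)" by (auto simp: act1_def)
    \<comment> \<open>Below 1 / \<beta> digit 1 would return both points to the base, where their
      states agree.\<close>
    have ge: "1 / \<beta> \<le> x" if x: "x \<in> Bad (False, w1) (False, w2)" for x
    proof (rule ccontr)
      assume "\<not> 1 / \<beta> \<le> x"
      then show False using Bad_step[OF x, of True] act by (simp add: step_E stepE_def Bad_refl)
    qed
    show ?thesis
    proof (intro exI, rule Bad_expand(2)[OF Bad_sets subset_refl])
      fix x assume x: "x \<in> Bad (False, w1) (False, w2)"
      then show "R_fibre \<beta> True x = \<beta> * x - 1 \<and> step (False, w1) x True = (False, w1 @ [True]) \<and> step (False, w2) x True = (False, w2 @ [True])"
        using ge[OF x] act subsetD[OF Bad_I x] by (simp add: step_E stepE_def R_fibre_eq)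
    qed
  next
    case False
    \<comment> \<open>Now one of the pieces ends below 1 / \<beta>, so all common points lie there
      and move by \<open>T0\<close>. Under digit 1 a piece with end at least 1 / \<beta> returns to
      the base, and one with a smaller end climbs.\<close>
    let ?s = "\<lambda>w. if 1 / \<beta> \<le> r \<beta> w then [] else w @ [True]"
    show ?thesis
    proof (intro exI, rule Bad_expand(2)[OF Bad_sets subset_refl])
      fix x assume x: "x \<in> Bad (False, w1) (False, w2)"
      then have "x \<le> r \<beta> w1" "x \<le> r \<beta> w2" by (auto simp: Bad_def compat_def mirror_def)
      then have lt: "x < 1 / \<beta>" using False by auto
      then show "R_fibre \<beta> True x = \<beta> * x - 0 \<and> step (False, w1) x True = (False, ?s w1) \<and> step (False, w2) x True = (False, ?s w2)"
        using subsetD[OF Bad_I x] by (simp add: step_E stepE_def R_fibre_eq act1_def)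
    qed
  qed
  have "\<exists>w1' w2'. \<beta> ^ n * lm (Bad (False, w1) (False, w2)) \<le> lm (Bad (False, w1') (False, w2'))" for n
  proof (induction n)
    case 0 show ?case by auto
  next
    case (Suc n)
    then obtain w1' w2' where 1: "\<beta> ^ n * lm (Bad (False, w1) (False, w2)) \<le> lm (Bad (False, w1') (False, w2'))" by blast
    obtain w1'' w2'' where 2: "\<beta> * lm (Bad (False, w1') (False, w2')) \<le> lm (Bad (False, w1'') (False, w2''))" using ex by blast
    have "\<beta> ^ Suc n * lm (Bad (False, w1) (False, w2)) \<le> \<beta> * lm (Bad (False, w1') (False, w2'))"
      using mult_left_mono[OF 1, of \<beta>] beta0 by (simp add: mult.assoc)
    then show ?case using 2 by (meson order_trans)
  qed
  then have "\<beta> ^ n * lm (Bad (False, w1) (False, w2)) \<le> c" for n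
    using lm_le_c[OF Bad_sets Bad_I] by (meson order_trans)
  then have "lm (Bad (False, w1) (False, w2)) \<le> 0" by (rule power_growth_bounded)
  then show ?thesis by (simp add: measure_le_0_iff)
qed

lemma lm_mirror:
  assumes A: "A \<in> sets borel" shows "lm ((\<lambda>x. c - x) ` A) = lm A" "(\<lambda>x. c - x) ` A \<in> sets borel"
proof -
  have im: "(\<lambda>x. c - x) ` A = (\<lambda>x. c - x) -` A"
  proof (intro equalityI subsetI)
    fix x assume "x \<in> (\<lambda>x. c - x) -` A"
    then have "c - (c - x) \<in> (\<lambda>x. c - x) ` A" by (intro imageI) simp
    then show "x \<in> (\<lambda>x. c - x) ` A" by simp
  qed auto
  show s: "(\<lambda>x. c - x) ` A \<in> sets borel" unfolding im using measurable_sets[of "\<lambda>x. c - x" borel borel A] A by simp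
  have d: "distr lborel borel (\<lambda>x. c - x) = lborel"
    using lborel_real_affine[of "-1" c] by (simp add: density_1)
  have "lm A = measure (distr lborel borel (\<lambda>x. c - x)) A" by (simp only: d)
  also have "\<dots> = lm ((\<lambda>x. c - x) -` A \<inter> space lborel)" using A by (intro measure_distr) auto
  finally show "lm ((\<lambda>x. c - x) ` A) = lm A" by (simp add: im)
qed

lemma Bad_bar_bar: "lm (Bad (True, w1) (True, w2)) = 0"
proof -
  have sub: "(\<lambda>x. c - x) ` Bad (True, w1) (True, w2) \<subseteq> Bad (False, w1) (False, w2)"
    using Bad_mirror[of _ "(True, w1)" "(True, w2)"] by auto
  have "lm (Bad (True, w1) (True, w2)) = lm ((\<lambda>x. c - x) ` Bad (True, w1) (True, w2))" by (rule lm_mirror(1)[symmetric]) simp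
  also have "\<dots> \<le> lm (Bad (False, w1) (False, w2))" by (rule lm_mono[OF lm_mirror(2) Bad_sets sub Bad_I]) simp
  finally show ?thesis by (simp add: Bad_E_E measure_le_0_iff)
qed

text \<open>If one of the two towers cuts the switch region, one digit brings both points into the same tower.\<close>

lemma Bad_mixed_switch:
  assumes "c / \<beta> < r \<beta> w1 \<or> c / \<beta> < r \<beta> w2"
  shows "lm (Bad (False, w1) (True, w2) \<inter> {1 / \<beta>..c / \<beta>}) = 0"
proof -
  have main: "lm (Bad (False, w1) (True, w2) \<inter> {1 / \<beta>..c / \<beta>}) = 0" if r1: "c / \<beta> < r \<beta> w1" for w1 w2
  proof -
    let ?A = "Bad (False, w1) (True, w2) \<inter> {1 / \<beta>..c / \<beta>}"
    \<comment> \<open>Digit 0 takes the first point across to the mirror tower. The second point,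
      folded back, sees digit 1 at c - x \<ge> 1 / \<beta>, moves by \<open>T1\<close> and stays in
      the mirror tower.\<close>
    have "\<beta> * lm ?A \<le> lm (Bad (True, w1 @ [False]) (True, w2 @ [True]))"
    proof (rule Bad_expand(2)[where d = 0 and i = False])
      fix x assume x: "x \<in> ?A"
      have xI: "x \<in> {0..c}" using x Bad_I by blast
      have x2: "c - x \<le> r \<beta> w2" using x by (auto simp: Bad_def compat_def mirror_def)
      have x': "1 / \<beta> \<le> c - x" using x c_div' by auto
      have "act1 False (r \<beta> w1)" "act1 True (r \<beta> w2)" using r1 c_div_less x2 x' by (auto simp: act1_def)
      then show "R_fibre \<beta> False x = \<beta> * x - 0 \<and> step (False, w1) x False = (True, w1 @ [False]) \<and>
          step (True, w2) x False = (True, w2 @ [True])"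
        using x x' by (simp add: step_E step_bar stepE_def R_fibre_eq[OF xI])
    qed auto
    then have "\<beta> * lm ?A \<le> 0" by (simp add: Bad_bar_bar)
    then show ?thesis using beta0 by (simp add: mult_le_0_iff measure_le_0_iff)
  qed
  show ?thesis
  proof (cases "c / \<beta> < r \<beta> w1")
    case False
    let ?A = "Bad (False, w1) (True, w2) \<inter> {1 / \<beta>..c / \<beta>}"
    have sub: "(\<lambda>x. c - x) ` ?A \<subseteq> Bad (False, w2) (True, w1) \<inter> {1 / \<beta>..c / \<beta>}"
      using Bad_mirror[of _ "(False, w1)" "(True, w2)"] c_div' Bad_sym[of "(False, w2)"] by auto
    have A: "?A \<in> sets borel" by simp
    have "lm ?A = lm ((\<lambda>x. c - x) ` ?A)" by (rule lm_mirror(1)[OF A, symmetric])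
    also have "\<dots> \<le> lm (Bad (False, w2) (True, w1) \<inter> {1 / \<beta>..c / \<beta>})"
      by (rule lm_mono[OF lm_mirror(2)[OF A] _ sub]) (simp, use Bad_I in blast)
    also have "\<dots> = 0" using main False assms by blast
    finally show ?thesis by (simp add: measure_le_0_iff)
  qed (rule main)
qed

text \<open>
  An interval in which the bad points have high density cannot cover the switch region, as this
  region contains none of them. So one digit expands the interval without cutting it, and again
  the bad points would grow by the factor \<open>\<beta>\<close> forever.
\<close>

lemma Bad_mixed: "lm (Bad (False, w1) (True, w2)) = 0"
proof (rule ccontr)
  assume neg: "lm (Bad (False, w1) (True, w2)) \<noteq> 0"
  let ?B = "\<lambda>w1 w2. Bad (False, w1) (True, w2)"
  let ?Sw = "{1 / \<beta>..c / \<beta>}"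
  \<comment> \<open>e c has to be smaller than the length of the switch region. An interval in which
    the bad points have density 1 - e then cannot contain that region if almost none of it is
    bad.\<close>
  define e where "e = min (1/2) (lm ?Sw / (2 * c))"
  have Sw: "0 < lm ?Sw" "?Sw \<subseteq> {0..c}" using c_div_less by auto
  have e: "0 < e" "e < 1" using Sw c1 by (auto simp: e_def)
  have ec: "e * c < lm ?Sw"
  proof -
    have "e * c \<le> lm ?Sw / (2 * c) * c" using c1 by (intro mult_right_mono) (auto simp: e_def)
    then show ?thesis using c1 Sw by simp
  qed
  define good where "good w1 w2 J \<longleftrightarrow> is_interval J \<and> J \<in> sets borel \<and> J \<subseteq> {0..c} \<and>
    0 < lm (?B w1 w2 \<inter> J) \<and> (1 - e) * lm J \<le> lm (?B w1 w2 \<inter> J)" for w1 w2 and J :: "real set"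
  \<comment> \<open>\<open>H\<close> is an interval on which one branch and one pair of new states
    are in force. Replacing \<open>J\<close> by its part in \<open>H\<close> loses only a null set
    of bad points and does not lower the density.\<close>
  have extend: "\<exists>J'. good w1' w2' J' \<and> \<beta> * lm (?B w1 w2 \<inter> J) \<le> lm (?B w1' w2' \<inter> J')"
    if J: "good w1 w2 J" and H: "is_interval H" "H \<in> sets borel"
      and null: "lm (?B w1 w2 \<inter> J - H) = 0"
      and R: "\<And>x. x \<in> H \<Longrightarrow> x \<in> {0..c} \<Longrightarrow> R_fibre \<beta> i x = \<beta> * x - d"
      and steps: "\<And>x. x \<in> H \<Longrightarrow> x \<in> ?B w1 w2 \<Longrightarrow> step (False, w1) x i = (False, w1') \<and> step (True, w2) x i = (True, w2')"
    for w1 w2 J H i d w1' w2'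
  proof -
    have Ji: "is_interval J" and Jb[measurable]: "J \<in> sets borel" and Jc: "J \<subseteq> {0..c}"
      and pos: "0 < lm (?B w1 w2 \<inter> J)" and Jd: "(1 - e) * lm J \<le> lm (?B w1 w2 \<inter> J)" using J by (auto simp: good_def)
    note H(2)[measurable]
    let ?h = "\<lambda>x. \<beta> * x - d"
    define J' where "J' = ?h ` (J \<inter> H)"
    have JHb: "J \<inter> H \<in> sets borel" by simp
    have J'b: "J' \<in> sets borel" and J'm: "lm J' = \<beta> * lm (J \<inter> H)"
      unfolding J'_def using affine_image_lborel[OF beta0 JHb] by auto
    have J'c: "J' \<subseteq> {0..c}" unfolding J'_def
    proof (rule image_subsetI)
      fix x assume "x \<in> J \<inter> H"
      then show "?h x \<in> {0..c}" using R[of x] R_fibre_I[of x i] Jc by auto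
    qed
    have "is_interval (J \<inter> H)" using Ji H(1) by (rule is_interval_Int)
    then have "connected (?h ` (J \<inter> H))" unfolding is_interval_connected_1
      by (intro connected_continuous_image) (auto intro!: continuous_intros)
    then have J'i: "is_interval J'" by (simp add: is_interval_connected_1 J'_def)
    let ?A = "?B w1 w2 \<inter> J \<inter> H"
    have Ab: "?A \<in> sets borel" by simp
    have BJ: "?B w1 w2 \<inter> J \<in> fmeasurable lborel" using Jc by (intro fmeasurable_I) auto
    have "lm (?B w1 w2 \<inter> J) \<le> lm ?A + lm (?B w1 w2 \<inter> J - H)"
      using measure_Un_le[of ?A lborel "?B w1 w2 \<inter> J - H"] by (simp add: Un_commute Diff_Int_distrib2[symmetric] Un_Diff_Int)
    then have A: "lm (?B w1 w2 \<inter> J) \<le> lm ?A" using null by simp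
    have "?h ` ?A \<subseteq> ?B w1' w2'"
      by (rule Bad_expand(1)[OF Ab, where i = i]) (use R steps Bad_I in blast)+
    then have sub: "?h ` ?A \<subseteq> ?B w1' w2' \<inter> J'" unfolding J'_def by auto
    have "\<beta> * lm ?A = lm (?h ` ?A)" by (rule affine_image_lborel(3)[OF beta0 Ab, symmetric])
    also have "\<dots> \<le> lm (?B w1' w2' \<inter> J')"
      by (rule lm_mono[OF affine_image_lborel(1)[OF beta0 Ab] _ sub]) (use J'b J'c in auto)
    finally have ge: "\<beta> * lm (?B w1 w2 \<inter> J) \<le> lm (?B w1' w2' \<inter> J')"
      using order_trans[OF mult_left_mono[OF A, of \<beta>]] beta0 by (metis less_imp_le)
    have "(1 - e) * lm J' \<le> \<beta> * ((1 - e) * lm J)"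
      using lm_mono[OF JHb Jb _ Jc] beta0 e by (simp add: J'm mult_left_mono)
    also have "\<dots> \<le> \<beta> * lm (?B w1 w2 \<inter> J)" using Jd beta0 by simp
    finally have "(1 - e) * lm J' \<le> lm (?B w1' w2' \<inter> J')" using ge by simp
    moreover have "0 < lm (?B w1' w2' \<inter> J')" using ge pos beta0 by (meson less_le_trans mult_pos_pos)
    ultimately have "good w1' w2' J'" using J'i J'b J'c by (simp add: good_def)
    then show ?thesis using ge by blast
  qed
  have step: "\<exists>w1' w2' J'. good w1' w2' J' \<and> \<beta> * lm (?B w1 w2 \<inter> J) \<le> lm (?B w1' w2' \<inter> J')"
    if J: "good w1 w2 J" for w1 w2 J
  proof -
    have Ji: "is_interval J" and Jb[measurable]: "J \<in> sets borel" and Jc: "J \<subseteq> {0..c}"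
      and Jd: "(1 - e) * lm J \<le> lm (?B w1 w2 \<inter> J)" using J by (auto simp: good_def)
    have Bx: "x \<le> r \<beta> w1 \<and> c - x \<le> r \<beta> w2 \<and> x \<in> {0..c}" if "x \<in> ?B w1 w2" for x
      using that Bad_I[of "(False, w1)" "(True, w2)"] by (auto simp: Bad_def compat_def mirror_def)
    show ?thesis
    proof (cases "c / \<beta> < r \<beta> w1 \<or> c / \<beta> < r \<beta> w2")
      case False
      \<comment> \<open>If both ends are at most c / \<beta>, the common points of a piece and a
        mirrored piece lie in the switch region.\<close>
      have BS: "x \<in> ?Sw" if "x \<in> ?B w1 w2" for x using Bx[OF that] False c_div' by auto
      have "\<exists>J'. good (w1 @ [False]) (w2 @ [True]) J' \<and> \<beta> * lm (?B w1 w2 \<inter> J) \<le> lm (?B (w1 @ [False]) (w2 @ [True]) \<inter> J')"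
      proof (rule extend[OF J, where H = ?Sw and i = False and d = 0])
        show "is_interval ?Sw" by (simp add: is_interval_cc)
        have "?B w1 w2 \<inter> J - ?Sw = {}" using BS by blast
        then show "lm (?B w1 w2 \<inter> J - ?Sw) = 0" by (simp only: measure_empty)
        show "R_fibre \<beta> False x = \<beta> * x - 0" if "x \<in> ?Sw" "x \<in> {0..c}" for x using that by (simp add: R_fibre_eq)
        fix x assume x: "x \<in> ?Sw" "x \<in> ?B w1 w2"
        have "1 / \<beta> \<le> c - x" using x(1) c_div' by auto
        then show "step (False, w1) x False = (False, w1 @ [False]) \<and> step (True, w2) x False = (True, w2 @ [True])"
          using False Bx[OF x(2)] by (simp add: step_E step_bar stepE_def act1_def)
      qed simp
      then show ?thesis by blast
    next
      case True
      have nullS: "lm (?B w1 w2 \<inter> ?Sw) = 0" by (rule Bad_mixed_switch[OF True])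
      have "\<not> ?Sw \<subseteq> J"
      proof
        assume SJ: "?Sw \<subseteq> J"
        have "lm ?Sw \<le> lm (?Sw - ?B w1 w2) + lm (?B w1 w2 \<inter> ?Sw)"
        proof -
          have "?Sw = (?Sw - ?B w1 w2) \<union> (?B w1 w2 \<inter> ?Sw)" by blast
          then show ?thesis using measure_Un_le[of "?Sw - ?B w1 w2" lborel "?B w1 w2 \<inter> ?Sw"] by simp
        qed
        also have "\<dots> \<le> lm (J - ?B w1 w2)" using nullS SJ Jc lm_mono[of "?Sw - ?B w1 w2" "J - ?B w1 w2"] by auto
        also have "J - ?B w1 w2 = J - (?B w1 w2 \<inter> J)" by blast
        also have "lm \<dots> = lm J - lm (?B w1 w2 \<inter> J)"
          using fmeasurable_I[OF Jb Jc] by (intro measurable_measure_Diff) auto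
        also have "\<dots> \<le> e * lm J" using Jd by (simp add: algebra_simps)
        also have "\<dots> \<le> e * c" using lm_le_c[OF Jb Jc] e by simp
        finally show False using ec by simp
      qed
      \<comment> \<open>\<open>J\<close> lies on one side of \<open>p\<close>. Its bad points inside
        the switch region form a null set; the others are all in the right or all in the left
        region, where a single branch acts.\<close>
      then obtain p where p: "p \<in> ?Sw" "p \<notin> J" by blast
      have null: "lm (?B w1 w2 \<inter> J - H) = 0" if "?B w1 w2 \<inter> J - H \<subseteq> ?B w1 w2 \<inter> ?Sw" "H \<in> sets borel" for H
      proof -
        have "lm (?B w1 w2 \<inter> J - H) \<le> lm (?B w1 w2 \<inter> ?Sw)"
          by (rule lm_mono[OF _ _ that(1) le_infI1[OF Bad_I]]) (use that(2) in auto)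
        then show ?thesis by (simp only: nullS measure_le_0_iff)
      qed
      show ?thesis
      proof (cases "\<exists>x\<in>J. p < x")
        case True
        have gt: "p < x" if "x \<in> J" for x
        proof -
          obtain y where "y \<in> J" "p < y" using True by blast
          then show ?thesis using mem_is_interval_1_I[OF Ji that, of y p] p(2) by force
        qed
        have "\<exists>J'. good (w1 @ [False]) (if 1 / \<beta> \<le> r \<beta> w2 then [] else w2 @ [True]) J' \<and>
            \<beta> * lm (?B w1 w2 \<inter> J) \<le> lm (?B (w1 @ [False]) (if 1 / \<beta> \<le> r \<beta> w2 then [] else w2 @ [True]) \<inter> J')"
        proof (rule extend[OF J, where H = "{c / \<beta><..c}" and i = False and d = 1])
          show "is_interval {c / \<beta><..c}" by (simp add: is_interval_oc)
          show "lm (?B w1 w2 \<inter> J - {c / \<beta><..c}) = 0"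
          proof (rule null)
            show "?B w1 w2 \<inter> J - {c / \<beta><..c} \<subseteq> ?B w1 w2 \<inter> ?Sw" using gt p(1) Bx by force
          qed simp
          show "R_fibre \<beta> False x = \<beta> * x - 1" if "x \<in> {c / \<beta><..c}" "x \<in> {0..c}" for x
            unfolding R_fibre_eq[OF that(2)] using that c_div_less by auto
          fix x assume x: "x \<in> {c / \<beta><..c}" "x \<in> ?B w1 w2"
          have "c - x < 1 / \<beta>" "1 / \<beta> < x" using x(1) c_div' c_div_less by auto
          then show "step (False, w1) x False = (False, w1 @ [False]) \<and>
             step (True, w2) x False = (True, if 1 / \<beta> \<le> r \<beta> w2 then [] else w2 @ [True])"
            using Bx[OF x(2)] x(1) by (auto simp: step_E step_bar stepE_def act1_def)
        qed simp
        then show ?thesis by blast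
      next
        case False
        have lt: "x < p" if "x \<in> J" for x using False p(2) that by (metis linorder_neqE_linordered_idom)
        have "\<exists>J'. good (if 1 / \<beta> \<le> r \<beta> w1 then [] else w1 @ [True]) (w2 @ [False]) J' \<and>
            \<beta> * lm (?B w1 w2 \<inter> J) \<le> lm (?B (if 1 / \<beta> \<le> r \<beta> w1 then [] else w1 @ [True]) (w2 @ [False]) \<inter> J')"
        proof (rule extend[OF J, where H = "{0..<1 / \<beta>}" and i = True and d = 0])
          show "is_interval {0..<1 / \<beta>}" by (simp add: is_interval_co)
          show "lm (?B w1 w2 \<inter> J - {0..<1 / \<beta>}) = 0"
          proof (rule null)
            show "?B w1 w2 \<inter> J - {0..<1 / \<beta>} \<subseteq> ?B w1 w2 \<inter> ?Sw" using lt p(1) Bx by force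
          qed simp
          show "R_fibre \<beta> True x = \<beta> * x - 0" if "x \<in> {0..<1 / \<beta>}" "x \<in> {0..c}" for x
            using that by (simp add: R_fibre_eq)
          fix x assume x: "x \<in> {0..<1 / \<beta>}" "x \<in> ?B w1 w2"
          have "c / \<beta> < c - x" "1 / \<beta> < c - x" using x(1) c_div' c_div_less by auto
          then show "step (False, w1) x True = (False, if 1 / \<beta> \<le> r \<beta> w1 then [] else w1 @ [True]) \<and>
             step (True, w2) x True = (True, w2 @ [False])"
            using Bx[OF x(2)] x(1) by (auto simp: step_E step_bar stepE_def act1_def)
        qed simp
        then show ?thesis by blast
      qed
    qed
  qed
  have "0 < lm (?B w1 w2)" using neg by (simp add: zero_less_measure_iff)
  from density_interval[OF Bad_sets Bad_I this e] obtain J0 where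
    "is_interval J0" "J0 \<in> sets borel" "J0 \<subseteq> {0..c}" "0 < lm (?B w1 w2 \<inter> J0)" "(1 - e) * lm J0 \<le> lm (?B w1 w2 \<inter> J0)" .
  then have J0: "good w1 w2 J0" "0 < lm (?B w1 w2 \<inter> J0)" by (auto simp: good_def)
  have "\<exists>w1' w2' J. good w1' w2' J \<and> \<beta> ^ k * lm (?B w1 w2 \<inter> J0) \<le> lm (?B w1' w2' \<inter> J)" for k
  proof (induction k)
    case 0 then show ?case using J0 by auto
  next
    case (Suc k)
    then obtain w1' w2' J where J: "good w1' w2' J" "\<beta> ^ k * lm (?B w1 w2 \<inter> J0) \<le> lm (?B w1' w2' \<inter> J)" by blast
    obtain w1'' w2'' J' where J': "good w1'' w2'' J'" "\<beta> * lm (?B w1' w2' \<inter> J) \<le> lm (?B w1'' w2'' \<inter> J')" using step[OF J(1)] by blast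
    have "\<beta> ^ Suc k * lm (?B w1 w2 \<inter> J0) \<le> \<beta> * lm (?B w1' w2' \<inter> J)"
      using mult_left_mono[OF J(2), of \<beta>] beta0 by (simp add: mult.assoc)
    then show ?case using J' by (meson order_trans)
  qed
  moreover have "lm (?B w1' w2' \<inter> J) \<le> c" if "good w1' w2' J" for w1' w2' J
    using that by (intro lm_le_c) (auto simp: good_def)
  ultimately have "\<beta> ^ k * lm (?B w1 w2 \<inter> J0) \<le> c" for k by (meson order_trans)
  then have "lm (?B w1 w2 \<inter> J0) \<le> 0" by (rule power_growth_bounded)
  then show False using J0(2) by simp
qed

lemma Bad_null: "lm (Bad \<sigma> \<tau>) = 0"
proof -
  obtain b w b' w' where s: "\<sigma> = (b, w)" "\<tau> = (b', w')" by (cases \<sigma>, cases \<tau>)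
  show ?thesis unfolding s using Bad_E_E Bad_bar_bar Bad_mixed Bad_sym[of "(True, w)" "(False, w')"] by (cases b; cases b') auto
qed


section \<open>Stationarity of the states\<close>

lemma st_measurable[measurable]: "st \<in> K \<rightarrow>\<^sub>M count_space UNIV"
proof (rule measurable_count_space_eq_countable[THEN iffD2])
  \<comment> \<open>Outside \<open>G\<close> the definite description has one fixed default value,
    so \<open>st\<close> is constant there.\<close>
  have out: "st z = (THE \<sigma>. False)" if "z \<notin> G" for z
  proof -
    have "(\<lambda>\<sigma>. z \<in> ocell \<sigma>) = (\<lambda>\<sigma>. False)" using that by (auto simp: G_def)
    then show ?thesis by (simp add: st_def)
  qed
  show "st \<in> space K \<rightarrow> UNIV \<and> (\<forall>\<sigma>\<in>UNIV. st -` {\<sigma>} \<inter> space K \<in> sets K)"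
  proof (intro conjI ballI)
    fix \<sigma>
    have eq: "st -` {\<sigma>} \<inter> space K = ocell \<sigma> \<union> (if \<sigma> = (THE \<sigma>. False) then space K - G else {})"
    proof (intro set_eqI)
      fix z show "z \<in> st -` {\<sigma>} \<inter> space K \<longleftrightarrow> z \<in> ocell \<sigma> \<union> (if \<sigma> = (THE \<sigma>. False) then space K - G else {})"
      proof (cases "z \<in> G")
        case True
        then show ?thesis using ocell_st[OF True] st_ocell[of z \<sigma>] by auto
      next
        case False
        then have "z \<notin> ocell \<sigma>" unfolding G_def by blast
        then show ?thesis using out[OF False] False by auto
      qed
    qed
    have "space K - G \<in> sets K" using sets.compl_sets[OF G_sets] .
    then show "st -` {\<sigma>} \<inter> space K \<in> sets K" unfolding eq using ocell_sets[of \<sigma>] by auto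
  qed simp
qed simp

lemma ocell_cong: "(\<eta>, u) \<in> ocell \<sigma> \<longleftrightarrow> (\<eta>', u) \<in> ocell \<sigma>"
  by (cases u) (simp add: ocell_def flip_eq mem_cell)

lemma st_cong: "st (\<eta>, u) = st (\<eta>', u)"
  unfolding st_def using ocell_cong[of \<eta> u _ \<eta>'] by simp

lemma nn_integral_N1:
  assumes f: "f \<in> borel_measurable K"
  shows "(\<integral>\<^sup>+z. f z \<partial>N1) = \<kappa> * (\<integral>\<^sup>+z. f z * indicator (E \<beta> \<union> E_bar \<beta>) z \<partial>K)"
proof -
  have fN: "f \<in> borel_measurable N0" unfolding lambda_tilde_def by (rule measurable_restrict_space1[OF f])
  have "(\<integral>\<^sup>+z. f z \<partial>N1) = \<kappa> * (\<integral>\<^sup>+z. f z \<partial>N0)"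
    unfolding normalised_def \<kappa>_def by (rule nn_integral_scale_measure[OF fN])
  also have "(\<integral>\<^sup>+z. f z \<partial>N0) = (\<integral>\<^sup>+z. f z * indicator (E \<beta> \<union> E_bar \<beta>) z \<partial>K)"
    unfolding lambda_tilde_def using space_sets by (intro nn_integral_restrict_space) simp
  finally show ?thesis .
qed

text \<open>The stream is independent of the other two coordinates, so it may be replaced by a fresh
  random one.\<close>

lemma nn_integral_N1_average:
  assumes f[measurable]: "f \<in> borel_measurable K"
  shows "(\<integral>\<^sup>+z. f z \<partial>N1) = (\<integral>\<^sup>+z. (\<integral>\<^sup>+\<eta>. f (\<eta>, snd z) \<partial>bernoulli_measure) \<partial>N1)"
proof -
  note space_sets[measurable]
  let ?U = "E \<beta> \<union> E_bar \<beta>"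
  have fm: "(\<lambda>z. \<integral>\<^sup>+\<eta>. f (\<eta>, snd z) \<partial>bernoulli_measure) \<in> borel_measurable K" by measurable
  have in_avg: "(\<integral>\<^sup>+\<eta>. f (\<eta>, u) * indicator ?U (\<eta>, u) \<partial>bernoulli_measure) =
     (\<integral>\<^sup>+\<eta>. (\<integral>\<^sup>+\<eta>'. f (\<eta>', u) \<partial>bernoulli_measure) * indicator ?U (\<eta>, u) \<partial>bernoulli_measure)" for u
  proof -
    have ind: "indicator ?U (\<eta>, u) = (indicator ?U (sconst True, u) :: ennreal)" for \<eta>
      using space_cong[of \<eta> u "sconst True"] by (simp add: indicator_def)
    have [measurable]: "(\<lambda>\<eta>. f (\<eta>, u)) \<in> borel_measurable bernoulli_measure"
      by (rule measurable_compose[OF _ f]) (rule measurable_Pair2', simp add: space_pair_measure)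
    have "(\<integral>\<^sup>+\<eta>. f (\<eta>, u) * indicator ?U (sconst True, u) \<partial>bernoulli_measure) =
       (\<integral>\<^sup>+\<eta>. f (\<eta>, u) \<partial>bernoulli_measure) * indicator ?U (sconst True, u)"
      by (rule nn_integral_multc) measurable
    moreover have "(\<integral>\<^sup>+\<eta>. g \<eta> * indicator ?U (\<eta>, u) \<partial>bernoulli_measure) = (\<integral>\<^sup>+\<eta>. g \<eta> * indicator ?U (sconst True, u) \<partial>bernoulli_measure)" for g
      by (intro nn_integral_cong arg_cong2[of _ _ _ _ "(*)"] refl ind)
    ultimately show ?thesis using bernoulli.emeasure_space_1 by simp
  qed
  have "(\<integral>\<^sup>+z. f z \<partial>N1) = \<kappa> * (\<integral>\<^sup>+x. \<integral>\<^sup>+y. \<integral>\<^sup>+\<eta>. f (\<eta>, x, y) * indicator ?U (\<eta>, x, y) \<partial>bernoulli_measure \<partial>lborel \<partial>lborel)"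
    unfolding nn_integral_N1[OF f] by (subst nn_integral_K) auto
  also have "\<dots> = \<kappa> * (\<integral>\<^sup>+z. (\<integral>\<^sup>+\<eta>. f (\<eta>, snd z) \<partial>bernoulli_measure) * indicator ?U z \<partial>K)"
    unfolding in_avg by (subst nn_integral_K) auto
  also have "\<dots> = (\<integral>\<^sup>+z. (\<integral>\<^sup>+\<eta>. f (\<eta>, snd z) \<partial>bernoulli_measure) \<partial>N1)"
    by (rule nn_integral_N1[OF fm, symmetric])
  finally show ?thesis .
qed

text \<open>The probability that \<open>D\<close> holds for the state reached after \<open>n\<close> random digits.\<close>

primrec visit :: "nat \<Rightarrow> (real \<Rightarrow> bool \<times> bool list \<Rightarrow> bool) \<Rightarrow> real \<Rightarrow> bool \<times> bool list \<Rightarrow> real" where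
  "visit 0 D x \<sigma> = of_bool (D x \<sigma>)"
| "visit (Suc n) D x \<sigma> = (visit n D (R_fibre \<beta> False x) (step \<sigma> x False) + visit n D (R_fibre \<beta> True x) (step \<sigma> x True)) / 2"

lemma visit_bounds: "0 \<le> visit n D x \<sigma>" "visit n D x \<sigma> \<le> 1"
proof -
  have "0 \<le> visit n D x \<sigma> \<and> visit n D x \<sigma> \<le> 1"
  proof (induction n arbitrary: x \<sigma>)
    case (Suc n)
    have "0 \<le> (a + b) / 2 \<and> (a + b) / 2 \<le> 1" if "0 \<le> a \<and> a \<le> 1" "0 \<le> b \<and> b \<le> 1" for a b :: real using that by simp
    from this[OF Suc.IH Suc.IH] show ?case unfolding visit.simps .
  qed simp
  then show "0 \<le> visit n D x \<sigma>" "visit n D x \<sigma> \<le> 1" by auto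
qed

lemma visit_measurable:
  assumes D: "\<And>\<sigma>. Measurable.pred borel (\<lambda>x. D x \<sigma>)"
  shows "(\<lambda>x. visit n D x \<sigma>) \<in> borel_measurable borel"
proof (induction n arbitrary: \<sigma>)
  case 0
  have [measurable]: "Measurable.pred borel (\<lambda>x. D x \<sigma>)" by (rule D)
  show ?case by (simp add: of_bool_def)
next
  case (Suc n)
  have 1: "(\<lambda>x. visit n D (R_fibre \<beta> i x) s) \<in> borel_measurable borel" for i s
    using measurable_compose[OF R_fibre_measurable Suc] .
  have "(\<lambda>x. visit n D (R_fibre \<beta> i x) (step \<sigma> x i)) \<in> borel_measurable borel" for i
    by (rule measurable_compose_countable[where f = "\<lambda>s x. visit n D (R_fibre \<beta> i x) s", OF 1 step_measurable])
  then show ?case by simp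
qed

text \<open>At time \<open>t\<close> the states agree, or one of them satisfies \<open>D\<close>, or
  neither does and they merge within \<open>M\<close> further digits with probability at least
  \<gamma>.\<close>

lemma apart_contract:
  assumes \<gamma>: "0 \<le> \<gamma>" "\<gamma> \<le> 1"
    and D: "\<And>x \<sigma> \<tau>. x \<in> compat \<sigma> \<Longrightarrow> x \<in> compat \<tau> \<Longrightarrow> \<sigma> \<noteq> \<tau> \<Longrightarrow> \<not> D x \<sigma> \<Longrightarrow> \<not> D x \<tau> \<Longrightarrow> apart M x \<sigma> \<tau> \<le> 1 - \<gamma>"
  shows "x \<in> compat \<sigma> \<Longrightarrow> x \<in> compat \<tau> \<Longrightarrow>
    apart (t + M) x \<sigma> \<tau> \<le> (1 - \<gamma>) * apart t x \<sigma> \<tau> + \<gamma> * (visit t D x \<sigma> + visit t D x \<tau>)"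
proof (induction t arbitrary: x \<sigma> \<tau>)
  case 0
  show ?case
  proof (cases "\<sigma> = \<tau>")
    case True then show ?thesis using \<gamma> by (simp add: apart_refl)
  next
    case False
    show ?thesis
    proof (cases "D x \<sigma> \<or> D x \<tau>")
      case True
      have "apart M x \<sigma> \<tau> \<le> 1" by (rule apart_bounds)
      then show ?thesis using True False \<gamma> by auto
    next
      case False
      then show ?thesis using D[of x \<sigma> \<tau>] 0 \<open>\<sigma> \<noteq> \<tau>\<close> by simp
    qed
  qed
next
  case (Suc t)
  have "apart (t + M) (R_fibre \<beta> i x) (step \<sigma> x i) (step \<tau> x i) \<le>
     (1 - \<gamma>) * apart t (R_fibre \<beta> i x) (step \<sigma> x i) (step \<tau> x i) +
     \<gamma> * (visit t D (R_fibre \<beta> i x) (step \<sigma> x i) + visit t D (R_fibre \<beta> i x) (step \<tau> x i))" for i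
    by (rule Suc.IH; rule compat_step; rule Suc.prems)
  from add_mono[OF this[of False] this[of True]] show ?case
    by (simp add: field_simps)
qed

text \<open>The map preserves the measure, and the digits not yet read are independent of the state
  and of x; hence the law of both is the same at every time.\<close>

lemma nn_integral_visit:
  assumes D: "\<And>\<sigma>. Measurable.pred borel (\<lambda>x. D x \<sigma>)"
  shows "(\<integral>\<^sup>+z. ennreal (visit t D (fst (snd z)) (st z)) \<partial>N1) = (\<integral>\<^sup>+z. ennreal (of_bool (D (fst (snd z)) (st z))) \<partial>N1)"
proof (induction t)
  case (Suc t)
  note S_N1(3)[measurable]
  have 1: "(\<lambda>z. ennreal (visit t D (f z) (g z))) \<in> borel_measurable K"
    if f: "f \<in> borel_measurable K" and g: "g \<in> K \<rightarrow>\<^sub>M count_space UNIV" for f and g :: "bool stream \<times> real \<times> real \<Rightarrow> bool \<times> bool list"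
  proof -
    have "(\<lambda>z. visit t D (f z) s) \<in> borel_measurable K" for s
      using measurable_compose[OF f visit_measurable[OF D]] .
    then have "(\<lambda>z. visit t D (f z) (g z)) \<in> borel_measurable K"
      by (rule measurable_compose_countable[where f = "\<lambda>s z. visit t D (f z) s", OF _ g])
    then show ?thesis by simp
  qed
  have xm: "(\<lambda>z. fst (snd z)) \<in> borel_measurable K" by measurable
  let ?g = "\<lambda>z. ennreal (visit t D (fst (snd z)) (st z))"
  let ?h = "\<lambda>i z. ennreal (visit t D (R_fibre \<beta> i (fst (snd z))) (step (st z) (fst (snd z)) i))"
  have gm: "?g \<in> borel_measurable K" by (rule 1[OF xm st_measurable])
  have "(\<lambda>z. step s (fst (snd z)) i) \<in> K \<rightarrow>\<^sub>M count_space UNIV" for s i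
    using measurable_compose[OF xm step_measurable] .
  then have sm: "(\<lambda>z. step (st z) (fst (snd z)) i) \<in> K \<rightarrow>\<^sub>M count_space UNIV" for i
    by (rule measurable_compose_countable[where f = "\<lambda>s z. step s (fst (snd z)) i", OF _ st_measurable])
  have hm[measurable]: "?h i \<in> borel_measurable K" for i
    by (rule 1[OF measurable_compose[OF xm R_fibre_measurable] sm])
  have shm: "(\<lambda>z. shd (fst z)) \<in> K \<rightarrow>\<^sub>M count_space UNIV" by measurable
  have hs: "(\<lambda>z. ?h (shd (fst z)) z) \<in> borel_measurable K"
    by (rule measurable_compose_countable[where f = ?h, OF hm shm])
  have "(\<integral>\<^sup>+z. ?g z \<partial>N1) = (\<integral>\<^sup>+z. ?g z \<partial>distr N1 N1 S)" by (simp only: S_N1(1))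
  also have "\<dots> = (\<integral>\<^sup>+z. ?g (S z) \<partial>N1)" by (rule nn_integral_distr) (use measurable_N1[OF gm] in simp_all)
  also have "\<dots> = (\<integral>\<^sup>+z. ?h (shd (fst z)) z \<partial>N1)"
  proof (rule nn_integral_cong_AE, use AE_G in eventually_elim)
    fix z assume "z \<in> G"
    then have "(fst z, fst (snd z), snd (snd z)) \<in> ocell (st z)" using ocell_st by simp
    from S_ocell[OF this] show "?g (S z) = ?h (shd (fst z)) z" using st_ocell by simp
  qed
  also have "\<dots> = (\<integral>\<^sup>+z. (\<integral>\<^sup>+\<eta>. ?h (shd \<eta>) (\<eta>, snd z) \<partial>bernoulli_measure) \<partial>N1)"
    by (subst nn_integral_N1_average[OF hs]) simp
  also have "\<dots> = (\<integral>\<^sup>+z. ennreal (visit (Suc t) D (fst (snd z)) (st z)) \<partial>N1)"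
  proof (rule nn_integral_cong)
    fix z
    have "(\<lambda>\<eta>. ?h (shd \<eta>) (\<eta>, snd z)) = (\<lambda>\<eta>. ?h (shd \<eta>) z)"
      using st_cong[of _ "snd z" "fst z"] by simp
    moreover have "(\<lambda>\<eta>. ?h (shd \<eta>) z) \<in> borel_measurable bernoulli_measure"
      by (rule measurable_compose_countable[where f = "\<lambda>i _. ?h i z"]) measurable
    ultimately have "(\<integral>\<^sup>+\<eta>. ?h (shd \<eta>) (\<eta>, snd z) \<partial>bernoulli_measure) = ennreal (1/2) * ?h True z + ennreal (1/2) * ?h False z"
      using nn_integral_bernoulli[of "\<lambda>\<eta>. ?h (shd \<eta>) z"] bernoulli.emeasure_space_1 by simp
    also have "\<dots> = ennreal (visit (Suc t) D (fst (snd z)) (st z))"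
      using visit_bounds(1) by (simp add: ennreal_mult'[symmetric] ennreal_plus[symmetric] field_simps del: ennreal_plus ennreal_half)
    finally show "(\<integral>\<^sup>+\<eta>. ?h (shd \<eta>) (\<eta>, snd z) \<partial>bernoulli_measure) = ennreal (visit (Suc t) D (fst (snd z)) (st z))" .
  qed
  finally show ?case using Suc by simp
qed simp

text \<open>A cell is the product of the streams, \<open>compat \<sigma>\<close> and an interval of
  length \<open>height (snd \<sigma>)\<close>. So an integral over \<open>compat \<sigma>\<close>
  for a fixed starting state is a part of the stationary integral, up to a constant factor.\<close>

lemma nn_integral_visit_compat:
  assumes D: "\<And>\<sigma>. Measurable.pred borel (\<lambda>x. D x \<sigma>)"
  shows "\<kappa> * ennreal (height (snd \<sigma>)) * (\<integral>\<^sup>+x. ennreal (visit t D x \<sigma>) * indicator (compat \<sigma>) x \<partial>lborel)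
    \<le> (\<integral>\<^sup>+z. ennreal (of_bool (D (fst (snd z)) (st z))) \<partial>N1)"
proof -
  let ?d = "\<lambda>x. ennreal (visit t D x \<sigma>)"
  have [measurable]: "(\<lambda>x. visit t D x \<sigma>) \<in> borel_measurable borel" by (rule visit_measurable[OF D])
  note ocell_sets[measurable]
  have f[measurable]: "(\<lambda>z. ?d (fst (snd z)) * indicator (ocell \<sigma>) z) \<in> borel_measurable K" by measurable
  have inner: "(\<integral>\<^sup>+y. \<integral>\<^sup>+\<eta>. ?d x * indicator (ocell \<sigma>) (\<eta>, x, y) \<partial>bernoulli_measure \<partial>lborel) =
      ennreal (height (snd \<sigma>)) * (?d x * indicator (compat \<sigma>) x)" for x
  proof -
    define I where "I = (if fst \<sigma> then {- (v \<beta> (snd \<sigma>) + height (snd \<sigma>)) <..< - v \<beta> (snd \<sigma>)} else {v \<beta> (snd \<sigma>) <..< v \<beta> (snd \<sigma>) + height (snd \<sigma>)})"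
    have I: "emeasure lborel I = ennreal (height (snd \<sigma>))" "I \<in> sets borel" using height_pos[of "snd \<sigma>"] by (auto simp: I_def)
    have "indicator (ocell \<sigma>) (\<eta>, x, y) = (indicator (compat \<sigma>) x * indicator I y :: ennreal)" for \<eta> y
      by (auto simp: indicator_def ocell_def flip_eq mem_cell compat_def I_def)
    then have "(\<integral>\<^sup>+y. \<integral>\<^sup>+\<eta>. ?d x * indicator (ocell \<sigma>) (\<eta>, x, y) \<partial>bernoulli_measure \<partial>lborel) =
        (\<integral>\<^sup>+y. (?d x * indicator (compat \<sigma>) x) * indicator I y \<partial>lborel)"
      using bernoulli.emeasure_space_1 by (simp add: mult.assoc)
    also have "\<dots> = (?d x * indicator (compat \<sigma>) x) * ennreal (height (snd \<sigma>))"
      using I by (simp add: nn_integral_cmult_indicator)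
    finally show ?thesis by (simp add: mult.commute)
  qed
  have "\<kappa> * ennreal (height (snd \<sigma>)) * (\<integral>\<^sup>+x. ?d x * indicator (compat \<sigma>) x \<partial>lborel) =
     \<kappa> * (\<integral>\<^sup>+x. ennreal (height (snd \<sigma>)) * (?d x * indicator (compat \<sigma>) x) \<partial>lborel)"
    by (subst nn_integral_cmult) (auto simp: mult.assoc)
  also have "\<dots> = \<kappa> * (\<integral>\<^sup>+z. ?d (fst (snd z)) * indicator (ocell \<sigma>) z \<partial>K)"
    by (subst nn_integral_K[OF f]) (simp add: inner)
  also have "\<dots> = \<kappa> * (\<integral>\<^sup>+z. ?d (fst (snd z)) * indicator (ocell \<sigma>) z * indicator (E \<beta> \<union> E_bar \<beta>) z \<partial>K)"
  proof -
    have "ocell \<sigma> \<subseteq> E \<beta> \<union> E_bar \<beta>" using G_subset by (auto simp: G_def)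
    then have "?d (fst (snd z)) * indicator (ocell \<sigma>) z = ?d (fst (snd z)) * indicator (ocell \<sigma>) z * indicator (E \<beta> \<union> E_bar \<beta>) z" for z
      by (auto simp: indicator_def)
    then show ?thesis by simp
  qed
  also have "\<dots> = (\<integral>\<^sup>+z. ?d (fst (snd z)) * indicator (ocell \<sigma>) z \<partial>N1)" by (rule nn_integral_N1[OF f, symmetric])
  also have "\<dots> \<le> (\<integral>\<^sup>+z. ennreal (visit t D (fst (snd z)) (st z)) \<partial>N1)"
    by (rule nn_integral_mono) (auto simp: indicator_def st_ocell)
  finally show ?thesis unfolding nn_integral_visit[OF D] .
qed


section \<open>Merging with probability one\<close>

lemma integrable_bounded_I:
  fixes f :: "real \<Rightarrow> real"
  assumes [measurable]: "f \<in> borel_measurable borel" and b: "\<And>x. \<bar>f x\<bar> \<le> b" and C[measurable]: "C \<in> sets borel" and CI: "C \<subseteq> {0..c}"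
  shows "integrable lborel (\<lambda>x. indicator C x * f x)"
proof -
  have "emeasure lborel C < \<infinity>" using fmeasurable_I[OF C CI] by (simp add: fmeasurable_def)
  then have "integrable lborel (\<lambda>x. indicator C x *\<^sub>R f x)"
    by (intro integrableI_bounded_set_indicator[where B = b]) (auto simp: b)
  then show ?thesis by simp
qed

lemma AE_lborel_N1:
  assumes "AE x in lborel. A x" shows "AE z in N1. A (fst (snd z))"
proof -
  have "AE x in restrict_space lborel {0..c}. A x" using assms by (subst AE_restrict_space_iff) (auto elim: eventually_mono)
  then have "AE x in \<nu>. A x"
    using absolutely_continuous_AE[OF _ \<nu>_absolutely_continuous] by (simp add: sets_\<nu> sets_restrict_space)
  then show ?thesis unfolding \<nu>_def by (rule AE_distrD[OF x_measurable])
qed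

text \<open>Finitely many states carry all but e / 2 of the mass. For each pair of them the points
  where no word of \<open>M\<close> digits merges the pair decrease to a null set of bad points as
  \<open>M\<close> grows, so one \<open>M\<close> serves all these pairs.\<close>

lemma small_exception:
  assumes e: "0 < e"
  obtains D M where "\<And>\<sigma>. Measurable.pred borel (\<lambda>x. D x \<sigma>)"
    and "\<And>x \<sigma> \<tau>. x \<in> compat \<sigma> \<Longrightarrow> x \<in> compat \<tau> \<Longrightarrow> \<sigma> \<noteq> \<tau> \<Longrightarrow> \<not> D x \<sigma> \<Longrightarrow> \<not> D x \<tau> \<Longrightarrow> apart M x \<sigma> \<tau> \<le> 1 - (1/2) ^ M"
    and "(\<integral>\<^sup>+z. ennreal (of_bool (D (fst (snd z)) (st z))) \<partial>N1) \<le> ennreal e"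
proof -
  interpret N1: prob_space N1 by (rule prob_space_N1)
  interpret n: prob_space \<nu> by (rule prob_space_\<nu>)
  have st1[measurable]: "st \<in> N1 \<rightarrow>\<^sub>M count_space UNIV" by (rule measurable_N1) measurable
  define Fs where "Fs k = {\<sigma> :: bool \<times> bool list. to_nat \<sigma> < k}" for k
  have Fsfin: "finite (Fs k)" for k
    using finite_imageD[of to_nat "Fs k"] finite_subset[of "to_nat ` Fs k" "{..<k}"] by (force simp: Fs_def)
  define A where "A k = {z \<in> space N1. st z \<notin> Fs k}" for k
  have Am[measurable]: "A k \<in> sets N1" for k unfolding A_def by measurable
  have "(\<lambda>k. measure N1 (A k)) \<longlonglongrightarrow> measure N1 (\<Inter>k. A k)"
    by (rule N1.finite_Lim_measure_decseq) (auto simp: A_def Fs_def decseq_def)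
  moreover have "(\<Inter>k. A k) = {}" unfolding A_def Fs_def by (auto intro!: exI[of _ "Suc (to_nat _)"])
  ultimately have "(\<lambda>k. measure N1 (A k)) \<longlonglongrightarrow> 0" by simp
  then have "eventually (\<lambda>k. measure N1 (A k) < e / 2) sequentially" using e by (intro order_tendstoD(2)) auto
  then obtain k where k: "measure N1 (A k) < e / 2" by (auto simp: eventually_sequentially)
  define B where "B p M = {x \<in> compat (fst p) \<inter> compat (snd p). apart M x (fst p) (snd p) = 1}" for p M
  have Bm[measurable]: "B p M \<in> sets borel" for p M
  proof -
    have "B p M = {x \<in> space borel. x \<in> compat (fst p) \<and> x \<in> compat (snd p) \<and> apart M x (fst p) (snd p) = 1}" by (auto simp: B_def)
    also have "\<dots> \<in> sets borel" by measurable
    finally show ?thesis .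
  qed
  have Bc: "B p M \<subseteq> {0..c}" for p M using compat_I[of "fst p"] by (auto simp: B_def)
  have B\<nu>: "B p M \<in> sets \<nu>" for p M using Bm Bc by (simp add: sets_\<nu> sets_restrict_space_iff)
  have lim: "(\<lambda>M. measure \<nu> (B p M)) \<longlonglongrightarrow> 0" for p
  proof -
    have "(\<lambda>M. measure \<nu> (B p M)) \<longlonglongrightarrow> measure \<nu> (\<Inter>M. B p M)"
    proof (rule n.finite_Lim_measure_decseq)
      show "decseq (B p)"
        unfolding decseq_def
      proof (intro allI impI subsetI)
        fix m n x assume "m \<le> n" "x \<in> B p n"
        then show "x \<in> B p m" using apart_antimono[of m n x "fst p" "snd p"] apart_bounds(2)[of m x "fst p" "snd p"] by (auto simp: B_def)
      qed
    qed (use B\<nu> in blast)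
    also have "(\<Inter>M. B p M) = Bad (fst p) (snd p)" by (auto simp: B_def Bad_def)
    also have "measure \<nu> (Bad (fst p) (snd p)) = 0"
    proof -
      have "emeasure lborel (Bad (fst p) (snd p)) = 0"
        using Bad_null[of "fst p" "snd p"] fmeasurable_I[OF Bad_sets Bad_I, of "fst p" "snd p"]
        by (simp add: emeasure_eq_measure2)
      then have "Bad (fst p) (snd p) \<in> null_sets (restrict_space lborel {0..c})"
        using Bad_I[of "fst p" "snd p"] by (subst null_sets_restrict_space) (auto simp: null_sets_def)
      then have "Bad (fst p) (snd p) \<in> null_sets \<nu>" using \<nu>_absolutely_continuous by (auto simp: absolutely_continuous_def)
      then show ?thesis by (simp add: null_sets_def measure_def)
    qed
    finally show ?thesis .
  qed
  have "(\<lambda>M. \<Sum>p\<in>Fs k \<times> Fs k. measure \<nu> (B p M)) \<longlonglongrightarrow> (\<Sum>p\<in>Fs k \<times> Fs k. 0)"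
    by (intro tendsto_sum lim)
  then have "eventually (\<lambda>M. (\<Sum>p\<in>Fs k \<times> Fs k. measure \<nu> (B p M)) < e / 2) sequentially"
    using e by (intro order_tendstoD(2)) auto
  then obtain M where M: "(\<Sum>p\<in>Fs k \<times> Fs k. measure \<nu> (B p M)) < e / 2" by (auto simp: eventually_sequentially)
  define U where "U = (\<Union>p\<in>Fs k \<times> Fs k - Id. B p M)"
  have Um[measurable]: "U \<in> sets borel" unfolding U_def using Fsfin[of k] by (intro sets.finite_UN) auto
  have U\<nu>: "U \<in> sets \<nu>" unfolding U_def using Fsfin[of k] B\<nu> by (intro sets.finite_UN) auto
  have "measure \<nu> U \<le> (\<Sum>p\<in>Fs k \<times> Fs k - Id. measure \<nu> (B p M))"
    unfolding U_def using Fsfin[of k] B\<nu> by (intro n.finite_measure_subadditive_finite) auto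
  also have "\<dots> \<le> (\<Sum>p\<in>Fs k \<times> Fs k. measure \<nu> (B p M))" using Fsfin[of k] by (intro sum_mono2) auto
  finally have U: "measure \<nu> U < e / 2" using M by simp
  define D where "D x \<sigma> \<longleftrightarrow> \<sigma> \<notin> Fs k \<or> x \<in> U" for x \<sigma>
  show thesis
  proof (rule that[of D M])
    show "Measurable.pred borel (\<lambda>x. D x \<sigma>)" for \<sigma> unfolding D_def by measurable
    fix x \<sigma> \<tau> assume x: "x \<in> compat \<sigma>" "x \<in> compat \<tau>" "\<sigma> \<noteq> \<tau>" "\<not> D x \<sigma>" "\<not> D x \<tau>"
    then have "(\<sigma>, \<tau>) \<in> Fs k \<times> Fs k - Id" "x \<notin> U" by (auto simp: D_def)
    then have "x \<notin> B (\<sigma>, \<tau>) M" unfolding U_def by blast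
    then have "apart M x \<sigma> \<tau> \<noteq> 1" using x by (simp add: B_def)
    then have "apart M x \<sigma> \<tau> < 1" using apart_bounds(2)[of M x \<sigma> \<tau>] by simp
    then show "apart M x \<sigma> \<tau> \<le> 1 - (1/2) ^ M" by (rule apart_gap)
  next
    let ?X = "(\<lambda>z. fst (snd z)) -` U \<inter> space N1"
    have Xm: "?X \<in> sets N1" using measurable_sets[OF x_measurable, of U] U\<nu> by (simp add: sets_\<nu>)
    have XU: "emeasure N1 ?X = emeasure \<nu> U"
      unfolding \<nu>_def using U\<nu> by (intro emeasure_distr[symmetric] x_measurable) (simp add: sets_\<nu>)
    have "(\<integral>\<^sup>+z. ennreal (of_bool (D (fst (snd z)) (st z))) \<partial>N1) \<le> (\<integral>\<^sup>+z. indicator (A k) z + indicator ?X z \<partial>N1)"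
      by (intro nn_integral_mono) (auto simp: A_def D_def indicator_def)
    also have "\<dots> = emeasure N1 (A k) + emeasure N1 ?X" using Xm by (subst nn_integral_add) auto
    also have "\<dots> \<le> ennreal (e / 2) + ennreal (e / 2)"
      unfolding XU using k U by (intro add_mono) (auto simp: N1.emeasure_eq_measure n.emeasure_eq_measure intro!: ennreal_leI)
    also have "\<dots> = ennreal e" using e by (simp add: ennreal_plus[symmetric] del: ennreal_plus)
    finally show "(\<integral>\<^sup>+z. ennreal (of_bool (D (fst (snd z)) (st z))) \<partial>N1) \<le> ennreal e" .
  qed
qed

text \<open>
  Outside a set \<open>D\<close> of measure \<open>e\<close> two states merge within \<open>M\<close> digits with probability at least
  \<open>\<gamma> = (1/2) ^ M\<close>. By invariance \<open>D\<close> is visited with probability \<open>O(e)\<close> at every time, uniformly in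
  \<open>M\<close>, so the limit \<open>L\<close> satisfies \<open>L \<le> (1 - \<gamma>) L + \<gamma> O(e)\<close>.
\<close>

lemma apart_integral_tendsto_0:
  "(\<lambda>t. \<integral>x. indicator (compat \<sigma> \<inter> compat \<tau>) x * apart t x \<sigma> \<tau> \<partial>lborel) \<longlonglongrightarrow> 0"
proof -
  let ?C = "compat \<sigma> \<inter> compat \<tau>"
  define f where "f t = (\<integral>x. indicator ?C x * apart t x \<sigma> \<tau> \<partial>lborel)" for t
  have C: "?C \<in> sets borel" "?C \<subseteq> {0..c}" using compat_I[of \<sigma>] by auto
  have int: "integrable lborel (\<lambda>x. indicator ?C x * apart t x \<sigma> \<tau>)" for t
    by (rule integrable_bounded_I[where b = 1, OF _ _ C]) (use apart_bounds in auto)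
  have dec: "f n \<le> f m" if "m \<le> n" for m n
    unfolding f_def by (intro integral_mono int mult_left_mono apart_antimono[OF that]) simp
  have nonneg: "0 \<le> f t" for t unfolding f_def by (intro integral_nonneg_AE) (auto simp: apart_bounds)
  have "decseq f" "\<forall>t. 0 \<le> f t" using dec nonneg by (auto simp: decseq_def)
  then obtain L where L: "f \<longlonglongrightarrow> L" using decseq_convergent by metis
  obtain q where q: "\<kappa> = ennreal q" "0 < q"
    using \<kappa>_finite \<kappa>_pos by (cases \<kappa>) (auto simp: less_le)
  \<comment> \<open>\<open>a \<rho>\<close> converts mass in the tower into Lebesgue measure on
    \<open>compat \<rho>\<close>: it inverts the normalising constant times the height of the
    cell.\<close>
  define a where "a \<rho> = 1 / (q * height (snd \<rho>))" for \<rho> :: "bool \<times> bool list"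
  have L_le: "L \<le> e * (a \<sigma> + a \<tau>)" if e: "0 < e" for e
  proof -
    obtain D M where D: "\<And>\<sigma>. Measurable.pred borel (\<lambda>x. D x \<sigma>)"
      and contr: "\<And>x \<sigma> \<tau>. x \<in> compat \<sigma> \<Longrightarrow> x \<in> compat \<tau> \<Longrightarrow> \<sigma> \<noteq> \<tau> \<Longrightarrow> \<not> D x \<sigma> \<Longrightarrow> \<not> D x \<tau> \<Longrightarrow> apart M x \<sigma> \<tau> \<le> 1 - (1/2) ^ M"
      and small: "(\<integral>\<^sup>+z. ennreal (of_bool (D (fst (snd z)) (st z))) \<partial>N1) \<le> ennreal e"
      using small_exception[OF e] by blast
    define \<gamma> :: real where "\<gamma> = (1/2) ^ M"
    have \<gamma>: "0 < \<gamma>" "\<gamma> \<le> 1" by (auto simp: \<gamma>_def power_le_one)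
    have intd: "integrable lborel (\<lambda>x. indicator C x * visit t D x \<rho>)" if "C \<in> sets borel" "C \<subseteq> {0..c}" for C t \<rho>
      by (rule integrable_bounded_I[where b = 1, OF visit_measurable[OF D] _ that]) (use visit_bounds in auto)
    have I: "(\<integral>x. indicator (compat \<rho>) x * visit t D x \<rho> \<partial>lborel) \<le> e * a \<rho>" for \<rho> t
    proof -
      let ?I = "\<integral>x. indicator (compat \<rho>) x * visit t D x \<rho> \<partial>lborel"
      have nn: "(\<integral>\<^sup>+x. ennreal (visit t D x \<rho>) * indicator (compat \<rho>) x \<partial>lborel) = ennreal ?I"
        using nn_integral_eq_integral[OF intd[OF compat_sets compat_I, of \<rho> t \<rho>]] visit_bounds(1)
        by (simp add: ennreal_mult' ennreal_indicator[symmetric] mult.commute)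
      have "\<kappa> * ennreal (height (snd \<rho>)) * ennreal ?I \<le> ennreal e"
        using order_trans[OF nn_integral_visit_compat[OF D, of \<rho> t] small] by (simp only: nn)
      then have "q * height (snd \<rho>) * ?I \<le> e"
        using q e height_pos[of "snd \<rho>"] by (simp add: ennreal_mult'[symmetric] ennreal_le_iff)
      then show ?thesis using q height_pos[of "snd \<rho>"] by (simp add: a_def field_simps)
    qed
    have "f (t + M) \<le> (1 - \<gamma>) * f t + \<gamma> * (e * a \<sigma> + e * a \<tau>)" for t
    proof -
      have "f (t + M) \<le> (\<integral>x. (1 - \<gamma>) * (indicator ?C x * apart t x \<sigma> \<tau>) +
          \<gamma> * (indicator (compat \<sigma>) x * visit t D x \<sigma> + indicator (compat \<tau>) x * visit t D x \<tau>) \<partial>lborel)"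
        unfolding f_def
      proof (rule integral_mono[OF int])
        show "integrable lborel (\<lambda>x. (1 - \<gamma>) * (indicator ?C x * apart t x \<sigma> \<tau>) +
          \<gamma> * (indicator (compat \<sigma>) x * visit t D x \<sigma> + indicator (compat \<tau>) x * visit t D x \<tau>))"
          using int intd[OF compat_sets compat_I] by (intro Bochner_Integration.integrable_add integrable_mult_right) auto
        fix x
        show "indicator ?C x * apart (t + M) x \<sigma> \<tau> \<le> (1 - \<gamma>) * (indicator ?C x * apart t x \<sigma> \<tau>) +
          \<gamma> * (indicator (compat \<sigma>) x * visit t D x \<sigma> + indicator (compat \<tau>) x * visit t D x \<tau>)"
        proof (cases "x \<in> ?C")
          case True
          have "apart (t + M) x \<sigma> \<tau> \<le> (1 - \<gamma>) * apart t x \<sigma> \<tau> + \<gamma> * (visit t D x \<sigma> + visit t D x \<tau>)"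
            by (rule apart_contract) (use \<gamma> contr True in \<open>auto simp: \<gamma>_def\<close>)
          then show ?thesis using True by simp
        next
          case False
          then show ?thesis using visit_bounds(1) \<gamma> by (auto simp: indicator_def)
        qed
      qed
      also have "\<dots> = (1 - \<gamma>) * f t + \<gamma> * ((\<integral>x. indicator (compat \<sigma>) x * visit t D x \<sigma> \<partial>lborel) + (\<integral>x. indicator (compat \<tau>) x * visit t D x \<tau> \<partial>lborel))"
        unfolding f_def using int intd[OF compat_sets compat_I]
        by (simp add: Bochner_Integration.integral_add)
      also have "\<dots> \<le> (1 - \<gamma>) * f t + \<gamma> * (e * a \<sigma> + e * a \<tau>)"
        using \<gamma> by (intro add_left_mono mult_left_mono add_mono I) auto
      finally show ?thesis .
    qed
    then have le: "\<exists>n. \<forall>t\<ge>n. f (t + M) \<le> (1 - \<gamma>) * f t + \<gamma> * (e * a \<sigma> + e * a \<tau>)" by blast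
    have l1: "(\<lambda>t. f (t + M)) \<longlonglongrightarrow> L" using LIMSEQ_ignore_initial_segment[OF L] .
    have l2: "(\<lambda>t. (1 - \<gamma>) * f t + \<gamma> * (e * a \<sigma> + e * a \<tau>)) \<longlonglongrightarrow> (1 - \<gamma>) * L + \<gamma> * (e * a \<sigma> + e * a \<tau>)"
      by (intro tendsto_intros L)
    have "L \<le> (1 - \<gamma>) * L + \<gamma> * (e * a \<sigma> + e * a \<tau>)" by (rule LIMSEQ_le[OF l1 l2 le])
    \<comment> \<open>\<gamma> cancels here, so it does no harm that \<open>M\<close> depends on
      \<open>e\<close>.\<close>
    then have "\<gamma> * L \<le> \<gamma> * (e * (a \<sigma> + a \<tau>))" by (simp add: algebra_simps)
    then show ?thesis using mult_le_cancel_left_pos[OF \<gamma>(1)] by blast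
  qed
  have apos: "0 < a \<sigma> + a \<tau>" using q height_pos by (auto simp: a_def intro!: add_pos_pos)
  have "L \<le> 0"
  proof (rule ccontr)
    assume "\<not> L \<le> 0"
    \<comment> \<open>With this value of \<open>e\<close> the bound on \<open>L\<close> becomes L /
      2.\<close>
    then have "0 < L / (2 * (a \<sigma> + a \<tau>))" using apos by simp
    from L_le[OF this] have "L \<le> L / (2 * (a \<sigma> + a \<tau>)) * (a \<sigma> + a \<tau>)" .
    also have "L / (2 * s) * s = L / 2" if "0 < s" for s using that by simp
    note this[OF apos]
    finally show False using \<open>\<not> L \<le> 0\<close> by simp
  qed
  moreover have "0 \<le> L" using LIMSEQ_le_const[OF L] nonneg by blast
  ultimately show ?thesis using L by (simp add: f_def[abs_def])
qed

text \<open>\<open>apart\<close> decreases in time, so a nonnegative limit exists at every point;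
  its integral over the common points vanishes.\<close>

lemma AE_apart_tendsto_0:
  "AE x in lborel. \<forall>\<sigma> \<tau>. x \<in> compat \<sigma> \<longrightarrow> x \<in> compat \<tau> \<longrightarrow> (\<lambda>t. apart t x \<sigma> \<tau>) \<longlonglongrightarrow> 0"
proof -
  have "AE x in lborel. x \<in> compat \<sigma> \<longrightarrow> x \<in> compat \<tau> \<longrightarrow> (\<lambda>t. apart t x \<sigma> \<tau>) \<longlonglongrightarrow> 0" for \<sigma> \<tau>
  proof -
    let ?C = "compat \<sigma> \<inter> compat \<tau>"
    have C: "?C \<in> sets borel" "?C \<subseteq> {0..c}" using compat_I[of \<sigma>] by auto
    define g where "g x = lim (\<lambda>t. apart t x \<sigma> \<tau>)" for x
    have conv: "(\<lambda>t. apart t x \<sigma> \<tau>) \<longlonglongrightarrow> g x" for x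
    proof -
      have "\<exists>L. (\<lambda>t. apart t x \<sigma> \<tau>) \<longlonglongrightarrow> L"
      proof -
        have "decseq (\<lambda>t. apart t x \<sigma> \<tau>)" "\<forall>t. 0 \<le> apart t x \<sigma> \<tau>" using apart_antimono apart_bounds(1) by (auto simp: decseq_def)
        then show ?thesis using decseq_convergent by metis
      qed
      then show ?thesis unfolding g_def by (simp add: convergent_LIMSEQ_iff[symmetric] convergent_def)
    qed
    have g01: "0 \<le> g x" "g x \<le> 1" for x
      using LIMSEQ_le_const[OF conv, of 0] LIMSEQ_le_const2[OF conv, of _ 1] apart_bounds by blast+
    have [measurable]: "g \<in> borel_measurable borel" unfolding g_def by measurable
    have intg: "integrable lborel (\<lambda>x. indicator ?C x * g x)"
      by (rule integrable_bounded_I[where b = 1, OF _ _ C]) (use g01 in auto)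
    have "(\<lambda>t. \<integral>x. indicator ?C x * apart t x \<sigma> \<tau> \<partial>lborel) \<longlonglongrightarrow> (\<integral>x. indicator ?C x * g x \<partial>lborel)"
    proof (rule integral_dominated_convergence[where w = "indicator ?C"])
      show "integrable lborel (indicator ?C :: real \<Rightarrow> real)"
        using integrable_bounded_I[of "\<lambda>_. 1" 1, OF _ _ C] by simp
      show "AE x in lborel. (\<lambda>t. indicator ?C x * apart t x \<sigma> \<tau>) \<longlonglongrightarrow> indicator ?C x * g x"
        by (intro AE_I2 tendsto_intros conv)
    qed (use apart_bounds in \<open>auto simp: indicator_def\<close>)
    then have "(\<integral>x. indicator ?C x * g x \<partial>lborel) = 0" using apart_integral_tendsto_0 LIMSEQ_unique by blast
    then have "AE x in lborel. indicator ?C x * g x = 0"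
      by (subst (asm) integral_nonneg_eq_0_iff_AE[OF intg]) (auto simp: g01)
    then show ?thesis
    proof eventually_elim
      fix x assume 0: "indicator ?C x * g x = 0"
      show "x \<in> compat \<sigma> \<longrightarrow> x \<in> compat \<tau> \<longrightarrow> (\<lambda>t. apart t x \<sigma> \<tau>) \<longlonglongrightarrow> 0"
        using 0 conv[of x] by (auto simp: indicator_def)
    qed
  qed
  then show ?thesis by (simp only: AE_all_countable simp_thms)
qed

end

lemma abs_diff_le_double:
  fixes a a' b :: real
  assumes "\<bar>a\<bar> \<le> b" "\<bar>a'\<bar> \<le> b" shows "\<bar>a - a'\<bar> \<le> 2 * b"
  using assms by linarith

lemma pred_eq_countable:
  fixes f g :: "'a \<Rightarrow> 'b::countable"
  assumes f: "f \<in> M \<rightarrow>\<^sub>M count_space UNIV" and g: "g \<in> M \<rightarrow>\<^sub>M count_space UNIV"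
  shows "Measurable.pred M (\<lambda>x. f x = g x)"
proof (rule measurable_compose_countable[where f = "\<lambda>s x. f x = s", OF _ g])
  show "Measurable.pred M (\<lambda>x. f x = s)" for s using measurable_compose[OF f, of "\<lambda>y. y = s"] by simp
qed

lemma measurable_into_K:
  assumes "f \<in> M \<rightarrow>\<^sub>M bernoulli_measure" "g \<in> borel_measurable M" "h \<in> borel_measurable M"
  shows "(\<lambda>x. (f x, g x, h x)) \<in> M \<rightarrow>\<^sub>M K"
  using assms by (intro measurable_Pair) (simp_all cong: measurable_cong_sets)

context beta_expansion
begin

section \<open>Recovering the height\<close>

text \<open>The state driven by a given stream; its mean over random streams brings back
  \<open>apart\<close>.\<close>

primrec run :: "nat \<Rightarrow> bool stream \<Rightarrow> real \<Rightarrow> bool \<times> bool list \<Rightarrow> bool \<times> bool list" where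
  "run 0 \<eta> x \<sigma> = \<sigma>"
| "run (Suc t) \<eta> x \<sigma> = run t (stl \<eta>) (R_fibre \<beta> (shd \<eta>) x) (step \<sigma> x (shd \<eta>))"

lemma run_measurable: "(\<lambda>u. run t (fst u) (snd u) \<sigma>) \<in> bernoulli_measure \<Otimes>\<^sub>M borel \<rightarrow>\<^sub>M count_space UNIV"
proof (induction t arbitrary: \<sigma>)
  case (Suc t)
  let ?M = "bernoulli_measure \<Otimes>\<^sub>M borel :: (bool stream \<times> real) measure"
  have 1: "(\<lambda>u. run t (stl (fst u)) (R_fibre \<beta> i (snd u)) s) \<in> ?M \<rightarrow>\<^sub>M count_space UNIV" for i s
  proof -
    have "(\<lambda>u. (stl (fst u), R_fibre \<beta> i (snd u))) \<in> ?M \<rightarrow>\<^sub>M ?M" by measurable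
    from measurable_compose[OF this Suc[of s]] show ?thesis by simp
  qed
  have 2: "(\<lambda>u. run t (stl (fst u)) (R_fibre \<beta> i (snd u)) (step \<sigma> (snd u) i)) \<in> ?M \<rightarrow>\<^sub>M count_space UNIV" for i
    by (rule measurable_compose_countable[where f = "\<lambda>s u. run t (stl (fst u)) (R_fibre \<beta> i (snd u)) s", OF 1])
      (rule measurable_compose[OF measurable_snd step_measurable])
  have sh: "(\<lambda>u. shd (fst u)) \<in> ?M \<rightarrow>\<^sub>M count_space UNIV" by measurable
  show ?case unfolding run.simps
    by (rule measurable_compose_countable[where f = "\<lambda>i u. run t (stl (fst u)) (R_fibre \<beta> i (snd u)) (step \<sigma> (snd u) i)", OF 2 sh])
qed simp

lemma nn_integral_run:
  "(\<integral>\<^sup>+\<eta>. of_bool (run t \<eta> x \<sigma> \<noteq> run t \<eta> x \<tau>) \<partial>bernoulli_measure) = ennreal (apart t x \<sigma> \<tau>)"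
proof (induction t arbitrary: x \<sigma> \<tau>)
  case 0
  then show ?case using bernoulli.emeasure_space_1 by simp
next
  case (Suc t)
  have "(\<lambda>\<eta>. run n \<eta> x \<rho>) \<in> bernoulli_measure \<rightarrow>\<^sub>M count_space UNIV" for n \<rho>
    using measurable_compose[OF measurable_Pair2'[of x borel bernoulli_measure] run_measurable] by simp
  then have [measurable]: "Measurable.pred bernoulli_measure (\<lambda>\<eta>. run (Suc t) \<eta> x \<sigma> \<noteq> run (Suc t) \<eta> x \<tau>)"
    by (intro pred_intros_logic pred_eq_countable)
  have "(\<lambda>\<eta>. of_bool (run (Suc t) \<eta> x \<sigma> \<noteq> run (Suc t) \<eta> x \<tau>) :: ennreal) \<in> borel_measurable bernoulli_measure"
    unfolding of_bool_def by measurable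
  from nn_integral_bernoulli[OF this] show ?case
    using apart_bounds(1) by (simp add: Suc ennreal_mult'[symmetric] ennreal_plus[symmetric] field_simps del: ennreal_plus ennreal_half)
qed

lemma S_pow_G: "z \<in> G \<Longrightarrow> (S ^^ k) z \<in> G"
  using S_G by (induction k) auto

lemma st_S_pow: "z \<in> G \<Longrightarrow> st ((S ^^ t) z) = run t (fst z) (fst (snd z)) (st z)"
proof (induction t arbitrary: z)
  case (Suc t)
  have "(fst z, fst (snd z), snd (snd z)) \<in> ocell (st z)" using ocell_st Suc.prems by simp
  note o = S_ocell[OF this]
  have "S z \<in> G" using S_G Suc.prems by blast
  from Suc.IH[OF this] show ?case using o st_ocell by (simp add: funpow_Suc_right del: funpow.simps)
qed simp

lemma pr_S_pow_cong: "z \<in> G \<Longrightarrow> z' \<in> G \<Longrightarrow> pr z = pr z' \<Longrightarrow> pr ((S ^^ t) z) = pr ((S ^^ t) z')"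
  using pr_S S_pow_G by (induction t) auto

text \<open>Equal projections and equal states stay equal, so the same branch acts on both points at
  every step. The distance is at most the height of a cell at the start and shrinks by 2 \<beta> > 2
  each time.\<close>

lemma S_pow_contracts:
  assumes "z \<in> G" "z' \<in> G" "pr z = pr z'" "st z = st z'"
  shows "\<bar>snd (snd ((S ^^ k) z)) - snd (snd ((S ^^ k) z'))\<bar> \<le> (1/2) ^ k"
  using assms
proof (induction k arbitrary: z z')
  case 0
  obtain b w where s: "st z = (b, w)" by (cases "st z")
  have "z \<in> ocell (b, w)" "z' \<in> ocell (b, w)" using 0 ocell_st s by metis+
  then have "\<bar>snd (snd z) - snd (snd z')\<bar> \<le> height w"
    by (cases z; cases z'; cases b) (auto simp: mem_ocell flip_eq mem_cell)
  then show ?case using height_le1[of w] by simp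
next
  case (Suc k)
  obtain \<eta> x y y' where z: "z = (\<eta>, x, y)" "z' = (\<eta>, x, y')" using Suc.prems(3) by (cases z; cases z') auto
  have n: "(S ^^ n) z \<in> G" "(S ^^ n) z' \<in> G" for n using S_pow_G Suc.prems by auto
  have "pr ((S ^^ k) z) = pr ((S ^^ k) z')" using pr_S_pow_cong Suc.prems by blast
  then obtain \<eta>1 x1 y1 y1' where z1: "(S ^^ k) z = (\<eta>1, x1, y1)" "(S ^^ k) z' = (\<eta>1, x1, y1')"
    by (cases "(S ^^ k) z"; cases "(S ^^ k) z'") auto
  have st: "st ((S ^^ k) z) = st ((S ^^ k) z')" using st_S_pow Suc.prems by (simp add: z)
  define \<sigma> where "\<sigma> = st ((S ^^ k) z)"
  have "(S ^^ k) z \<in> ocell \<sigma>" "(S ^^ k) z' \<in> ocell \<sigma>"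
    using ocell_st[OF n(1)[of k]] ocell_st[OF n(2)[of k]] st unfolding \<sigma>_def by simp_all
  then have "(\<eta>1, x1, y1) \<in> ocell \<sigma>" "(\<eta>1, x1, y1') \<in> ocell \<sigma>" unfolding z1 .
  from S_contracts[OF this] have "\<bar>snd (snd ((S ^^ Suc k) z)) - snd (snd ((S ^^ Suc k) z'))\<bar> = \<bar>y1 - y1'\<bar> / (2 * \<beta>)"
    by (simp add: z1)
  also have "\<dots> \<le> \<bar>y1 - y1'\<bar> / 2" using beta1 by (intro divide_left_mono) auto
  also have "\<dots> \<le> (1/2) ^ Suc k" using Suc.IH[OF Suc.prems] by (simp add: z1)
  finally show ?case .
qed

section \<open>A section of the tower and the estimate of the height\<close>

lemma ex_long_piece: "\<exists>w. c / 2 < r \<beta> w"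
proof (rule ccontr)
  assume no: "\<not> ?thesis"
  \<comment> \<open>As long as the ends stay below c / 2 < c / \<beta>, digit 0 multiplies them by
    \<beta>, so they would be unbounded.\<close>
  have "r \<beta> (replicate n False) = \<beta> ^ n" for n
  proof (induction n)
    case (Suc n)
    have "r \<beta> (replicate n False) \<le> c / 2" using no by (simp add: not_less)
    also have "c / 2 \<le> c / \<beta>" using beta1 beta2 c1 by (intro divide_left_mono) auto
    finally have "\<not> act1 False (r \<beta> (replicate n False))" by (simp add: act1_def)
    moreover have "replicate (Suc n) False = replicate n False @ [False]" by (simp add: replicate_append_same)
    ultimately show ?case using Suc by (simp add: r_snoc_act1)
  qed (simp add: r_Nil)
  then have "\<beta> ^ n * 1 \<le> c" for n using r_I[of "replicate n False"] by auto
  then show False using power_growth_bounded[of 1] by simp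
qed

text \<open>A piece longer than half of the interval covers the interval together with its mirror
  image. So two states suffice to choose, measurably, a point of the tower over every x.\<close>

definition long_word :: "bool list" where "long_word = (SOME w. c / 2 < r \<beta> w)"

lemma long_word: "c / 2 < r \<beta> long_word"
  unfolding long_word_def using ex_long_piece by (rule someI_ex)

definition section_state :: "real \<Rightarrow> bool \<times> bool list" where
  "section_state x = (c / 2 < x, long_word)"

definition tower_section :: "bool stream \<times> real \<Rightarrow> bool stream \<times> real \<times> real" where
  "tower_section = (\<lambda>(\<eta>, x). (\<eta>, x, (if c / 2 < x then - 1 else 1) * (v \<beta> long_word + height long_word / 2)))"

lemma section_compat: "x \<in> {0..c} \<Longrightarrow> x \<in> compat (section_state x)"
  using long_word by (auto simp: compat_def section_state_def mirror_def)

lemma section_ocell: "x \<in> {0..c} \<Longrightarrow> tower_section (\<eta>, x) \<in> ocell (section_state x)"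
  using compat_ocell[OF section_compat, of x \<eta>] by (simp add: section_state_def tower_section_def)

lemma section_G: "x \<in> {0..c} \<Longrightarrow> tower_section (\<eta>, x) \<in> G"
  using section_ocell unfolding G_def by blast

lemma section_measurable: "tower_section \<in> bernoulli_measure \<Otimes>\<^sub>M \<nu> \<rightarrow>\<^sub>M N1"
proof -
  have id: "(\<lambda>x. x) \<in> \<nu> \<rightarrow>\<^sub>M borel"
  proof -
    have "(\<lambda>x. x) \<in> restrict_space borel {0..c} \<rightarrow>\<^sub>M (borel :: real measure)" by (rule measurable_restrict_space1) simp
    then show ?thesis using sets_\<nu> by (simp cong: measurable_cong_sets)
  qed
  have sn: "(\<lambda>u. snd u) \<in> bernoulli_measure \<Otimes>\<^sub>M \<nu> \<rightarrow>\<^sub>M borel" using measurable_compose[OF measurable_snd id] .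
  have "(\<lambda>x. (if c / 2 < x then - 1 else 1) * (v \<beta> long_word + height long_word / 2)) \<in> borel_measurable borel" by measurable
  note y = measurable_compose[OF sn this]
  have "tower_section = (\<lambda>u. (fst u, snd u, (if c / 2 < snd u then - 1 else 1) * (v \<beta> long_word + height long_word / 2)))"
    by (auto simp: tower_section_def)
  also have "\<dots> \<in> bernoulli_measure \<Otimes>\<^sub>M \<nu> \<rightarrow>\<^sub>M K" by (rule measurable_into_K[OF measurable_fst sn y])
  finally have K: "tower_section \<in> bernoulli_measure \<Otimes>\<^sub>M \<nu> \<rightarrow>\<^sub>M K" .
  have sp: "space \<nu> = {0..c}" using sets_eq_imp_space_eq[OF sets_\<nu>] by simp
  have "tower_section u \<in> E \<beta> \<union> E_bar \<beta>" if "u \<in> space (bernoulli_measure \<Otimes>\<^sub>M \<nu>)" for u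
    using that section_G[of "snd u" "fst u"] G_subset by (auto simp: space_pair_measure sp)
  then have "tower_section \<in> bernoulli_measure \<Otimes>\<^sub>M \<nu> \<rightarrow>\<^sub>M N0" unfolding lambda_tilde_def
    by (intro measurable_restrict_space2 K) auto
  then show ?thesis by (simp add: sets_N1 cong: measurable_cong_sets)
qed

text \<open>Almost sure merging passes from Lebesgue measure to the tower because x has an
  absolutely continuous law there.\<close>

lemma uncoalesced_tendsto_0:
  "(\<lambda>t. \<integral>z. apart t (fst (snd z)) (st z) (section_state (fst (snd z))) \<partial>N1) \<longlonglongrightarrow> 0"
  and uncoalesced_measurable: "(\<lambda>z. apart t (fst (snd z)) (st z) (section_state (fst (snd z)))) \<in> borel_measurable N1"
proof -
  interpret N1: prob_space N1 by (rule prob_space_N1)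
  let ?f = "\<lambda>t z. apart t (fst (snd z)) (st z) (section_state (fst (snd z)))"
  show m: "?f t \<in> borel_measurable N1" for t
  proof (rule measurable_N1)
    have ss: "(\<lambda>z. section_state (fst (snd z))) \<in> K \<rightarrow>\<^sub>M count_space UNIV"
    proof -
      have "(\<lambda>z. if c / 2 < fst (snd z) then (True, long_word) else (False, long_word)) \<in> K \<rightarrow>\<^sub>M count_space UNIV" by measurable
      moreover have "(\<lambda>z :: bool stream \<times> real \<times> real. section_state (fst (snd z))) = (\<lambda>z. if c / 2 < fst (snd z) then (True, long_word) else (False, long_word))"
        by (auto simp: section_state_def)
      ultimately show ?thesis by simp
    qed
    have xm: "(\<lambda>z. fst (snd z)) \<in> borel_measurable K" by measurable
    have 1: "(\<lambda>z. apart t (fst (snd z)) s s') \<in> borel_measurable K" for s s'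
      using measurable_compose[OF xm apart_measurable] .
    have 2: "(\<lambda>z. apart t (fst (snd z)) s (section_state (fst (snd z)))) \<in> borel_measurable K" for s
      by (rule measurable_compose_countable[where f = "\<lambda>s' z. apart t (fst (snd z)) s s'", OF 1 ss])
    show "?f t \<in> borel_measurable K"
      by (rule measurable_compose_countable[where f = "\<lambda>s z. apart t (fst (snd z)) s (section_state (fst (snd z)))", OF 2 st_measurable])
  qed
  have "(\<lambda>t. \<integral>z. ?f t z \<partial>N1) \<longlonglongrightarrow> (\<integral>z. 0 \<partial>N1)"
  proof (rule integral_dominated_convergence[where w = "\<lambda>_. 1"])
    show "AE z in N1. (\<lambda>t. ?f t z) \<longlonglongrightarrow> 0"
      using AE_lborel_N1[OF AE_apart_tendsto_0] AE_G
    proof eventually_elim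
      fix z assume a: "\<forall>\<sigma> \<tau>. fst (snd z) \<in> compat \<sigma> \<longrightarrow> fst (snd z) \<in> compat \<tau> \<longrightarrow> (\<lambda>t. apart t (fst (snd z)) \<sigma> \<tau>) \<longlonglongrightarrow> 0"
        and z: "z \<in> G"
      have "fst (snd z) \<in> compat (st z)" using ocell_compat[of "fst z" "fst (snd z)" "snd (snd z)"] ocell_st[OF z] by simp
      moreover have "fst (snd z) \<in> compat (section_state (fst (snd z)))" using calculation compat_I by (intro section_compat) blast
      ultimately show "(\<lambda>t. ?f t z) \<longlonglongrightarrow> 0" using a by blast
    qed
  qed (use m apart_bounds in auto)
  then show "(\<lambda>t. \<integral>z. ?f t z \<partial>N1) \<longlonglongrightarrow> 0" by simp
qed

text \<open>
  Started from a point of the tower chosen over the projection of the \<open>k\<close>-th preimage, \<open>k\<close> steps of the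
  map approximate the height of the point itself.
\<close>

definition estimate :: "nat \<Rightarrow> bool stream \<times> real \<Rightarrow> real" where
  "estimate k u = snd (snd ((S ^^ k) (tower_section u)))"

lemma N1_bounded: "z \<in> space N1 \<Longrightarrow> \<bar>snd (snd z)\<bar> \<le> c + 1"
  using space_bounded by (fastforce simp: space_N1 space_N0)

lemma S_pow_measurable: "S ^^ k \<in> N1 \<rightarrow>\<^sub>M N1"
proof (induction k)
  case (Suc k)
  show ?case using measurable_comp[OF Suc S_N1(3)] by (simp add: comp_def)
qed (simp add: measurable_ident)

lemma height_measurable: "(\<lambda>z. snd (snd z)) \<in> borel_measurable N1"
  by (rule measurable_N1) measurable

lemma estimate_measurable: "estimate k \<in> borel_measurable (bernoulli_measure \<Otimes>\<^sub>M \<nu>)"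
  unfolding estimate_def[abs_def]
  using measurable_compose[OF measurable_compose[OF section_measurable S_pow_measurable] height_measurable] .

lemma estimate_bounded: "u \<in> space (bernoulli_measure \<Otimes>\<^sub>M \<nu>) \<Longrightarrow> \<bar>estimate k u\<bar> \<le> c + 1"
  unfolding estimate_def
  by (rule N1_bounded) (rule measurable_space[OF S_pow_measurable measurable_space[OF section_measurable]])

text \<open>If the point of the section and \<open>z\<close> have the same state after
  \<open>t\<close> steps, the remaining \<open>k\<close> steps contract their distance. Otherwise
  both heights are bounded by c + 1.\<close>

lemma estimate_error:
  assumes "z \<in> G"
  shows "\<bar>estimate (t + k) (pr z) - snd (snd ((S ^^ (t + k)) z))\<bar> \<le>
    (1/2) ^ k + 2 * (c + 1) * of_bool (run t (fst z) (fst (snd z)) (st z) \<noteq> run t (fst z) (fst (snd z)) (section_state (fst (snd z))))"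
proof -
  obtain \<eta> x y where z: "z = (\<eta>, x, y)" by (cases z)
  have x: "x \<in> {0..c}" using ocell_I[of \<eta> x y "st z"] ocell_st[OF assms] by (simp add: z)
  define z' where "z' = tower_section (\<eta>, x)"
  have z'G: "z' \<in> G" using section_G[OF x] by (simp add: z'_def)
  have pr: "pr z' = pr z" by (simp add: z z'_def tower_section_def)
  have st': "st z' = section_state x" using st_ocell section_ocell[OF x] by (simp add: z'_def)
  have e: "estimate (t + k) (pr z) = snd (snd ((S ^^ (t + k)) z'))" by (simp add: estimate_def z'_def z)
  have sp: "(S ^^ n) z \<in> space N1" "(S ^^ n) z' \<in> space N1" for n
    using S_pow_G[OF assms] S_pow_G[OF z'G] G_subset by (auto simp: space_N1 space_N0)
  show ?thesis
  proof (cases "run t \<eta> x (st z) = run t \<eta> x (section_state x)")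
    case True
    have p': "fst z' = \<eta>" "fst (snd z') = x" by (auto simp: z'_def tower_section_def)
    have "st ((S ^^ t) z') = st ((S ^^ t) z)"
      unfolding st_S_pow[OF z'G] st_S_pow[OF assms] st' p' using True by (simp add: z)
    moreover have "pr ((S ^^ t) z') = pr ((S ^^ t) z)" using pr_S_pow_cong[OF z'G assms pr] .
    ultimately have "\<bar>snd (snd ((S ^^ k) ((S ^^ t) z'))) - snd (snd ((S ^^ k) ((S ^^ t) z)))\<bar> \<le> (1/2) ^ k"
      using S_pow_contracts[OF S_pow_G[OF z'G] S_pow_G[OF assms]] by blast
    then have "\<bar>snd (snd ((S ^^ (t + k)) z')) - snd (snd ((S ^^ (t + k)) z))\<bar> \<le> (1/2) ^ k"
      by (simp add: funpow_add[of k t] add.commute[of t k])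
    then show ?thesis using True unfolding e by (simp add: z)
  next
    case False
    have "\<bar>snd (snd ((S ^^ (t + k)) z')) - snd (snd ((S ^^ (t + k)) z))\<bar> \<le> 2 * (c + 1)"
      by (rule abs_diff_le_double[OF N1_bounded[OF sp(2)[of "t + k"]] N1_bounded[OF sp(1)[of "t + k"]]])
    then show ?thesis using False unfolding e by (simp add: z add_increasing)
  qed
qed

lemma run_N1_measurable:
  "(\<lambda>z. run t (fst z) (fst (snd z)) (st z)) \<in> K \<rightarrow>\<^sub>M count_space UNIV"
  "(\<lambda>z. run t (fst z) (fst (snd z)) (section_state (fst (snd z)))) \<in> K \<rightarrow>\<^sub>M count_space UNIV"
proof -
  have p: "(\<lambda>z. (fst z, fst (snd z))) \<in> K \<rightarrow>\<^sub>M bernoulli_measure \<Otimes>\<^sub>M borel" by measurable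
  have 1: "(\<lambda>z. run t (fst z) (fst (snd z)) s) \<in> K \<rightarrow>\<^sub>M count_space UNIV" for s
    using measurable_compose[OF p run_measurable[of t s]] by simp
  show "(\<lambda>z. run t (fst z) (fst (snd z)) (st z)) \<in> K \<rightarrow>\<^sub>M count_space UNIV"
    by (rule measurable_compose_countable[where f = "\<lambda>s z. run t (fst z) (fst (snd z)) s", OF 1 st_measurable])
  note 1[measurable]
  have "(\<lambda>z. if c / 2 < fst (snd z) then run t (fst z) (fst (snd z)) (True, long_word) else run t (fst z) (fst (snd z)) (False, long_word)) \<in> K \<rightarrow>\<^sub>M count_space UNIV"
    by measurable
  moreover have "(\<lambda>z :: bool stream \<times> real \<times> real. run t (fst z) (fst (snd z)) (section_state (fst (snd z)))) =
    (\<lambda>z. if c / 2 < fst (snd z) then run t (fst z) (fst (snd z)) (True, long_word) else run t (fst z) (fst (snd z)) (False, long_word))"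
    by (auto simp: section_state_def)
  ultimately show "(\<lambda>z. run t (fst z) (fst (snd z)) (section_state (fst (snd z)))) \<in> K \<rightarrow>\<^sub>M count_space UNIV" by (simp only:)
qed

text \<open>Given the state and x the stream is still random, so the integral over it is
  \<open>apart\<close>.\<close>

lemma integral_run:
  "(\<integral>\<^sup>+z. of_bool (run t (fst z) (fst (snd z)) (st z) \<noteq> run t (fst z) (fst (snd z)) (section_state (fst (snd z)))) \<partial>N1) =
    ennreal (\<integral>z. apart t (fst (snd z)) (st z) (section_state (fst (snd z))) \<partial>N1)"
proof -
  interpret N1: prob_space N1 by (rule prob_space_N1)
  let ?b = "\<lambda>z. of_bool (run t (fst z) (fst (snd z)) (st z) \<noteq> run t (fst z) (fst (snd z)) (section_state (fst (snd z)))) :: ennreal"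
  have "Measurable.pred K (\<lambda>z. run t (fst z) (fst (snd z)) (st z) \<noteq> run t (fst z) (fst (snd z)) (section_state (fst (snd z))))"
    using run_N1_measurable by (intro pred_intros_logic pred_eq_countable)
  then have bm: "?b \<in> borel_measurable K" unfolding of_bool_def by measurable
  have "(\<integral>\<^sup>+z. ?b z \<partial>N1) = (\<integral>\<^sup>+z. (\<integral>\<^sup>+\<eta>. ?b (\<eta>, snd z) \<partial>bernoulli_measure) \<partial>N1)"
    by (rule nn_integral_N1_average[OF bm])
  also have "\<dots> = (\<integral>\<^sup>+z. ennreal (apart t (fst (snd z)) (st z) (section_state (fst (snd z)))) \<partial>N1)"
  proof (rule nn_integral_cong)
    fix z
    have "st (\<eta>, snd z) = st z" for \<eta> using st_cong[of \<eta> "snd z" "fst z"] by simp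
    then show "(\<integral>\<^sup>+\<eta>. ?b (\<eta>, snd z) \<partial>bernoulli_measure) = ennreal (apart t (fst (snd z)) (st z) (section_state (fst (snd z))))"
      using nn_integral_run[of t "fst (snd z)" "st z" "section_state (fst (snd z))"] by simp
  qed
  also have "\<dots> = ennreal (\<integral>z. apart t (fst (snd z)) (st z) (section_state (fst (snd z))) \<partial>N1)"
    using apart_bounds uncoalesced_measurable
    by (intro nn_integral_eq_integral N1.integrable_const_bound[where B = 1]) auto
  finally show ?thesis .
qed

text \<open>The time is split: first \<open>t\<close> is fixed so that unmerged points contribute
  little, then the remaining steps are left to the contraction.\<close>

lemma estimate_tendsto:
  "(\<lambda>k. \<integral>z. \<bar>estimate k (pr z) - snd (snd ((S ^^ k) z))\<bar> \<partial>N1) \<longlonglongrightarrow> 0"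
proof (rule LIMSEQ_I)
  fix e :: real assume e: "0 < e"
  interpret N1: prob_space N1 by (rule prob_space_N1)
  let ?I = "\<lambda>t. \<integral>z. apart t (fst (snd z)) (st z) (section_state (fst (snd z))) \<partial>N1"
  have "(\<lambda>t. 2 * (c + 1) * ?I t) \<longlonglongrightarrow> 2 * (c + 1) * 0" by (intro tendsto_intros uncoalesced_tendsto_0)
  then have "eventually (\<lambda>t. 2 * (c + 1) * ?I t < e / 2) sequentially" using e by (intro order_tendstoD(2)) auto
  then obtain t where t: "2 * (c + 1) * ?I t < e / 2" by (auto simp: eventually_sequentially)
  have "(\<lambda>k. (1/2 :: real) ^ k) \<longlonglongrightarrow> 0" by (rule LIMSEQ_realpow_zero) auto
  then have "eventually (\<lambda>k. (1/2 :: real) ^ k < e / 2) sequentially" using e by (intro order_tendstoD(2)) auto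
  then obtain k0 where k0: "\<And>k. k0 \<le> k \<Longrightarrow> (1/2 :: real) ^ k < e / 2" by (auto simp: eventually_sequentially)
  have I0: "0 \<le> ?I t" by (intro integral_nonneg_AE) (auto simp: apart_bounds)
  have bound: "(\<integral>z. \<bar>estimate (t + k) (pr z) - snd (snd ((S ^^ (t + k)) z))\<bar> \<partial>N1) \<le> (1/2) ^ k + 2 * (c + 1) * ?I t" for k
  proof -
    let ?d = "\<lambda>z. \<bar>estimate (t + k) (pr z) - snd (snd ((S ^^ (t + k)) z))\<bar>"
    let ?b = "\<lambda>z. run t (fst z) (fst (snd z)) (st z) \<noteq> run t (fst z) (fst (snd z)) (section_state (fst (snd z)))"
    have dm: "?d \<in> borel_measurable N1"
      using measurable_compose[OF pr_measurable[OF sets_\<nu>] estimate_measurable] measurable_compose[OF S_pow_measurable height_measurable]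
      by (intro borel_measurable_abs borel_measurable_diff) auto
    have db: "?d z \<le> 2 * (c + 1)" if "z \<in> space N1" for z
      by (rule abs_diff_le_double[OF estimate_bounded[OF measurable_space[OF pr_measurable[OF sets_\<nu>] that]]
            N1_bounded[OF measurable_space[OF S_pow_measurable that]]])
    have "Measurable.pred K ?b" using run_N1_measurable by (intro pred_intros_logic pred_eq_countable)
    then have "(\<lambda>z. of_bool (?b z) :: ennreal) \<in> borel_measurable K" unfolding of_bool_def by measurable
    then have bm: "(\<lambda>z. of_bool (?b z) :: ennreal) \<in> borel_measurable N1" by (rule measurable_N1)
    have "ennreal (\<integral>z. ?d z \<partial>N1) = (\<integral>\<^sup>+z. ennreal (?d z) \<partial>N1)"
      using dm db by (intro nn_integral_eq_integral[symmetric] N1.integrable_const_bound[where B = "2 * (c + 1)"]) auto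
    also have "\<dots> \<le> (\<integral>\<^sup>+z. ennreal ((1/2) ^ k) + ennreal (2 * (c + 1)) * of_bool (?b z) \<partial>N1)"
    proof (rule nn_integral_mono_AE, use AE_G in eventually_elim)
      fix z assume "z \<in> G"
      have "ennreal ((1/2) ^ k) + ennreal (2 * (c + 1)) * of_bool (?b z) = ennreal ((1/2) ^ k + 2 * (c + 1) * of_bool (?b z))"
        using c1 by (cases "?b z") (auto simp: ennreal_plus[symmetric] simp del: ennreal_plus)
      then show "ennreal (?d z) \<le> ennreal ((1/2) ^ k) + ennreal (2 * (c + 1)) * of_bool (?b z)"
        using estimate_error[OF \<open>z \<in> G\<close>, of t k] by (simp only: ennreal_leI)
    qed
    also have "\<dots> = ennreal ((1/2) ^ k) + ennreal (2 * (c + 1)) * ennreal (?I t)"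
      using bm N1.emeasure_space_1 by (subst nn_integral_add) (auto simp: nn_integral_cmult integral_run)
    also have "\<dots> = ennreal ((1/2) ^ k + 2 * (c + 1) * ?I t)"
      using c1 I0 by (simp add: ennreal_mult'[symmetric] ennreal_plus[symmetric] del: ennreal_plus)
    finally show ?thesis using c1 I0 by (subst (asm) ennreal_le_iff) auto
  qed
  show "\<exists>n0. \<forall>n\<ge>n0. norm ((\<integral>z. \<bar>estimate n (pr z) - snd (snd ((S ^^ n) z))\<bar> \<partial>N1) - 0) < e"
  proof (intro exI allI impI)
    fix n assume n: "t + k0 \<le> n"
    then have "(\<integral>z. \<bar>estimate n (pr z) - snd (snd ((S ^^ n) z))\<bar> \<partial>N1) \<le> (1/2) ^ (n - t) + 2 * (c + 1) * ?I t"
      using bound[of "n - t"] by simp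
    also have "\<dots> < e / 2 + e / 2" using t k0[of "n - t"] n by (intro add_strict_mono) auto
    also have "\<dots> = e" by simp
    finally show "norm ((\<integral>z. \<bar>estimate n (pr z) - snd (snd ((S ^^ n) z))\<bar> \<partial>N1) - 0) < e"
      by (simp add: integral_nonneg_AE)
  qed
qed

lemma natural_extension_N1: "natural_extension N1 S pr (bernoulli_measure \<Otimes>\<^sub>M \<nu>) (R_map \<beta>)"
proof -
  let ?X = "\<Inter>n. (S ^^ n) ` G"
  interpret N1: prob_space N1 by (rule prob_space_N1)
  interpret n: prob_space \<nu> by (rule prob_space_\<nu>)
  interpret pair_prob_space bernoulli_measure \<nu> ..
  \<comment> \<open>The projection and the height are together all coordinates of the tower, so they
    generate its sigma-algebra.\<close>
  have gen: "\<exists>A'\<in>sets ((bernoulli_measure \<Otimes>\<^sub>M \<nu>) \<Otimes>\<^sub>M borel). A = {z \<in> space N1. (pr z, snd (snd z)) \<in> A'}" if "A \<in> sets N1" for A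
  proof -
    let ?M = "(bernoulli_measure \<Otimes>\<^sub>M \<nu>) \<Otimes>\<^sub>M (borel :: real measure)"
    let ?q = "\<lambda>u :: (bool stream \<times> real) \<times> real. (fst (fst u), snd (fst u), snd u)"
    have A: "A \<in> sets K" "A \<subseteq> space N1" using that by (auto simp: sets_N1 sets_N0 space_N1 space_N0)
    have id: "(\<lambda>x. x) \<in> \<nu> \<rightarrow>\<^sub>M borel"
    proof -
      have "(\<lambda>x. x) \<in> restrict_space borel {0..c} \<rightarrow>\<^sub>M (borel :: real measure)" by (rule measurable_restrict_space1) simp
      then show ?thesis using sets_\<nu> by (simp cong: measurable_cong_sets)
    qed
    have "?q \<in> ?M \<rightarrow>\<^sub>M K"
      by (rule measurable_into_K[OF measurable_compose[OF measurable_fst measurable_fst]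
            measurable_compose[OF measurable_compose[OF measurable_fst measurable_snd] id] measurable_snd])
    from measurable_sets[OF this A(1)] have "?q -` A \<inter> space ?M \<in> sets ?M" .
    moreover have "A = {z \<in> space N1. (pr z, snd (snd z)) \<in> ?q -` A \<inter> space ?M}"
      using A(2) measurable_space[OF pr_measurable[OF sets_\<nu>]] by (fastforce simp: space_pair_measure pr_eq)
    ultimately show ?thesis by blast
  qed
  have "\<forall>A\<in>sets N1. \<exists>B\<in>sigma_sets ?X {(S ^^ k) ` (pr -` C \<inter> ?X) | k C. C \<in> sets (bernoulli_measure \<Otimes>\<^sub>M \<nu>)}. sym_diff A B \<in> null_sets N1"
    by (rule generated_mod_null[where u = estimate and Y = "\<lambda>z. snd (snd z)" and c = "c + 1", OF _ S_N1(3) S_N1(1) S_N1(2)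
          pr_measurable[OF sets_\<nu>] height_measurable estimate_measurable N1_bounded estimate_bounded estimate_tendsto gen])
      (rule N1.finite_measure_axioms)
  moreover have "mp_system (bernoulli_measure \<Otimes>\<^sub>M \<nu>) (R_map \<beta>)"
    unfolding mp_system_def using P.prob_space_axioms R_map_measurable[OF sets_\<nu>] R_map_\<nu> by blast
  moreover have "mp_system N1 S" unfolding mp_system_def using S_N1 prob_space_N1 by blast
  ultimately show ?thesis unfolding natural_extension_def using factor_map_pr S_N1(2) by blast
qed

end

theorem theorem5p1:
  fixes \<beta> :: real and \<mu> :: "real measure"
  assumes "1 < \<beta>" and "\<beta> < 2"
    and "prob_space \<mu>" and "sets \<mu> = sets (restrict_space borel (I_beta \<beta>))"
    and "absolutely_continuous (restrict_space lborel (I_beta \<beta>)) \<mu>"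
    and "mp_system (bernoulli_measure \<Otimes>\<^sub>M \<mu>) (R_map \<beta>)"
  shows "natural_extension
           (normalised (lambda_tilde \<beta>)) (psi_tilde \<beta>) (\<lambda>(\<omega>, x, y). (\<omega>, x))
           (bernoulli_measure \<Otimes>\<^sub>M \<mu>) (R_map \<beta>)"
proof -
  interpret beta_expansion \<beta> "1 / (\<beta> - 1)" by unfold_locales (use assms in auto)
  \<comment> \<open>Uniqueness identifies the given measure with the projection of the tower
    measure.\<close>
  have "\<mu> = \<nu>" by (rule invariant_eq_\<nu>) (use assms in \<open>auto simp: I_eq mp_system_def\<close>)
  then show ?thesis using natural_extension_N1 by simp
qed

end
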